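(* Let $S$ be the Sierpiński gasket, let $\Delta_\mu$ be its standard (Neumann) Laplacian, and let $\zeta_{\Delta_\mu}(s)=\sum_j\lambda_j^{-s/2}$ be its spectral zeta function (see the context). Let $R(z)=z(5-4z)$ and let $\zeta_{R,z_0}$ denote the zeta function of the polynomial $R$. Then $$\zeta_{\Delta_\mu}(s)=\zeta_{R,\frac34}(s)\cdot\frac{5^{-s/2}}{2}\left(\frac{1}{1-3\cdot5^{-s/2}}+\frac{3}{1-5^{-s/2}}\right)+\zeta_{R,\frac54}(s)\cdot\frac{5^{-s}}{2}\left(\frac{3}{1-3\cdot5^{-s/2}}-\frac{1}{1-5^{-s/2}}\right).$$ In particular, $\zeta_{\Delta_\mu}(s)$ has a meromorphic continuation to $\operatorname{Re}(s)>-\varepsilon$ for some $\varepsilon\ge1$. Its poles are contained in $$\left\{\frac{2in\pi}{\log5},\ \frac{\log9+2in\pi}{\log5}\ :\ n\in\mathbb Z\right\}.$$ Moreover $0<\frac{\log4}{\log5}=d_R<1<d_s=\frac{\log9}{\log5}<2$.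
   Context: **Sierpiński gasket.** Let $v_1,v_2,v_3$ be the vertices of a (nondegenerate) triangle in $\mathbb R^2$, $F_j(x)=\frac12(x+v_j)$, and let $S$ be the unique nonempty compact set with $S=F_1(S)\cup F_2(S)\cup F_3(S)$. Put $V_0=\{v_1,v_2,v_3\}$, $V_{n+1}=\bigcup_jF_j(V_n)$. Two distinct points $x,y\in V_n$ are neighbors, $x\sim y$, if they both belong to $F_{j_1}\circ\cdots\circ F_{j_n}(V_0)$ for some $j_1,\dots,j_n$. The discrete energy forms are $\mathcal E_n(f,f)=(5/3)^n\sum_{x\sim y}(f(y)-f(x))^2$ (sum over unordered pairs of neighbors in $V_n$); they are nondecreasing in $n$, and $\mathcal E(f,f)=\lim_n\mathcal E_n(f,f)$, with domain the continuous functions $f$ on $S$ for which this limit is finite ($\mathcal E(f,g)$ is defined by polarization). Let $\mu$ be the self-similar (normalized Hausdorff) probability measure on $S$ with $\mu(F_{j_1}\circ\cdots\circ F_{j_n}(S))=3^{-n}$. $\mathcal E$ is a local regular Dirichlet form on $L^2(S,\mu)$. **Laplacian.** The Laplacian is normalized by $\Delta_\mu f(x)=\lim_{n\to\infty}5^n\Delta_nf(x)$, where $\Delta_nf(x)=\frac14\sum_{y\in V_n,\,y\sim x}f(y)-f(x)$ for $x\in V_n\setminus V_0$. Equivalently, the Neumann Laplacian $\Delta_\mu$ is the self-adjoint operator on $L^2(S,\mu)$ such that $f\in\operatorname{Dom}\Delta_\mu$ and $\Delta_\mu f=u$ iff $f\in\operatorname{Dom}\mathcal E$ and $\mathcal E(f,g)=-6\int_Su\,g\,d\mu$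 for all $g\in\operatorname{Dom}\mathcal E$. $-\Delta_\mu$ is nonnegative with discrete spectrum. Its spectral zeta function is $\zeta_{\Delta_\mu}(s)=\sum_j\lambda_j^{-s/2}$, where $\lambda_j$ runs over the nonzero eigenvalues of $-\Delta_\mu$ counted with multiplicity; the series is considered for $\operatorname{Re}(s)>d_s$, where $d_s$ is the spectral dimension, i.e. the exponent such that the eigenvalue counting function $\rho(\lambda)=\#\{j:\lambda_j<\lambda\}$ satisfies $0<\liminf_{\lambda\to\infty}\rho(\lambda)\lambda^{-d_s/2}\le\limsup_{\lambda\to\infty}\rho(\lambda)\lambda^{-d_s/2}<\infty$. **Zeta function of $R$.** For $R(z)=z(5-4z)$ put $N=\deg R=2$, $c=R'(0)=5$, $d_R=\frac{2\log N}{\log c}$. For $z_0\in\{\frac34,\frac54\}$ and $\operatorname{Re}(s)>d_R$, $$\zeta_{R,z_0}(s)=\lim_{n\to\infty}\sum_{z\in R^{-n}\{z_0\}}(5^nz)^{-s/2},$$ where $R^{-n}\{z_0\}$ denotes the $2^n$ preimages of $z_0$ under the $n$-th iterate of $R$, counted with multiplicity (all of them are positive reals). The limit exists and is analytic in $s$ for $\operatorname{Re}(s)>d_R$. *)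

theory Defs
  imports
    "HOL-Complex_Analysis.Complex_Analysis"
    "HOL-Probability.Probability_Measure"
    "HOL-Library.Function_Algebras"
begin

section \<open>The gasket and its self-similar measure\<close>

text \<open>
  The vertices are a family \<^term>\<open>v :: 3 \<Rightarrow> real^2\<close> over the three-element index type \<^typ>\<open>3\<close>;
  the triangle is nondegenerate iff \<^term>\<open>\<not> collinear (range v)\<close>, which also makes the
  vertices distinct.
\<close>

definition gasket_map :: "(3 \<Rightarrow> real^2) \<Rightarrow> 3 \<Rightarrow> real^2 \<Rightarrow> real^2" where
  "gasket_map v j x = (1/2) *\<^sub>R (x + v j)"

fun gasket_word :: "(3 \<Rightarrow> real^2) \<Rightarrow> 3 list \<Rightarrow> real^2 \<Rightarrow> real^2" where
  "gasket_word v [] = id"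
| "gasket_word v (j # w) = gasket_map v j \<circ> gasket_word v w"

definition is_gasket :: "(3 \<Rightarrow> real^2) \<Rightarrow> (real^2) set \<Rightarrow> bool" where
  "is_gasket v S \<longleftrightarrow> compact S \<and> S \<noteq> {} \<and> S = (\<Union>j. gasket_map v j ` S)"

definition is_gasket_measure :: "(3 \<Rightarrow> real^2) \<Rightarrow> (real^2) set \<Rightarrow> (real^2) measure \<Rightarrow> bool" where
  "is_gasket_measure v S \<mu> \<longleftrightarrow>
     prob_space \<mu> \<and> sets \<mu> = sets (restrict_space borel S) \<and>
     (\<forall>w. measure \<mu> (gasket_word v w ` S) = 1 / 3 ^ length w)"

section \<open>Energy form\<close>

primrec gasket_vertices :: "(3 \<Rightarrow> real^2) \<Rightarrow> nat \<Rightarrow> (real^2) set" where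
  "gasket_vertices v 0 = range v"
| "gasket_vertices v (Suc n) = (\<Union>j. gasket_map v j ` gasket_vertices v n)"

definition gasket_nb :: "(3 \<Rightarrow> real^2) \<Rightarrow> nat \<Rightarrow> real^2 \<Rightarrow> real^2 \<Rightarrow> bool" where
  "gasket_nb v n x y \<longleftrightarrow>
     x \<in> gasket_vertices v n \<and> y \<in> gasket_vertices v n \<and> x \<noteq> y \<and>
     (\<exists>w. length w = n \<and> x \<in> gasket_word v w ` range v \<and> y \<in> gasket_word v w ` range v)"

text \<open>The energy sums over unordered pairs, hence the factor 1/2 in front of the sum over
  ordered pairs.\<close>

definition energy_level :: "(3 \<Rightarrow> real^2) \<Rightarrow> nat \<Rightarrow> (real^2 \<Rightarrow> real) \<Rightarrow> real" where
  "energy_level v n f =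
     (5/3) ^ n * (1/2 * (\<Sum>(x, y) | gasket_nb v n x y. (f y - f x)\<^sup>2))"

text \<open>Functions on the gasket are functions on the plane of which only the values on \<open>S\<close> matter.
  The level energies are nondecreasing, so finiteness of their limit is convergence.\<close>

definition energy_domain :: "(3 \<Rightarrow> real^2) \<Rightarrow> (real^2) set \<Rightarrow> (real^2 \<Rightarrow> real) set" where
  "energy_domain v S = {f. continuous_on S f \<and> convergent (\<lambda>n. energy_level v n f)}"

definition energy :: "(3 \<Rightarrow> real^2) \<Rightarrow> (real^2 \<Rightarrow> real) \<Rightarrow> real" where
  "energy v f = lim (\<lambda>n. energy_level v n f)"

definition energy_form :: "(3 \<Rightarrow> real^2) \<Rightarrow> (real^2 \<Rightarrow> real) \<Rightarrow> (real^2 \<Rightarrow> real) \<Rightarrow> real" where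
  "energy_form v f g = (energy v (\<lambda>x. f x + g x) - energy v (\<lambda>x. f x - g x)) / 4"

section \<open>Neumann Laplacian and its spectrum\<close>

text \<open>The graph of the Laplacian: \<open>f\<close> is in its domain and is mapped to \<open>u\<close>.\<close>

definition neumann_laplacian ::
  "(3 \<Rightarrow> real^2) \<Rightarrow> (real^2) set \<Rightarrow> (real^2) measure \<Rightarrow> (real^2 \<Rightarrow> real) \<Rightarrow> (real^2 \<Rightarrow> real) \<Rightarrow> bool" where
  "neumann_laplacian v S \<mu> f u \<longleftrightarrow>
     f \<in> energy_domain v S \<and>
     u \<in> borel_measurable \<mu> \<and> integrable \<mu> (\<lambda>x. (u x)\<^sup>2) \<and>
     (\<forall>g\<in>energy_domain v S. energy_form v f g = - 6 * (LINT x|\<mu>. u x * g x))"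

text \<open>The eigenfunctions of minus the Laplacian are normalized to vanish off \<open>S\<close>, so that
  functions agreeing on \<open>S\<close> are not counted separately. They are continuous on \<open>S\<close>, the support
  of the measure, so passing to classes modulo null sets would not identify any of them.\<close>

definition eigenspace ::
  "(3 \<Rightarrow> real^2) \<Rightarrow> (real^2) set \<Rightarrow> (real^2) measure \<Rightarrow> real \<Rightarrow> (real^2 \<Rightarrow> real) set" where
  "eigenspace v S \<mu> l =
     {f. neumann_laplacian v S \<mu> f (\<lambda>x. - (l * f x)) \<and> (\<forall>x. x \<notin> S \<longrightarrow> f x = 0)}"

definition eigen_mult ::
  "(3 \<Rightarrow> real^2) \<Rightarrow> (real^2) set \<Rightarrow> (real^2) measure \<Rightarrow> real \<Rightarrow> nat" where
  "eigen_mult v S \<mu> l = vector_space.dim (\<lambda>(c::real) f x. c * f x) (eigenspace v S \<mu> l)"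

text \<open>Index set of the nonzero eigenvalues counted with multiplicity; the eigenvalue belonging
  to the index \<open>j\<close> is \<open>fst j\<close>.\<close>

definition eigen_index ::
  "(3 \<Rightarrow> real^2) \<Rightarrow> (real^2) set \<Rightarrow> (real^2) measure \<Rightarrow> (real \<times> nat) set" where
  "eigen_index v S \<mu> = {(l, k). l \<noteq> 0 \<and> k < eigen_mult v S \<mu> l}"

definition eigen_term :: "complex \<Rightarrow> real \<times> nat \<Rightarrow> complex" where
  "eigen_term s j = complex_of_real (fst j) powr (- s / 2)"

definition spectral_zeta ::
  "(3 \<Rightarrow> real^2) \<Rightarrow> (real^2) set \<Rightarrow> (real^2) measure \<Rightarrow> complex \<Rightarrow> complex" where
  "spectral_zeta v S \<mu> s = (\<Sum>\<^sub>\<infinity>j\<in>eigen_index v S \<mu>. eigen_term s j)"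

definition eigen_count ::
  "(3 \<Rightarrow> real^2) \<Rightarrow> (real^2) set \<Rightarrow> (real^2) measure \<Rightarrow> real \<Rightarrow> nat" where
  "eigen_count v S \<mu> x = card {j \<in> eigen_index v S \<mu>. fst j < x}"

definition is_spectral_dim ::
  "(3 \<Rightarrow> real^2) \<Rightarrow> (real^2) set \<Rightarrow> (real^2) measure \<Rightarrow> real \<Rightarrow> bool" where
  "is_spectral_dim v S \<mu> d \<longleftrightarrow>
     0 < Liminf at_top (\<lambda>x. ereal (real (eigen_count v S \<mu> x) * x powr (- d / 2))) \<and>
     Limsup at_top (\<lambda>x. ereal (real (eigen_count v S \<mu> x) * x powr (- d / 2))) < \<infinity>"

definition spectral_dim :: "(3 \<Rightarrow> real^2) \<Rightarrow> (real^2) set \<Rightarrow> (real^2) measure \<Rightarrow> real" where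
  "spectral_dim v S \<mu> = (THE d. is_spectral_dim v S \<mu> d)"

section \<open>Zeta function of a polynomial\<close>

definition poly_iter :: "real poly \<Rightarrow> nat \<Rightarrow> real poly" where
  "poly_iter R n = (pcompose R ^^ n) [:0, 1:]"

text \<open>The preimages under the iterate are taken in the complex plane, with multiplicity.\<close>

definition poly_zeta_approx :: "real poly \<Rightarrow> real \<Rightarrow> complex \<Rightarrow> nat \<Rightarrow> complex" where
  "poly_zeta_approx R z0 s n =
     (\<Sum>z\<in>#proots (map_poly complex_of_real (poly_iter R n - [:z0:])).
        (complex_of_real (poly (pderiv R) 0 ^ n) * z) powr (- s / 2))"

definition poly_zeta :: "real poly \<Rightarrow> real \<Rightarrow> complex \<Rightarrow> complex" where
  "poly_zeta R z0 s = lim (poly_zeta_approx R z0 s)"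

definition poly_zeta_dim :: "real poly \<Rightarrow> real" where
  "poly_zeta_dim R = 2 * ln (real (degree R)) / ln (poly (pderiv R) 0)"

definition gasket_poly :: "real poly" where
  "gasket_poly = [:0, 1:] * [:5, -4:]"

end

theory Submission
  imports Defs
begin

text \<open>
  Spectral decimation: for \<open>l\<close> outside \<open>{1/2, 5/4, 3/2}\<close>, restriction to \<open>V\<^sub>n\<close> maps the \<open>l\<close>-eigenfunctions
  of the graph Laplacian on \<open>V\<^bsub>n+1\<^esub>\<close> bijectively to the \<open>R l\<close>-eigenfunctions on \<open>V\<^sub>n\<close>. An eigenfunction of the
  Laplacian on \<open>S\<close> restricts on all fine levels to graph eigenfunctions, whose eigenvalues satisfy
  \<open>R l\<^bsub>m+1\<^esub> = l\<^sub>m\<close>, with the small inverse branch for large \<open>m\<close>; it is recovered from any one of these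
  restrictions, and its eigenvalue is \<open>lim 5\<^sup>m l\<^sub>m\<close>. Going down the levels, the sequence of a nonzero eigenvalue
  ends in \<open>3/4\<close> or \<open>5/4\<close> on a level \<open>i + 1\<close>, where the eigenspaces have the dimensions
  \<open>(3\<^sup>i + 3) / 2\<close> and \<open>(3\<^sup>i - 1) / 2\<close>. Summing over the inverse orbits gives the product formula.

  Put \<open>t = 5 powr (- s / 2)\<close>. The functional equation of the Koenigs function of the small branch turns the zeta
  functions of \<open>R\<close> into series of iterates of the transfer operator of \<open>R\<close>, with leading eigenvalue \<open>2\<close>. On
  analytic functions the remainder contracts fast enough that \<open>\<zeta>\<^bsub>R,3/4\<^esub> - \<zeta>\<^bsub>R,5/4\<^esub>\<close> and \<open>(1 - 2 t) \<zeta>\<^bsub>R,5/4\<^esub>\<close>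
  continue to \<open>Re s > - 1\<close>. The coefficients of the two zeta functions add up to a multiple of \<open>1 - 2 t\<close>, so the
  poles with \<open>t = 1/2\<close> cancel, and only those with \<open>t = 1\<close> or \<open>t = 1/3\<close> remain.
\<close>

section \<open>Words, cells and vertices\<close>

text \<open>The equation of the graph Laplacian at a vertex is written as a sum over flags, that is,
  cells with a marked corner at this vertex. A corner of the triangle has one flag and every other
  vertex has two, so the Neumann condition is built in and no boundary case arises. For given
  \<open>l\<close> the sequence of graph eigenvalues is not extracted from an eigenfunction. It is
  prescribed, as the small-branch orbit of the point with Koenigs value \<open>l / 5 ^ n\<close>.
  Arbitrary data on level \<open>n\<close> extend along it to a function of finite energy that
  solves the weak equation up to a positive multiple of the residual of the data. Uniqueness is a
  Poincare-type estimate: a function of finite energy that vanishes on level \<open>n\<close> has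
  squared sup norm at most a constant times \<open>(3/5) ^ n\<close> times its energy. Bounding the
  transfer operator in sup norm by \<open>2 ^ k\<close> gives convergence only for
  \<open>Re s > ln 4 / ln 5\<close>. Constants carry the eigenvalue \<open>2\<close>, and
  differences between two points remove them; what is left decays like \<open>(2/5) ^ k\<close>. For
  \<open>Re s > - 1\<close> the modulus of \<open>t\<close> is at most \<open>sqrt 5\<close>, and
  \<open>2/5 * sqrt 5 < 1\<close>.\<close>

lemma three_wrap: "(4::3) = 1" "(5::3) = 2"
  by simp_all

text \<open>Indices are compared cyclically with a base index \<open>k\<close>, so that a statement
  about one corner covers all three by symmetry.\<close>

lemma three_cases:
  fixes i k :: 3
  obtains "i = k" | "i = k + 1" | "i = k + 2"
  using exhaust_3[of i] exhaust_3[of k] by fastforce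

lemma three_neq [simp]:
  fixes k :: 3
  shows "k + 1 \<noteq> k" "k + 2 \<noteq> k" "k + 1 \<noteq> k + 2" "k \<noteq> k + 1" "k \<noteq> k + 2" "k + 2 \<noteq> k + 1"
  unfolding add_left_cancel add_cancel_left_right add_cancel_right_right by simp_all

lemma three_add_add [simp]:
  fixes k :: 3
  shows "k + 1 + 1 = k + 2" "k + 1 + 2 = k" "k + 2 + 1 = k" "k + 2 + 2 = k + 1"
proof -
  have "(3::3) = 0" by simp
  then show "k + 1 + 1 = k + 2" "k + 1 + 2 = k" "k + 2 + 1 = k" "k + 2 + 2 = k + 1"
    unfolding add.assoc by simp_all
qed

lemma UNIV_three: "(UNIV :: 3 set) = {k, k + 1, k + 2}"
proof (rule set_eqI)
  fix i :: 3
  show "i \<in> UNIV \<longleftrightarrow> i \<in> {k, k + 1, k + 2}"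
    by (cases i k rule: three_cases) simp_all
qed

lemma sum_three: "(\<Sum>j\<in>UNIV. f j) = f k + f (k + 1) + f (k + 2)" for f :: "3 \<Rightarrow> 'a :: comm_monoid_add"
proof -
  have "sum f {k, k + 1, k + 2} = f k + f (k + 1) + f (k + 2)"
    by (simp add: add.assoc)
  then show ?thesis by (simp only: UNIV_three[of k])
qed

definition decimation :: "real \<Rightarrow> real" where
  "decimation l = l * (5 - 4 * l)"

text \<open>Twice the signed area of a triangle; quotients of such areas are barycentric
  coordinates.\<close>

definition area2 :: "real^2 \<Rightarrow> real^2 \<Rightarrow> real^2 \<Rightarrow> real" where
  "area2 a b c = (b$1 - a$1) * (c$2 - a$2) - (b$2 - a$2) * (c$1 - a$1)"

lemma area2_eq_0_imp_collinear:
  assumes "area2 a b c = 0"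
  shows "collinear {a, b, c}"
proof (cases "b = a")
  case True
  then show ?thesis by simp
next
  case False
  have eq: "(b$1 - a$1) * (c$2 - a$2) = (b$2 - a$2) * (c$1 - a$1)"
    using assms by (simp add: area2_def)
  have "\<exists>t. c - a = t *\<^sub>R (b - a)"
  proof (cases "b$1 = a$1")
    case True
    then have n: "b$2 \<noteq> a$2" using False by (auto simp: vec_eq_iff forall_2)
    then have "c$1 = a$1" using eq True by simp
    then show ?thesis using n True
      by (intro exI[of _ "(c$2 - a$2) / (b$2 - a$2)"]) (auto simp: vec_eq_iff forall_2)
  next
    case n: False
    let ?t = "(c$1 - a$1) / (b$1 - a$1)"
    have "(c$2 - a$2) = ?t * (b$2 - a$2)" "(c$1 - a$1) = ?t * (b$1 - a$1)"
      using eq n by (simp_all add: divide_simps mult.commute)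
    then show ?thesis
      by (intro exI[of _ ?t]) (simp add: vec_eq_iff forall_2)
  qed
  then have "collinear {0, b - a, c - a}"
    by (auto simp: collinear_lemma)
  then have "collinear {b, a, c}"
    by (subst collinear_3) auto
  then show ?thesis by (simp add: insert_commute)
qed

lemma gasket_word_append: "gasket_word v (u @ w) = gasket_word v u \<circ> gasket_word v w"
  by (induction u) (auto simp: comp_assoc)

lemma inj_gasket_map: "inj (gasket_map v j)"
  by (rule injI) (simp add: gasket_map_def)

lemma inj_gasket_word: "inj (gasket_word v w)"
proof (induction w)
  case (Cons i w)
  then show ?case
    unfolding gasket_word.simps by (intro inj_compose inj_gasket_map)
qed simp

lemma dist_gasket_map: "dist (gasket_map v j x) (gasket_map v j y) = dist x y / 2"
proof -
  have "gasket_map v j x - gasket_map v j y = (1/2) *\<^sub>R (x - y)"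
    by (simp add: gasket_map_def algebra_simps)
  then show ?thesis by (simp add: dist_norm)
qed

lemma dist_gasket_word: "dist (gasket_word v w x) (gasket_word v w y) = dist x y / 2 ^ length w"
  by (induction w) (auto simp: dist_gasket_map)

lemma continuous_on_gasket_word: "continuous_on A (gasket_word v w)"
proof -
  have "continuous_on UNIV (gasket_word v w)"
    by (induction w) (auto intro!: continuous_on_compose2[where t = UNIV] continuous_intros
        simp: gasket_map_def)
  then show ?thesis by (rule continuous_on_subset) simp
qed

definition words :: "nat \<Rightarrow> 3 list set" where
  "words n = {w. length w = n}"

lemma words_0 [simp]: "words 0 = {[]}"
  by (auto simp: words_def)

text \<open>Words grow on the right: \<open>gasket_word\<close> applies the last letter first, so
  appending a letter passes to a subcell, while prepending one would move the cell.\<close>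

lemma words_Suc: "words (Suc n) = (\<lambda>(w, i). w @ [i]) ` (words n \<times> UNIV)"
proof -
  have "\<exists>u i. w = u @ [i] \<and> length u = n" if "length w = Suc n" for w :: "3 list"
    using that by (intro exI[of _ "butlast w"] exI[of _ "last w"]) (cases w rule: rev_cases, auto)+
  then show ?thesis by (fastforce simp: words_def)
qed

lemma UN_words_Suc: "(\<Union>w\<in>words (Suc n). f w) = (\<Union>w\<in>words n. \<Union>i. f (w @ [i]))"
  unfolding words_Suc by (auto simp del: UN_simps)

lemma finite_words [simp]: "finite (words n)"
  by (induction n) (auto simp: words_Suc)

lemma card_words: "card (words n) = 3 ^ n"
proof (induction n)
  case (Suc n)
  have "card (words (Suc n)) = card (words n \<times> (UNIV :: 3 set))"
    unfolding words_Suc by (intro card_image inj_onI) auto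
  then show ?case using Suc by (simp add: card_cartesian_product)
qed simp

lemma sum_words_Suc: "(\<Sum>w\<in>words (Suc n). f w) = (\<Sum>w\<in>words n. \<Sum>i\<in>UNIV. f (w @ [i]))"
  for f :: "3 list \<Rightarrow> 'a :: comm_monoid_add"
proof -
  have "(\<Sum>w\<in>words (Suc n). f w) = (\<Sum>x\<in>words n \<times> UNIV. f ((\<lambda>(w, i). w @ [i]) x))"
    unfolding words_Suc by (intro sum.reindex_cong[OF _ refl refl] inj_onI) auto
  then show ?thesis by (simp add: sum.cartesian_product case_prod_unfold)
qed

section \<open>Barycentric coordinates\<close>

locale triangle =
  fixes v :: "3 \<Rightarrow> real^2"
  assumes nondegenerate: "\<not> collinear (range v)"
begin

text \<open>Barycentric coordinates are affine, so the geometry of an arbitrary nondegenerate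
  triangle turns into arithmetic: \<open>gasket_map v i\<close> halves all coordinates and adds 1/2
  to the one with index \<open>i\<close>.\<close>

definition bary :: "3 \<Rightarrow> real^2 \<Rightarrow> real" where
  "bary j x = area2 x (v (j + 1)) (v (j + 2)) / area2 (v 1) (v 2) (v 3)"

lemma area2_nz: "area2 (v 1) (v 2) (v 3) \<noteq> 0"
proof
  assume "area2 (v 1) (v 2) (v 3) = 0"
  then have "collinear {v 1, v 2, v 3}" by (rule area2_eq_0_imp_collinear)
  moreover have "range v = {v 1, v 2, v 3}" by (auto simp: UNIV_3)
  ultimately show False using nondegenerate by simp
qed

lemma bary_vertex: "bary j (v i) = (if i = j then 1 else 0)"
proof -
  \<comment> \<open>The signed area is invariant under cyclic permutations, which matches the fixed
    denominator with each of the three numerators.\<close>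
  have A: "area2 (v 1) (v 2) (v 3) = area2 (v 2) (v 3) (v 1)"
     "area2 (v 1) (v 2) (v 3) = area2 (v 3) (v 1) (v 2)"
     by (auto simp: area2_def algebra_simps)
  show ?thesis
    using exhaust_3[of j] exhaust_3[of i] area2_nz A
    by (elim disjE) (simp_all add: bary_def three_wrap, auto simp: area2_def)
qed

lemma bary_affine: "bary j ((1/2) *\<^sub>R (x + y)) = (bary j x + bary j y) / 2"
proof -
  have "area2 ((1/2) *\<^sub>R (x + y)) b c = (area2 x b c + area2 y b c) / 2" for b c
    by (simp add: area2_def algebra_simps)
  then show ?thesis by (simp add: bary_def add_divide_distrib)
qed

lemma bary_map: "bary j (gasket_map v i x) = (bary j x + (if i = j then 1 else 0)) / 2"
  by (simp add: gasket_map_def bary_affine bary_vertex)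

lemma sum_bary: "(\<Sum>j\<in>UNIV. bary j x) = 1"
proof -
  have "area2 x (v 2) (v 3) + area2 x (v 3) (v 1) + area2 x (v 1) (v 2) = area2 (v 1) (v 2) (v 3)"
    by (simp add: area2_def algebra_simps)
  then show ?thesis using area2_nz
    by (simp add: sum_3 bary_def three_wrap flip: add_divide_distrib)
qed

lemma bary_point: "x = (\<Sum>j\<in>UNIV. bary j x *\<^sub>R v j)"
proof -
  let ?A = "area2 (v 1) (v 2) (v 3)"
  have "?A * x $ i = area2 x (v 2) (v 3) * v 1 $ i + area2 x (v 3) (v 1) * v 2 $ i
      + area2 x (v 1) (v 2) * v 3 $ i" if "i = 1 \<or> i = 2" for i
    using that by (elim disjE) (simp_all add: area2_def algebra_simps)
  then have "x $ i = (area2 x (v 2) (v 3) * v 1 $ i + area2 x (v 3) (v 1) * v 2 $ i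
      + area2 x (v 1) (v 2) * v 3 $ i) / ?A" if "i = 1 \<or> i = 2" for i
    using that area2_nz by (simp add: field_simps)
  then show ?thesis
    using area2_nz by (simp add: vec_eq_iff forall_2 sum_3 bary_def three_wrap add_divide_distrib)
qed

lemma bary_eqI: "(\<And>j. bary j x = bary j y) \<Longrightarrow> x = y"
  by (subst bary_point[of x], subst bary_point[of y]) simp

lemma continuous_on_bary: "continuous_on A (bary j)"
  unfolding bary_def area2_def by (intro continuous_intros) (use area2_nz in \<open>auto simp: area2_def\<close>)

text \<open>The full triangle. How cells meet is studied on the images of \<open>tri\<close>, where
  membership is a system of inequalities; the cells of the gasket inherit the result.\<close>

definition tri :: "(real^2) set" where
  "tri = {x. \<forall>j. 0 \<le> bary j x}"

lemma vertex_in_tri [simp]: "v j \<in> tri"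
  by (simp add: tri_def bary_vertex)

lemma gasket_map_tri: "x \<in> tri \<Longrightarrow> gasket_map v i x \<in> tri"
  by (simp add: tri_def bary_map)

lemma gasket_word_tri: "x \<in> tri \<Longrightarrow> gasket_word v w x \<in> tri"
  by (induction w) (auto intro: gasket_map_tri)

lemma bary_le_1:
  assumes "x \<in> tri" shows "bary j x \<le> 1"
proof -
  have "bary j x + bary (j + 1) x + bary (j + 2) x = 1"
    using sum_bary[of x] by (simp add: sum_three[of _ j])
  moreover have "0 \<le> bary (j + 1) x" "0 \<le> bary (j + 2) x" using assms by (auto simp: tri_def)
  ultimately show ?thesis by linarith
qed

declare gasket_vertices.simps(2) [simp del]

section \<open>Corners of cells and intersections of cells\<close>

definition vtx :: "3 list \<Rightarrow> 3 \<Rightarrow> real^2" where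
  "vtx w j = gasket_word v w (v j)"

lemma vtx_Nil [simp]: "vtx [] j = v j"
  by (simp add: vtx_def)

lemma v_inj: "v i = v j \<Longrightarrow> i = j"
  using bary_vertex[of i i] bary_vertex[of i j] by (metis zero_neq_one)

lemma vtx_inj [simp]: "vtx w i = vtx w j \<longleftrightarrow> i = j"
  using v_inj by (auto simp: vtx_def dest: injD[OF inj_gasket_word])

text \<open>\<open>v i\<close> is the fixed point of \<open>gasket_map v i\<close>.\<close>

lemma vtx_snoc_same [simp]: "vtx (w @ [i]) i = vtx w i"
  by (simp add: vtx_def gasket_word_append gasket_map_def)

text \<open>Both sides are the midpoint between the corners \<open>i\<close> and \<open>j\<close> of
  the cell \<open>w\<close>.\<close>

lemma vtx_snoc_swap: "vtx (w @ [i]) j = vtx (w @ [j]) i"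
  by (simp add: vtx_def gasket_word_append gasket_map_def add.commute)

lemma vtx_in_cell_tri: "vtx w j \<in> gasket_word v w ` tri"
  by (simp add: vtx_def)

lemma gasket_vertices_eq: "gasket_vertices v n = (\<lambda>(w, j). vtx w j) ` (words n \<times> UNIV)"
proof (induction n)
  case (Suc n)
  have "gasket_vertices v (Suc n) = (\<Union>i. gasket_map v i ` (\<lambda>(w, j). vtx w j) ` (words n \<times> UNIV))"
    using Suc by (simp add: gasket_vertices.simps)
  also have "\<dots> = (\<lambda>(w, j). vtx w j) ` (words (Suc n) \<times> UNIV)"
  proof (intro equalityI subsetI)
    fix x assume "x \<in> (\<Union>i. gasket_map v i ` (\<lambda>(w, j). vtx w j) ` (words n \<times> UNIV))"
    then obtain i w j where "w \<in> words n" "x = gasket_map v i (vtx w j)" by auto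
    then have "i # w \<in> words (Suc n)" "x = vtx (i # w) j" by (auto simp: words_def vtx_def)
    then show "x \<in> (\<lambda>(w, j). vtx w j) ` (words (Suc n) \<times> UNIV)" by force
  next
    fix x assume "x \<in> (\<lambda>(w, j). vtx w j) ` (words (Suc n) \<times> UNIV)"
    then obtain w j where w: "w \<in> words (Suc n)" "x = vtx w j" by auto
    then obtain i u where "w = i # u" "u \<in> words n" by (auto simp: words_def length_Suc_conv)
    then show "x \<in> (\<Union>i. gasket_map v i ` (\<lambda>(w, j). vtx w j) ` (words n \<times> UNIV))"
      using w by (force simp: vtx_def)
  qed
  finally show ?case .
qed force

lemma vtx_in_vertices [simp]: "w \<in> words n \<Longrightarrow> vtx w j \<in> gasket_vertices v n"
  by (auto simp: gasket_vertices_eq)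

lemma verticesE:
  assumes "x \<in> gasket_vertices v n"
  obtains w j where "w \<in> words n" "x = vtx w j"
  using assms by (auto simp: gasket_vertices_eq)

lemma finite_vertices [simp]: "finite (gasket_vertices v n)"
  by (simp add: gasket_vertices_eq)

text \<open>The vertices of the triangle are extreme: coordinate \<open>k\<close> equal to 1 forces
  the first letter to be \<open>k\<close> and the preimage point to be \<open>v k\<close>
  again.\<close>

lemma vertex_in_cell:
  assumes "v k \<in> gasket_word v w ` tri"
  shows "v k = vtx w k"
  using assms
proof (induction w)
  case (Cons i w)
  then obtain z where z: "z \<in> gasket_word v w ` tri" "v k = gasket_map v i z" by auto
  then have "z \<in> tri" using gasket_word_tri by auto
  then have z1: "bary k z \<le> 1" "\<And>j. 0 \<le> bary j z" using bary_le_1 by (auto simp: tri_def)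
  have eq: "(bary j z + (if i = j then 1 else 0)) / 2 = (if k = j then 1 else 0)" for j
    using bary_map[of j i z] bary_vertex[of j k] z by simp
  have "i = k" using eq[of k] z1(1) by (auto split: if_splits)
  have "bary j z = bary j (v k)" for j
    using eq[of j] \<open>i = k\<close> by (auto simp: bary_vertex split: if_splits)
  then have "z = v k" by (rule bary_eqI)
  then have "v k = vtx w k" using Cons.IH z(1) by simp
  then have "vtx (i # w) k = gasket_map v i (v k)" by (simp add: vtx_def)
  then show ?case using z(2) unfolding \<open>z = v k\<close> by (rule ssubst)
qed simp

text \<open>In the two images the coordinates \<open>i\<close> and \<open>j\<close> respectively are
  at least 1/2. As all coordinates are nonnegative with sum 1, both equal 1/2 and the third
  vanishes.\<close>

lemma map_tri_inter:
  assumes "x \<in> gasket_map v i ` tri" "x \<in> gasket_map v j ` tri" "i \<noteq> j"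
  shows "x = gasket_map v i (v j)"
proof (rule bary_eqI)
  fix k
  obtain y z where yz: "y \<in> tri" "x = gasket_map v i y" "z \<in> tri" "x = gasket_map v j z"
    using assms by auto
  have p: "\<And>k. 0 \<le> bary k y" "\<And>k. 0 \<le> bary k z" using yz by (auto simp: tri_def)
  have e: "bary k y + (if i = k then 1 else 0) = bary k z + (if j = k then 1 else 0)" for k
    using bary_map[of k i y] bary_map[of k j z] yz by simp
  have "1 \<le> bary j y" using e[of j] p(2)[of j] assms(3) by auto
  then have j: "bary j y = 1" using bary_le_1[OF yz(1), of j] by linarith
  have s: "bary j y + bary (j + 1) y + bary (j + 2) y = 1"
    using sum_bary[of y] by (simp add: sum_three[of _ j])
  have "bary k y = (if j = k then 1 else 0)"
    using p(1)[of "j + 1"] p(1)[of "j + 2"] j s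
    by (cases k j rule: three_cases) auto
  then show "bary k x = bary k (gasket_map v i (v j))"
    by (simp add: yz(2) bary_map bary_vertex)
qed

text \<open>A common prefix is stripped by injectivity. At the first differing letter
  \<open>map_tri_inter\<close> pins the point down, and \<open>vertex_in_cell\<close> recognizes it
  as a corner. Two points \<open>x\<close> and \<open>y\<close> are carried along to express that
  the intersection has at most one element.\<close>

lemma cell_inter:
  assumes "length w = length w'" "w \<noteq> w'"
    and "x \<in> gasket_word v w ` tri" "x \<in> gasket_word v w' ` tri"
    and "y \<in> gasket_word v w ` tri" "y \<in> gasket_word v w' ` tri"
  shows "x = y" "\<exists>i. x = vtx w i"
proof -
  have "x = y \<and> (\<exists>i. x = vtx w i)"
    using assms
  proof (induction w w' arbitrary: x y rule: list_induct2)
    case (Cons a u a' u')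
    show ?case
    proof (cases "a = a'")
      case True
      obtain x1 y1 where *: "x1 \<in> gasket_word v u ` tri" "x = gasket_map v a x1"
        "y1 \<in> gasket_word v u ` tri" "y = gasket_map v a y1" using Cons.prems by auto
      have "x1 \<in> gasket_word v u' ` tri" "y1 \<in> gasket_word v u' ` tri"
        using Cons.prems(3,5) * True injD[OF inj_gasket_map, of v a'] by auto
      then have "x1 = y1 \<and> (\<exists>i. x1 = vtx u i)" using Cons.IH Cons.prems(1) True * by blast
      then obtain i where "x1 = y1" "x1 = vtx u i" by blast
      then have "x = vtx (a # u) i" using *(2) by (simp add: vtx_def)
      then show ?thesis using *(2,4) \<open>x1 = y1\<close> by blast
    next
      case False
      have sub: "z \<in> gasket_map v b ` tri" if "z \<in> gasket_word v (b # w) ` tri" for z b w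
        using that gasket_word_tri by auto
      have x: "x = gasket_map v a (v a')"
        by (rule map_tri_inter[OF sub[OF Cons.prems(2)] sub[OF Cons.prems(3)] False])
      have y: "y = gasket_map v a (v a')"
        by (rule map_tri_inter[OF sub[OF Cons.prems(4)] sub[OF Cons.prems(5)] False])
      obtain z where z: "z \<in> gasket_word v u ` tri" "x = gasket_map v a z" using Cons.prems by auto
      then have "z = v a'" using x injD[OF inj_gasket_map] by metis
      then have "v a' = vtx u a'" using vertex_in_cell z by simp
      then have "x = vtx (a # u) a'" using x by (simp add: vtx_def)
      then show ?thesis using x y by auto
    qed
  qed simp
  then show "x = y" "\<exists>i. x = vtx w i" by auto
qed

text \<open>The midpoint of the side opposite to the corner \<open>k\<close> of the cell
  \<open>w\<close>.\<close>

definition mid :: "3 list \<Rightarrow> 3 \<Rightarrow> real^2" where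
  "mid w k = vtx (w @ [k + 1]) (k + 2)"

lemma mid_alt: "vtx (w @ [k + 2]) (k + 1) = mid w k"
  by (simp add: mid_def vtx_snoc_swap)

lemma vtx_snoc_1: "vtx (w @ [i]) (i + 1) = mid w (i + 2)"
  by (simp add: mid_def)

lemma vtx_snoc_2: "vtx (w @ [i]) (i + 2) = mid w (i + 1)"
  by (simp add: mid_def vtx_snoc_swap)

lemma bary_mid: "bary j (gasket_map v (k + 1) (v (k + 2))) = (if j = k then 0 else 1 / 2)"
  by (cases j k rule: three_cases) (auto simp: bary_map bary_vertex)

lemma mid_eq: "mid w k = gasket_word v w (gasket_map v (k + 1) (v (k + 2)))"
  by (simp add: mid_def vtx_def gasket_word_append)

lemma mid_in_cell: "mid w k \<in> gasket_word v w ` tri"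
  unfolding mid_eq by (intro imageI gasket_map_tri) simp

lemma mid_neq_vtx: "mid w k \<noteq> vtx w j"
proof
  assume "mid w k = vtx w j"
  then have "gasket_map v (k + 1) (v (k + 2)) = v j"
    unfolding mid_eq vtx_def by (rule injD[OF inj_gasket_word])
  then have "bary j (v j) = (if j = k then 0 else 1 / 2)" using bary_mid[of j k] by simp
  then show False by (auto simp: bary_vertex split: if_splits)
qed

lemma mid_inj_same: "mid w k = mid w l \<Longrightarrow> k = l"
proof -
  assume "mid w k = mid w l"
  then have "gasket_map v (k + 1) (v (k + 2)) = gasket_map v (l + 1) (v (l + 2))"
    unfolding mid_eq by (rule injD[OF inj_gasket_word])
  then have "bary k (gasket_map v (l + 1) (v (l + 2))) = 0" using bary_mid[of k k] by simp
  then show "k = l" using bary_mid[of k l] by (auto split: if_splits)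
qed

lemma vtx_of_cell:
  assumes "w \<in> words n" "w' \<in> words n" "x \<in> gasket_word v w ` tri" "vtx w' j = x"
  shows "\<exists>i. x = vtx w i"
proof (cases "w = w'")
  case False
  then show ?thesis
    using cell_inter(2)[of w w' x x] assms vtx_in_cell_tri[of w' j] by (auto simp: words_def)
qed (use assms in auto)

text \<open>A vertex of level \<open>n\<close> inside the cell \<open>w\<close> of the same level is
  a corner of \<open>w\<close>, by \<open>cell_inter\<close>, and a midpoint is not.\<close>

lemma mid_not_vertex:
  assumes "w \<in> words n" shows "mid w k \<notin> gasket_vertices v n"
proof
  assume "mid w k \<in> gasket_vertices v n"
  then obtain w' j where "w' \<in> words n" "vtx w' j = mid w k" by (metis verticesE)
  then have "\<exists>i. mid w k = vtx w i" using vtx_of_cell[OF assms] mid_in_cell by blast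
  then show False using mid_neq_vtx by blast
qed

lemma mid_inj:
  assumes "w \<in> words n" "w' \<in> words n" "mid w k = mid w' l"
  shows "w = w' \<and> k = l"
proof -
  have "w = w'"
  proof (rule ccontr)
    assume "w \<noteq> w'"
    then have "\<exists>i. mid w k = vtx w i"
      using cell_inter(2)[of w w' "mid w k" "mid w k"] assms mid_in_cell[of w k] mid_in_cell[of w' l]
      by (auto simp: words_def)
    then show False using mid_neq_vtx by blast
  qed
  then show ?thesis using assms mid_inj_same by auto
qed

lemma vertices_Suc: "gasket_vertices v (Suc n) = gasket_vertices v n \<union> (\<lambda>(w, k). mid w k) ` (words n \<times> UNIV)"
proof (intro equalityI subsetI)
  fix x assume "x \<in> gasket_vertices v (Suc n)"
  then obtain w i j where w: "w \<in> words n" "x = vtx (w @ [i]) j"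
    by (auto simp: gasket_vertices_eq words_Suc)
  show "x \<in> gasket_vertices v n \<union> (\<lambda>(w, k). mid w k) ` (words n \<times> UNIV)"
    using w by (cases j i rule: three_cases) (force simp: vtx_snoc_1 vtx_snoc_2)+
next
  fix x assume "x \<in> gasket_vertices v n \<union> (\<lambda>(w, k). mid w k) ` (words n \<times> UNIV)"
  then show "x \<in> gasket_vertices v (Suc n)"
  proof
    assume "x \<in> gasket_vertices v n"
    then obtain w j where "w \<in> words n" "x = vtx (w @ [j]) j" by (auto elim: verticesE)
    moreover have "w @ [j] \<in> words (Suc n)" using \<open>w \<in> words n\<close> by (simp add: words_def)
    ultimately show ?thesis by (metis vtx_in_vertices)
  next
    assume "x \<in> (\<lambda>(w, k). mid w k) ` (words n \<times> UNIV)"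
    then show ?thesis by (auto simp: mid_def words_def intro!: vtx_in_vertices)
  qed
qed

lemma vertices_mono: "n \<le> m \<Longrightarrow> gasket_vertices v n \<subseteq> gasket_vertices v m"
  by (rule lift_Suc_mono_le[of "gasket_vertices v"]) (auto simp: vertices_Suc)

lemma mid_in_vertices: "w \<in> words n \<Longrightarrow> mid w k \<in> gasket_vertices v (Suc n)"
  by (auto simp: vertices_Suc)

lemma vertices_SucE:
  assumes "x \<in> gasket_vertices v (Suc n)"
  obtains "x \<in> gasket_vertices v n" | w k where "w \<in> words n" "x = mid w k"
  using assms by (auto simp: vertices_Suc)

lemma card_vertices: "card (gasket_vertices v n) = (3 ^ (n + 1) + 3) div 2"
proof (induction n)
  case 0
  have "card (range v) = 3" using v_inj by (subst card_image) (auto intro: injI)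
  then show ?case by simp
next
  case (Suc n)
  have "card ((\<lambda>(w, k). mid w k) ` (words n \<times> UNIV)) = 3 ^ n * 3"
    using mid_inj by (subst card_image) (auto intro!: inj_onI simp: card_cartesian_product card_words)
  moreover have "gasket_vertices v n \<inter> (\<lambda>(w, k). mid w k) ` (words n \<times> UNIV) = {}"
    using mid_not_vertex by auto
  ultimately have "card (gasket_vertices v (Suc n)) = (3 ^ (n + 1) + 3) div 2 + 3 ^ n * 3"
    unfolding vertices_Suc using Suc by (subst card_Un_disjoint) auto
  then show ?case by simp
qed

section \<open>Flags: cells with a marked corner\<close>

definition flags_at :: "nat \<Rightarrow> real^2 \<Rightarrow> (3 list \<times> 3) set" where
  "flags_at n x = {(w, i). w \<in> words n \<and> vtx w i = x}"

lemma finite_flags_at [simp]: "finite (flags_at n x)"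
  by (rule finite_subset[of _ "words n \<times> UNIV"]) (auto simp: flags_at_def)

lemma flags_at_0: "flags_at 0 (v i) = {([], i)}"
  by (auto simp: flags_at_def dest: v_inj)

text \<open>An old vertex keeps its flags; each cell is merely replaced by its subcell at that
  corner. Together with \<open>flags_at_mid\<close> this makes every step of the decimation local to
  single flags.\<close>

lemma flags_at_Suc_vertex:
  assumes "x \<in> gasket_vertices v n"
  shows "flags_at (Suc n) x = (\<lambda>(w, i). (w @ [i], i)) ` flags_at n x"
proof (intro equalityI subsetI)
  fix f assume "f \<in> flags_at (Suc n) x"
  then obtain w i j where f: "f = (w @ [i], j)" "w \<in> words n" "vtx (w @ [i]) j = x"
    by (auto simp: flags_at_def words_Suc)
  have "i = j"
    using f assms mid_not_vertex[OF f(2)]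
    by (cases j i rule: three_cases) (auto simp: vtx_snoc_1 vtx_snoc_2)
  then show "f \<in> (\<lambda>(w, i). (w @ [i], i)) ` flags_at n x"
    using f by (auto simp: flags_at_def)
qed (auto simp: flags_at_def words_Suc)

lemma flags_at_mid:
  assumes "w \<in> words n"
  shows "flags_at (Suc n) (mid w k) = {(w @ [k + 1], k + 2), (w @ [k + 2], k + 1)}"
proof (intro equalityI subsetI)
  fix f assume "f \<in> flags_at (Suc n) (mid w k)"
  then obtain w' i j where f: "f = (w' @ [i], j)" "w' \<in> words n" "vtx (w' @ [i]) j = mid w k"
    by (auto simp: flags_at_def words_Suc)
  show "f \<in> {(w @ [k + 1], k + 2), (w @ [k + 2], k + 1)}"
  proof (cases j i rule: three_cases)
    case 1
    then have "vtx w' i = mid w k" using f by simp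
    then show ?thesis using mid_not_vertex[OF assms] f by (metis vtx_in_vertices)
  next
    case 2
    then have "mid w' (i + 2) = mid w k" using f by (simp add: vtx_snoc_1)
    then have "w' = w" "k = i + 2" using mid_inj[OF f(2) assms] by auto
    then show ?thesis using f 2 by simp
  next
    case 3
    then have "mid w' (i + 1) = mid w k" using f by (simp add: vtx_snoc_2)
    then have "w' = w" "k = i + 1" using mid_inj[OF f(2) assms] by auto
    then show ?thesis using f 3 by simp
  qed
qed (use assms in \<open>auto simp: flags_at_def words_Suc mid_alt mid_def\<close>)

lemma sum_flags_group:
  fixes g :: "3 list \<times> 3 \<Rightarrow> real"
  shows "(\<Sum>(w, i)\<in>words n \<times> UNIV. g (w, i)) = (\<Sum>x\<in>gasket_vertices v n. \<Sum>f\<in>flags_at n x. g f)"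
proof -
  have "(\<Sum>f\<in>words n \<times> UNIV. g f) =
      (\<Sum>x\<in>gasket_vertices v n. \<Sum>f\<in>{f \<in> words n \<times> UNIV. (case f of (w, i) \<Rightarrow> vtx w i) = x}. g f)"
    by (intro sum.group[symmetric]) auto
  moreover have "{f \<in> words n \<times> UNIV. (case f of (w, i) \<Rightarrow> vtx w i) = x} = flags_at n x" for x
    by (auto simp: flags_at_def)
  ultimately show ?thesis by (simp add: case_prod_unfold)
qed

end

section \<open>Cells of the gasket\<close>

locale gasket_set = triangle +
  fixes S :: "(real^2) set"
  assumes gasket: "is_gasket v S"
begin

lemma compact_S: "compact S" and S_ne: "S \<noteq> {}" and S_eq: "S = (\<Union>j. gasket_map v j ` S)"
  using gasket by (auto simp: is_gasket_def)

lemma gasket_word_S: "x \<in> S \<Longrightarrow> gasket_word v w x \<in> S"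
  using S_eq by (induction w) auto

text \<open>At a point of the compact set \<open>S\<close> where a barycentric coordinate is
  minimal, self-similarity makes the minimum at least half of another value of this coordinate,
  hence at least half of itself. So it is nonnegative.\<close>

lemma S_subset_tri: "S \<subseteq> tri"
proof -
  have "0 \<le> bary j x" if "x \<in> S" for x j
  proof -
    obtain m where m: "m \<in> S" "\<And>y. y \<in> S \<Longrightarrow> bary j m \<le> bary j y"
      using continuous_attains_inf[OF compact_S S_ne continuous_on_bary] by blast
    obtain i y where y: "y \<in> S" "m = gasket_map v i y" using S_eq m(1) by blast
    have "bary j m \<ge> bary j y / 2" using bary_map[of j i y] y by simp
    then have "0 \<le> bary j m" using m(2)[OF y(1)] by linarith
    then show ?thesis using m(2)[OF that] by linarith
  qed
  then show ?thesis by (auto simp: tri_def)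
qed

text \<open>\<open>v j\<close> is the limit of the iterates of the contraction
  \<open>gasket_map v j\<close>, started anywhere in the closed set \<open>S\<close>.\<close>

lemma v_in_S: "v j \<in> S"
proof -
  obtain x where x: "x \<in> S" using S_ne by auto
  let ?y = "\<lambda>n. gasket_word v (replicate n j) x"
  have fix': "gasket_word v (replicate n j) (v j) = v j" for n
    by (induction n) (auto simp: gasket_map_def)
  have "dist (?y n) (v j) = dist x (v j) * (1/2) ^ n" for n
    using dist_gasket_word[of v "replicate n j" x "v j"] by (simp add: fix' power_divide)
  moreover have "(\<lambda>n. dist x (v j) * (1/2) ^ n) \<longlonglongrightarrow> 0"
    by (intro tendsto_mult_right_zero LIMSEQ_power_zero) auto
  ultimately have "(\<lambda>n. dist (?y n) (v j)) \<longlonglongrightarrow> 0" by simp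
  then have "?y \<longlonglongrightarrow> v j" by (subst tendsto_dist_iff)
  moreover have "?y n \<in> S" for n using x by (rule gasket_word_S)
  ultimately show ?thesis using compact_S by (meson closed_sequentially compact_imp_closed)
qed

definition cell :: "3 list \<Rightarrow> (real^2) set" where
  "cell w = gasket_word v w ` S"

lemma cell_subset: "cell w \<subseteq> S"
  using gasket_word_S by (auto simp: cell_def)

lemma cell_append: "cell (w @ u) \<subseteq> cell w"
  using gasket_word_S by (auto simp: cell_def gasket_word_append)

lemma vtx_in_cell: "vtx w j \<in> cell w"
  using v_in_S by (auto simp: cell_def vtx_def)

lemma vtx_append_in_cell: "vtx (w @ u) j \<in> cell w"
  using vtx_in_cell cell_append by blast

lemma vertices_subset_S: "gasket_vertices v n \<subseteq> S"
  using vtx_in_cell cell_subset by (auto simp: gasket_vertices_eq)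

lemma compact_cell: "compact (cell w)"
  unfolding cell_def by (intro compact_continuous_image continuous_on_gasket_word compact_S)

lemma cell_tri: "cell w \<subseteq> gasket_word v w ` tri"
  using S_subset_tri by (auto simp: cell_def)

lemma cell_split: "cell w = (\<Union>i. cell (w @ [i]))"
proof -
  have "cell w = gasket_word v w ` (\<Union>i. gasket_map v i ` S)" using S_eq by (simp add: cell_def)
  then show ?thesis by (auto simp: cell_def gasket_word_append)
qed

lemma S_cells: "S = (\<Union>w\<in>words n. cell w)"
proof (induction n)
  case (Suc n)
  have "(\<Union>w\<in>words (Suc n). cell w) = (\<Union>w\<in>words n. \<Union>i. cell (w @ [i]))"
    by (rule UN_words_Suc)
  also have "\<dots> = (\<Union>w\<in>words n. cell w)" by (simp only: cell_split[symmetric])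
  also have "\<dots> = S" using Suc by simp
  finally show ?case by simp
qed (simp add: cell_def)

lemma dist_cell:
  assumes "x \<in> cell w" "y \<in> cell w"
  shows "dist x y \<le> diameter S / 2 ^ length w"
proof -
  obtain a b where "a \<in> S" "b \<in> S" "x = gasket_word v w a" "y = gasket_word v w b"
    using assms by (auto simp: cell_def)
  then show ?thesis
    using diameter_bounded_bound[OF compact_imp_bounded[OF compact_S], of a b]
    by (auto simp: dist_gasket_word divide_right_mono)
qed

lemma cell_vtx:
  assumes "w \<in> words n" "w' \<in> words n" "w \<noteq> w'" "x \<in> cell w" "x \<in> cell w'"
  shows "\<exists>i. x = vtx w i"
  using cell_inter(2)[of w w' x x] assms cell_tri[of w] cell_tri[of w'] by (auto simp: words_def)

text \<open>The word found for \<open>x\<close> may describe it from a neighbouring cell. Then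
  \<open>x\<close> is a corner \<open>i\<close> of \<open>w\<close> itself, and repeating the letter
  \<open>i\<close> reaches any deeper level inside \<open>w\<close> without moving this
  corner.\<close>

lemma vertex_in_cellE:
  assumes "x \<in> cell w" "x \<in> gasket_vertices v (length w + k)"
  obtains u j where "length u = k" "x = vtx (w @ u) j"
proof -
  obtain w' j where w': "w' \<in> words (length w + k)" "x = vtx w' j" by (metis assms(2) verticesE)
  define w1 u where "w1 = take (length w) w'" "u = drop (length w) w'"
  have w1u: "w' = w1 @ u" "length w1 = length w" "length u = k"
    using w' by (auto simp: w1_u_def words_def)
  show ?thesis
  proof (cases "w1 = w")
    case True
    then show ?thesis using that w' w1u by auto
  next
    case False
    have "x \<in> cell w1" using w' w1u vtx_append_in_cell by simp
    then obtain i where "x = vtx w i"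
      using cell_vtx[of w "length w" w1 x] False assms w1u by (auto simp: words_def)
    moreover have "vtx (w @ replicate m i) i = vtx w i" for m
    proof (induction m)
      case (Suc m)
      have "w @ replicate (Suc m) i = (w @ replicate m i) @ [i]"
        by (simp add: replicate_append_same)
      then show ?case using Suc vtx_snoc_same[of "w @ replicate m i" i] by simp
    qed simp
    ultimately show ?thesis using that[of "replicate k i" i] by simp
  qed
qed

text \<open>A single cell need not be a neighbourhood of \<open>x\<close>, since \<open>x\<close>
  may be a common corner. But the finitely many cells that miss \<open>x\<close> have a closed
  union.\<close>

lemma cell_neighbourhood:
  assumes "x \<in> S"
  obtains \<delta> where "\<delta> > 0"
    "\<And>y. y \<in> S \<Longrightarrow> dist y x < \<delta> \<Longrightarrow> \<exists>w\<in>words n. x \<in> cell w \<and> y \<in> cell w"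
proof -
  define U where "U = (\<Union>w\<in>{w\<in>words n. x \<notin> cell w}. cell w)"
  have "closed U" unfolding U_def
    by (intro closed_UN) (auto simp: compact_imp_closed compact_cell)
  moreover have "x \<notin> U" by (auto simp: U_def)
  ultimately obtain \<delta> where d: "\<delta> > 0" "ball x \<delta> \<subseteq> - U"
    by (metis ComplI open_Compl openE)
  show ?thesis
  proof
    fix y assume y: "y \<in> S" "dist y x < \<delta>"
    then have "y \<notin> U" using d by (auto simp: dist_commute)
    moreover obtain w where "w \<in> words n" "y \<in> cell w" using y S_cells[of n] by auto
    ultimately show "\<exists>w\<in>words n. x \<in> cell w \<and> y \<in> cell w" by (auto simp: U_def)
  qed (use d in auto)
qed

end

section \<open>Energy\<close>

text \<open>Summation by parts on one triangle: the cofactor of \<open>b i\<close> is minus the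
  Laplacian of the complete graph on three points.\<close>

lemma vertex_pair_sum:
  fixes a :: "3 \<Rightarrow> real"
  shows "1/2 * (\<Sum>i\<in>UNIV. \<Sum>j\<in>UNIV. (a j - a i) * (b j - b i)) = (\<Sum>i\<in>UNIV. b i * (3 * a i - (\<Sum>j\<in>UNIV. a j)))"
  by (simp add: sum_3 algebra_simps)

text \<open>The difference is a positive quadratic form in the deviations of the midpoint values from the
  harmonic (minimizing) ones, which are weighted means of the vertex values.\<close>

lemma harmonic_extension_minimizes:
  fixes a1 a2 a3 z1 z2 z3 :: real
  shows "(a1 - a2)\<^sup>2 + (a1 - a3)\<^sup>2 + (a2 - a3)\<^sup>2 \<le>
    5/3 * (((a1 - z3)\<^sup>2 + (a1 - z2)\<^sup>2 + (z3 - z2)\<^sup>2) + ((a2 - z1)\<^sup>2 + (a2 - z3)\<^sup>2 + (z1 - z3)\<^sup>2)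
      + ((a3 - z2)\<^sup>2 + (a3 - z1)\<^sup>2 + (z2 - z1)\<^sup>2))"
proof -
  define d1 d2 d3 where "d1 = z1 - (a1 + 2 * a2 + 2 * a3) / 5" "d2 = z2 - (2 * a1 + a2 + 2 * a3) / 5"
    "d3 = z3 - (2 * a1 + 2 * a2 + a3) / 5"
  have z: "z1 = d1 + (a1 + 2 * a2 + 2 * a3) / 5" "z2 = d2 + (2 * a1 + a2 + 2 * a3) / 5"
    "z3 = d3 + (2 * a1 + 2 * a2 + a3) / 5" by (simp_all add: d1_d2_d3_def)
  have "5/3 * (((a1 - z3)\<^sup>2 + (a1 - z2)\<^sup>2 + (z3 - z2)\<^sup>2) + ((a2 - z1)\<^sup>2 + (a2 - z3)\<^sup>2 + (z1 - z3)\<^sup>2)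
      + ((a3 - z2)\<^sup>2 + (a3 - z1)\<^sup>2 + (z2 - z1)\<^sup>2)) - ((a1 - a2)\<^sup>2 + (a1 - a3)\<^sup>2 + (a2 - a3)\<^sup>2)
    = 5/3 * (2 * d1\<^sup>2 + 2 * d2\<^sup>2 + 2 * d3\<^sup>2 + (d1 - d2)\<^sup>2 + (d1 - d3)\<^sup>2 + (d2 - d3)\<^sup>2)"
    unfolding z by (simp add: power2_eq_square field_simps)
  moreover have "0 \<le> \<dots>" by simp
  ultimately show ?thesis by linarith
qed

lemma LIMSEQ_geometric:
  fixes x :: "'a :: metric_space"
  assumes "\<And>k. dist (y k) x \<le> C * (1/2) ^ k"
  shows "y \<longlonglongrightarrow> x"
proof -
  have "(\<lambda>k. C * (1/2) ^ k) \<longlonglongrightarrow> 0"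
    by (intro tendsto_mult_right_zero LIMSEQ_power_zero) auto
  then have "(\<lambda>k. dist (y k) x) \<longlonglongrightarrow> 0"
    by (rule tendsto_sandwich[OF _ _ tendsto_const, rotated 2]) (auto simp: assms)
  then show ?thesis by (subst tendsto_dist_iff)
qed

section \<open>Level forms and the energy form\<close>

context triangle
begin

definition cell_form :: "3 list \<Rightarrow> (real^2 \<Rightarrow> real) \<Rightarrow> (real^2 \<Rightarrow> real) \<Rightarrow> real" where
  "cell_form w f g =
     1/2 * (\<Sum>i\<in>UNIV. \<Sum>j\<in>UNIV. (f (vtx w j) - f (vtx w i)) * (g (vtx w j) - g (vtx w i)))"

definition level_form :: "nat \<Rightarrow> (real^2 \<Rightarrow> real) \<Rightarrow> (real^2 \<Rightarrow> real) \<Rightarrow> real" where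
  "level_form n f g = (5/3) ^ n * (\<Sum>w\<in>words n. cell_form w f g)"

lemma cell_form_eq: "cell_form w f g = (\<Sum>i\<in>UNIV. g (vtx w i) * (3 * f (vtx w i) - (\<Sum>j\<in>UNIV. f (vtx w j))))"
  unfolding cell_form_def by (rule vertex_pair_sum)

lemma cell_form_three:
  "cell_form w f f = (f (vtx w i) - f (vtx w (i + 1)))\<^sup>2 + (f (vtx w i) - f (vtx w (i + 2)))\<^sup>2
    + (f (vtx w (i + 1)) - f (vtx w (i + 2)))\<^sup>2"
  unfolding cell_form_def sum_three[of _ i] by (simp add: power2_eq_square algebra_simps)

lemma cell_form_nonneg: "0 \<le> cell_form w f f"
  by (simp add: cell_form_three[of w f 1])

lemma level_form_nonneg: "0 \<le> level_form n f f"
  by (simp add: level_form_def sum_nonneg cell_form_nonneg)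

text \<open>Two neighbours lie in exactly one common cell, because different cells of one level
  share at most one point. So the sum over pairs may be taken cell by cell.\<close>

lemma energy_level_eq: "energy_level v n f = level_form n f f"
proof -
  let ?P = "words n \<times> {(i :: 3, j). i \<noteq> j}"
  let ?h = "\<lambda>(w, i, j). (vtx w i, vtx w j)"
  have inj: "inj_on ?h ?P"
  proof (rule inj_onI)
    fix p q assume pq: "p \<in> ?P" "q \<in> ?P" "?h p = ?h q"
    obtain w i j where p: "p = (w, i, j)" by (cases p)
    obtain w' i' j' where q: "q = (w', i', j')" by (cases q)
    have e: "vtx w i = vtx w' i'" "vtx w j = vtx w' j'" "i \<noteq> j" "length w = length w'"
      using pq p q by (auto simp: words_def)
    have "w = w'"
    proof (rule ccontr)
      assume "w \<noteq> w'"
      then have "vtx w i = vtx w j"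
        using cell_inter(1)[OF e(4), of "vtx w i" "vtx w j"] vtx_in_cell_tri e by metis
      then show False using e(3) by simp
    qed
    then show "p = q" using e p q by simp
  qed
  have "{(x, y). gasket_nb v n x y} = ?h ` ?P"
  proof (intro equalityI subsetI)
    fix p assume "p \<in> {(x, y). gasket_nb v n x y}"
    then obtain w i j where "w \<in> words n" "p = (vtx w i, vtx w j)" "vtx w i \<noteq> vtx w j"
      by (auto simp: gasket_nb_def words_def vtx_def)
    then show "p \<in> ?h ` ?P" by (intro image_eqI[of _ _ "(w, i, j)"]) auto
  next
    fix p assume "p \<in> ?h ` ?P"
    then obtain w i j where p: "w \<in> words n" "p = (vtx w i, vtx w j)" "i \<noteq> j" by auto
    then have "vtx w i \<in> gasket_word v w ` range v" "vtx w j \<in> gasket_word v w ` range v"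
      by (auto simp: vtx_def)
    then have "gasket_nb v n (vtx w i) (vtx w j)"
      using p unfolding gasket_nb_def by (auto simp: words_def intro!: exI[of _ w])
    then show "p \<in> {(x, y). gasket_nb v n x y}" using p by simp
  qed
  then have "(\<Sum>(x, y) | gasket_nb v n x y. (f y - f x)\<^sup>2) = (\<Sum>p\<in>?P. case ?h p of (x, y) \<Rightarrow> (f y - f x)\<^sup>2)"
    by (simp add: sum.reindex[OF inj])
  also have "\<dots> = (\<Sum>w\<in>words n. \<Sum>p\<in>{(i, j). i \<noteq> j}. (f (vtx w (snd p)) - f (vtx w (fst p)))\<^sup>2)"
    by (simp add: sum.cartesian_product case_prod_unfold)
  also have "\<dots> = (\<Sum>w\<in>words n. \<Sum>p\<in>UNIV \<times> UNIV. (f (vtx w (snd p)) - f (vtx w (fst p)))\<^sup>2)"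
    by (rule sum.cong[OF refl], rule sum.mono_neutral_left) auto
  also have "\<dots> = (\<Sum>w\<in>words n. 2 * cell_form w f f)"
    by (simp add: cell_form_def sum.cartesian_product case_prod_unfold power2_eq_square)
  finally show ?thesis
    by (simp add: energy_level_def level_form_def sum_distrib_left[symmetric])
qed

text \<open>Residual of the eigenvalue equation: at a vertex with two flags it is four times the
  graph Laplacian of \<open>f\<close> plus \<open>4 * l * f x\<close>. At a corner of the triangle,
  with one flag, it is the analogue with two neighbours, which is the Neumann condition.\<close>

definition eqn :: "nat \<Rightarrow> real \<Rightarrow> (real^2 \<Rightarrow> real) \<Rightarrow> real^2 \<Rightarrow> real" where
  "eqn n l f x = (\<Sum>(w, i)\<in>flags_at n x. (\<Sum>j\<in>UNIV. f (vtx w j)) - (3 - 2 * l) * f x)"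

text \<open>Discrete Green formula. It holds for every \<open>l\<close>, since the terms with
  \<open>l\<close> cancel; this freedom is used to insert the graph eigenvalue of the level.\<close>

lemma level_form_eqn:
  "level_form n f h = (5/3) ^ n * (2 * l * (\<Sum>w\<in>words n. \<Sum>i\<in>UNIV. f (vtx w i) * h (vtx w i))
     - (\<Sum>x\<in>gasket_vertices v n. h x * eqn n l f x))"
proof -
  let ?g = "\<lambda>(w, i). h (vtx w i) * ((\<Sum>j\<in>UNIV. f (vtx w j)) - (3 - 2 * l) * f (vtx w i))"
  have "(\<Sum>w\<in>words n. cell_form w f h) = (\<Sum>w\<in>words n. \<Sum>i\<in>UNIV. 2 * l * (f (vtx w i) * h (vtx w i)) - ?g (w, i))"
    unfolding cell_form_eq by (intro sum.cong refl) (simp add: algebra_simps)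
  also have "\<dots> = 2 * l * (\<Sum>w\<in>words n. \<Sum>i\<in>UNIV. f (vtx w i) * h (vtx w i)) - (\<Sum>w\<in>words n. \<Sum>i\<in>UNIV. ?g (w, i))"
    by (simp only: sum_subtractf sum_distrib_left)
  also have "(\<Sum>w\<in>words n. \<Sum>i\<in>UNIV. ?g (w, i)) = (\<Sum>x\<in>gasket_vertices v n. \<Sum>f\<in>flags_at n x. ?g f)"
    using sum_flags_group[of ?g n] by (simp add: sum.cartesian_product)
  also have "\<dots> = (\<Sum>x\<in>gasket_vertices v n. h x * eqn n l f x)"
    unfolding eqn_def sum_distrib_left by (intro sum.cong refl) (auto simp: flags_at_def)
  finally show ?thesis by (simp add: level_form_def)
qed

lemma sum_vtx_snoc: "(\<Sum>j\<in>UNIV. F (vtx (w @ [i]) j)) = F (vtx w i) + F (mid w (i + 1)) + F (mid w (i + 2))"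
  for F :: "real^2 \<Rightarrow> real"
  by (simp add: sum_three[of _ i] vtx_snoc_1 vtx_snoc_2)

lemma energy_level_Suc: "energy_level v n f \<le> energy_level v (Suc n) f"
proof -
  have "cell_form w f f \<le> 5/3 * (\<Sum>i\<in>UNIV. cell_form (w @ [i]) f f)" for w
  proof -
    have e: "cell_form (w @ [i]) f f = (f (vtx w i) - f (mid w (i + 2)))\<^sup>2 + (f (vtx w i) - f (mid w (i + 1)))\<^sup>2
        + (f (mid w (i + 2)) - f (mid w (i + 1)))\<^sup>2" for i
      by (simp add: cell_form_three[of _ _ i] vtx_snoc_1 vtx_snoc_2)
    show ?thesis
      using harmonic_extension_minimizes[of "f (vtx w 1)" "f (vtx w 2)" "f (vtx w 3)"
        "f (mid w 3)" "f (mid w 2)" "f (mid w 1)"]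
      unfolding sum_3 e cell_form_three[of w f 1]
      by (simp add: three_wrap)
  qed
  then have "(\<Sum>w\<in>words n. cell_form w f f) \<le> 5/3 * (\<Sum>w\<in>words (Suc n). cell_form w f f)"
    unfolding sum_words_Suc sum_distrib_left by (intro sum_mono) (simp add: sum_distrib_left)
  from mult_left_mono[OF this, of "(5/3) ^ n"] show ?thesis
    by (simp add: energy_level_eq level_form_def mult_ac)
qed

lemma energy_level_mono: "n \<le> m \<Longrightarrow> energy_level v n f \<le> energy_level v m f"
  by (rule lift_Suc_mono_le[of "\<lambda>n. energy_level v n f"]) (auto intro: energy_level_Suc)

lemma energy_level_nonneg: "0 \<le> energy_level v n f"
  by (simp add: energy_level_eq level_form_nonneg)

lemma energy_bounded_convergent:
  assumes "\<And>n. energy_level v n f \<le> B" shows "convergent (\<lambda>n. energy_level v n f)"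
  using assms energy_level_mono
  by (intro Bseq_mono_convergent BseqI'[of _ B]) (auto simp: energy_level_nonneg)

lemma energy_LIMSEQ: "f \<in> energy_domain v S \<Longrightarrow> (\<lambda>n. energy_level v n f) \<longlonglongrightarrow> energy v f"
  by (simp add: energy_domain_def energy_def convergent_LIMSEQ_iff)

lemma energy_level_le_energy: "f \<in> energy_domain v S \<Longrightarrow> energy_level v n f \<le> energy v f"
  by (rule LIMSEQ_le_const[OF energy_LIMSEQ]) (auto intro: energy_level_mono)

lemma energy_nonneg: "f \<in> energy_domain v S \<Longrightarrow> 0 \<le> energy v f"
  using energy_level_le_energy energy_level_nonneg by (meson order_trans)

lemma vtx_osc:
  assumes "w \<in> words n"
  shows "\<bar>f (vtx w i) - f (vtx w j)\<bar> \<le> sqrt (energy_level v n f) * sqrt (3/5) ^ n"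
proof -
  have 1: "(f (vtx w i) - f (vtx w j))\<^sup>2 \<le> cell_form w f f"
    unfolding cell_form_three[of w f i]
    by (cases j i rule: three_cases) auto
  have "cell_form w f f \<le> (\<Sum>w\<in>words n. cell_form w f f)"
    using assms by (intro member_le_sum) (auto simp: cell_form_nonneg)
  also have "\<dots> = energy_level v n f * (3/5) ^ n"
    by (simp add: energy_level_eq level_form_def flip: power_mult_distrib)
  finally have "(f (vtx w i) - f (vtx w j))\<^sup>2 \<le> energy_level v n f * (3/5) ^ n" using 1 by linarith
  then show ?thesis
    by (simp add: real_sqrt_abs[symmetric] real_sqrt_mult[symmetric] real_sqrt_power[symmetric] del: real_sqrt_abs)
qed

text \<open>\<open>energy_form\<close> is a polarized limit, so bilinearity is not visible in it. It
  is transferred from the level forms, which are bilinear by their shape.\<close>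

lemma level_form_polar:
  "level_form n f g = (energy_level v n (\<lambda>x. f x + g x) - energy_level v n (\<lambda>x. f x - g x)) / 4"
proof -
  have "cell_form w f g = (cell_form w (\<lambda>x. f x + g x) (\<lambda>x. f x + g x) - cell_form w (\<lambda>x. f x - g x) (\<lambda>x. f x - g x)) / 4" for w
    unfolding cell_form_def by (simp add: sum_3 field_simps)
  then have eq: "(\<Sum>w\<in>words n. cell_form w f g) = ((\<Sum>w\<in>words n. cell_form w (\<lambda>x. f x + g x) (\<lambda>x. f x + g x))
     - (\<Sum>w\<in>words n. cell_form w (\<lambda>x. f x - g x) (\<lambda>x. f x - g x))) / 4"
    by (simp only: sum_subtractf[symmetric] sum_divide_distrib)
  show ?thesis
    unfolding energy_level_eq level_form_def eq by (simp only: right_diff_distrib times_divide_eq_right)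
qed

text \<open>The parallelogram law; it bounds the energies of sums and differences and so makes
  \<open>energy_domain\<close> closed under both.\<close>

lemma energy_level_add: "energy_level v n (\<lambda>x. f x + g x) + energy_level v n (\<lambda>x. f x - g x)
    = 2 * energy_level v n f + 2 * energy_level v n g"
proof -
  have "cell_form w (\<lambda>x. f x + g x) (\<lambda>x. f x + g x) + cell_form w (\<lambda>x. f x - g x) (\<lambda>x. f x - g x)
     = 2 * cell_form w f f + 2 * cell_form w g g" for w
    unfolding cell_form_def by (simp add: sum_3 field_simps)
  then have "(\<Sum>w\<in>words n. cell_form w (\<lambda>x. f x + g x) (\<lambda>x. f x + g x))
     + (\<Sum>w\<in>words n. cell_form w (\<lambda>x. f x - g x) (\<lambda>x. f x - g x))
     = 2 * (\<Sum>w\<in>words n. cell_form w f f) + 2 * (\<Sum>w\<in>words n. cell_form w g g)"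
    by (simp only: sum.distrib[symmetric] sum_distrib_left)
  from arg_cong[OF this, of "(*) ((5/3) ^ n)"] show ?thesis
    unfolding energy_level_eq level_form_def by (simp only: distrib_left mult.left_commute)
qed

lemma energy_domain_add_diff:
  assumes "f \<in> energy_domain v S" "g \<in> energy_domain v S"
  shows "(\<lambda>x. f x + g x) \<in> energy_domain v S" "(\<lambda>x. f x - g x) \<in> energy_domain v S"
proof -
  have b: "energy_level v n (\<lambda>x. f x + g x) \<le> 2 * energy v f + 2 * energy v g"
      "energy_level v n (\<lambda>x. f x - g x) \<le> 2 * energy v f + 2 * energy v g" for n
    using energy_level_add[of n f g] energy_level_le_energy[OF assms(1), of n] energy_level_le_energy[OF assms(2), of n]
      energy_level_nonneg[of n "\<lambda>x. f x + g x"] energy_level_nonneg[of n "\<lambda>x. f x - g x"] by linarith+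
  show "(\<lambda>x. f x + g x) \<in> energy_domain v S" "(\<lambda>x. f x - g x) \<in> energy_domain v S"
    using assms b by (auto simp: energy_domain_def intro!: continuous_intros energy_bounded_convergent)
qed

lemma energy_form_LIMSEQ:
  assumes "f \<in> energy_domain v S" "g \<in> energy_domain v S"
  shows "(\<lambda>n. level_form n f g) \<longlonglongrightarrow> energy_form v f g"
  unfolding level_form_polar energy_form_def
  by (intro tendsto_intros energy_LIMSEQ[where S = S] energy_domain_add_diff assms) auto

lemma energy_form_self:
  assumes "f \<in> energy_domain v S"
  shows "energy_form v f f = energy v f"
proof -
  have "(\<lambda>n. level_form n f f) \<longlonglongrightarrow> energy v f"
    using energy_LIMSEQ[OF assms] by (simp add: energy_level_eq)
  then show ?thesis using energy_form_LIMSEQ[OF assms assms] LIMSEQ_unique by blast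
qed

definition vstar :: "(real^2) set" where
  "vstar = (\<Union>n. gasket_vertices v n)"

lemma vtx_in_vstar [simp]: "vtx w j \<in> vstar"
  by (auto simp: vstar_def words_def intro!: exI[of _ "length w"])

lemma countable_vstar: "countable vstar"
  by (simp add: vstar_def countable_finite)

text \<open>The geometric series with ratio \<open>sqrt (3/5)\<close>, the factor by which the
  oscillation bound on cells shrinks from one level to the next.\<close>

definition osc_const :: real where
  "osc_const = 1 / (1 - sqrt (3/5))"

lemma sqrt35_less_1: "sqrt (3/5) < 1"
  by (simp add: real_sqrt_lt_1_iff)

text \<open>The word \<open>u\<close> is descended letter by letter. The corner \<open>a\<close> of
  the subcell \<open>a\<close> is also a corner of the parent cell, so each step moves within one
  cell and \<open>vtx_osc\<close> bounds it; the bounds form a geometric series.\<close>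

lemma vtx_append_osc:
  assumes B: "\<And>n. energy_level v n f \<le> B"
  shows "\<bar>f (vtx (w @ u) j) - f (vtx w i)\<bar> \<le> osc_const * (sqrt B * sqrt (3/5) ^ length w)"
proof -
  define r where "r = sqrt (3/5)"
  define K where "K = sqrt B * r ^ length w"
  have r: "0 < r" "r < 1" using sqrt35_less_1 by (auto simp: r_def)
  have B0: "0 \<le> B" using B[of 0] energy_level_nonneg[of 0 f] by linarith
  then have K0: "0 \<le> K" using r by (simp add: K_def)
  have osc: "\<bar>f (vtx (w @ u) i) - f (vtx (w @ u) j)\<bar> \<le> K * r ^ length u" for u i j
  proof -
    have "\<bar>f (vtx (w @ u) i) - f (vtx (w @ u) j)\<bar> \<le> sqrt (energy_level v (length (w @ u)) f) * r ^ length (w @ u)"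
      unfolding r_def by (rule vtx_osc) (simp add: words_def)
    also have "\<dots> \<le> sqrt B * r ^ length (w @ u)"
      using B r by (intro mult_right_mono) auto
    finally show ?thesis by (simp add: K_def power_add)
  qed
  have "\<bar>f (vtx (w @ u) j) - f (vtx w i)\<bar> \<le> K * (\<Sum>l\<le>length u. r ^ l)"
  proof (induction u arbitrary: j rule: rev_induct)
    case Nil
    then show ?case using osc[of "[]" j i] by simp
  next
    case (snoc a u)
    have "\<bar>f (vtx (w @ u @ [a]) j) - f (vtx (w @ u @ [a]) a)\<bar> \<le> K * r ^ Suc (length u)"
      using osc[of "u @ [a]" j a] by simp
    moreover have "vtx (w @ u @ [a]) a = vtx (w @ u) a"
      using vtx_snoc_same[of "w @ u" a] by simp
    ultimately show ?case using snoc[of a] by (simp add: algebra_simps)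
  qed
  also have "\<dots> \<le> K * osc_const"
  proof (intro mult_left_mono K0)
    show "(\<Sum>l\<le>length u. r ^ l) \<le> osc_const"
      using r unfolding osc_const_def r_def[symmetric]
      by (simp add: sum_gp0 divide_right_mono)
  qed
  finally show ?thesis by (simp add: K_def r_def mult.commute)
qed

end

section \<open>Continuity of functions of finite energy\<close>

context gasket_set
begin

lemma vstar_cell_osc:
  assumes B: "\<And>n. energy_level v n f \<le> B" and y: "y \<in> vstar" "y \<in> cell w"
  shows "\<bar>f y - f (vtx w i)\<bar> \<le> osc_const * (sqrt B * sqrt (3/5) ^ length w)"
proof -
  obtain n where "y \<in> gasket_vertices v n" using y by (auto simp: vstar_def)
  then have "y \<in> gasket_vertices v (length w + n)" using vertices_mono[of n "length w + n"] by auto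
  then obtain u j where "y = vtx (w @ u) j" using vertex_in_cellE y by metis
  then show ?thesis using vtx_append_osc[OF B] by simp
qed

lemma unique_cell:
  assumes "x \<notin> vstar" "x \<in> cell w" "x \<in> cell w'" "length w = length w'"
  shows "w = w'"
proof (rule ccontr)
  assume "w \<noteq> w'"
  then obtain i where "x = vtx w i"
    using cell_vtx[of w "length w" w' x] assms(2-4) unfolding words_def mem_Collect_eq by metis
  then show False using assms(1) vtx_in_vstar by metis
qed

lemma tendsto_sqrt35: "(\<lambda>m. K * (B * sqrt (3/5) ^ m)) \<longlonglongrightarrow> 0"
  by (intro tendsto_mult_right_zero LIMSEQ_power_zero) (use sqrt35_less_1 in auto)

text \<open>Bounded energy forces uniform continuity on the vertices. Away from \<open>vstar\<close>
  a point lies in only one cell per level, so the cells chosen independently by \<open>code\<close>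
  are automatically nested and the values at their corners form a Cauchy sequence.\<close>

lemma energy_bounded_extension:
  assumes B: "\<And>n. energy_level v n f \<le> B"
  shows "\<exists>g. continuous_on S g \<and> (\<forall>x\<in>vstar. g x = f x)"
proof -
  let ?K = "\<lambda>m. osc_const * (sqrt B * sqrt (3/5) ^ m)"
  define code where "code m x = (SOME w. w \<in> words m \<and> x \<in> cell w)" for m x
  have code: "code m x \<in> words m \<and> x \<in> cell (code m x)" if "x \<in> S" for m x
    unfolding code_def by (rule someI_ex) (use that S_cells[of m] in blast)
  define g where "g x = (if x \<in> vstar then f x else lim (\<lambda>m. f (vtx (code m x) 1)))" for x
  have g: "\<bar>g x - f (vtx w i)\<bar> \<le> ?K (length w)" if x: "x \<in> cell w" for x w i
  proof (cases "x \<in> vstar")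
    case True
    then show ?thesis using vstar_cell_osc[OF B True x] by (simp add: g_def)
  next
    case False
    have xS: "x \<in> S" using x cell_subset by auto
    have near: "\<bar>f (vtx (code k x) 1) - f (vtx u j)\<bar> \<le> ?K (length u)"
      if "x \<in> cell u" "length u \<le> k" for k u j
    proof -
      define u1 u2 where "u1 = take (length u) (code k x)" "u2 = drop (length u) (code k x)"
      have c: "code k x = u1 @ u2" "length u1 = length u"
        using code[OF xS, of k] that by (auto simp: u1_u2_def words_def)
      have "x \<in> cell u1" using c code[OF xS, of k] cell_append by auto
      then have "u1 = u" using unique_cell[OF False _ that(1)] c by auto
      then show ?thesis using vtx_append_osc[OF B, of u u2 1 j] c by simp
    qed
    have "Cauchy (\<lambda>m. f (vtx (code m x) 1))"
    proof (rule CauchyI)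
      fix e :: real assume "0 < e"
      then obtain M where M: "?K M < e / 2"
        using order_tendstoD(2)[OF tendsto_sqrt35, of "e / 2" osc_const "sqrt B"]
        by (auto simp: eventually_sequentially)
      have c: "x \<in> cell (code M x)" "length (code M x) = M" using code[OF xS, of M] by (auto simp: words_def)
      have "norm (f (vtx (code m x) 1) - f (vtx (code k x) 1)) < e" if "M \<le> m" "M \<le> k" for m k
        using near[OF c(1), of m 1] near[OF c(1), of k 1] that c M by (simp add: abs_le_iff abs_less_iff)
      then show "\<exists>M. \<forall>m\<ge>M. \<forall>k\<ge>M. norm (f (vtx (code m x) 1) - f (vtx (code k x) 1)) < e" by blast
    qed
    then have "(\<lambda>m. f (vtx (code m x) 1)) \<longlonglongrightarrow> g x"
      using False by (simp add: g_def real_Cauchy_convergent convergent_LIMSEQ_iff[symmetric])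
    then have "(\<lambda>m. \<bar>f (vtx (code m x) 1) - f (vtx w i)\<bar>) \<longlonglongrightarrow> \<bar>g x - f (vtx w i)\<bar>"
      by (intro tendsto_intros)
    then show ?thesis
      by (rule LIMSEQ_le_const2) (use near[OF x] in blast)
  qed
  have "continuous_on S g"
    unfolding continuous_on_iff
  proof (intro ballI allI impI)
    fix x e assume x: "x \<in> S" "(0::real) < e"
    then obtain M where M: "?K M < e / 2"
      using order_tendstoD(2)[OF tendsto_sqrt35, of "e / 2" osc_const "sqrt B"]
      by (auto simp: eventually_sequentially)
    obtain \<delta> where \<delta>: "\<delta> > 0"
      "\<And>y. y \<in> S \<Longrightarrow> dist y x < \<delta> \<Longrightarrow> \<exists>w\<in>words M. x \<in> cell w \<and> y \<in> cell w"
      using cell_neighbourhood[OF x(1), of M] by blast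
    have "dist (g y) (g x) < e" if y: "y \<in> S" "dist y x < \<delta>" for y
    proof -
      obtain w where "w \<in> words M" "x \<in> cell w" "y \<in> cell w" using \<delta>(2)[OF y] by blast
      then show ?thesis
        using g[of x w 1] g[of y w 1] M by (simp add: words_def dist_real_def abs_le_iff abs_less_iff)
    qed
    then show "\<exists>d>0. \<forall>y\<in>S. dist y x < d \<longrightarrow> dist (g y) (g x) < e" using \<delta>(1) by blast
  qed
  then show ?thesis by (intro exI[of _ g]) (simp add: g_def)
qed

lemma vstar_dense:
  assumes "x \<in> cell w"
  obtains y where "y \<longlonglongrightarrow> x" "\<And>k. y k \<in> vstar" "\<And>k. y k \<in> cell w"
proof -
  have "\<exists>u. length u = k \<and> x \<in> cell (w @ u)" for k
  proof (induction k)
    case (Suc k)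
    then obtain u where u: "length u = k" "x \<in> cell (w @ u)" by blast
    then obtain i where "x \<in> cell ((w @ u) @ [i])" using cell_split[of "w @ u"] by blast
    then show ?case using u by (intro exI[of _ "u @ [i]"]) auto
  qed (use assms in auto)
  then obtain u where u: "\<And>k. length (u k) = k" "\<And>k. x \<in> cell (w @ u k)" by metis
  have "dist (vtx (w @ u k) 1) x \<le> diameter S * (1/2) ^ k" for k
  proof -
    have "dist (vtx (w @ u k) 1) x \<le> diameter S / 2 ^ (length w + k)"
      using dist_cell[OF vtx_in_cell u(2)[of k], of 1] by (simp add: u)
    also have "\<dots> \<le> diameter S / 2 ^ k"
      using diameter_ge_0[OF compact_imp_bounded[OF compact_S]]
      by (intro divide_left_mono) auto
    finally show ?thesis by (simp add: power_divide)
  qed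
  then have "(\<lambda>k. vtx (w @ u k) 1) \<longlonglongrightarrow> x" by (rule LIMSEQ_geometric)
  then show ?thesis by (rule that) (auto simp: vtx_append_in_cell)
qed

lemma energy_sup_bound:
  assumes f: "f \<in> energy_domain v S" and x: "x \<in> cell w"
  shows "\<bar>f x - f (vtx w i)\<bar> \<le> osc_const * (sqrt (energy v f) * sqrt (3/5) ^ length w)"
proof -
  obtain y where y: "y \<longlonglongrightarrow> x" "\<And>k. y k \<in> vstar" "\<And>k. y k \<in> cell w"
    using vstar_dense[OF x] by blast
  have "continuous_on S f" using f by (simp add: energy_domain_def)
  then have "(\<lambda>k. f (y k)) \<longlonglongrightarrow> f x"
    using y(1) x y(3) cell_subset[of w] by (intro continuous_on_tendsto_compose[of S f] always_eventually) auto
  then have "(\<lambda>k. \<bar>f (y k) - f (vtx w i)\<bar>) \<longlonglongrightarrow> \<bar>f x - f (vtx w i)\<bar>" by (intro tendsto_intros)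
  then show ?thesis
    by (rule LIMSEQ_le_const2)
      (use vstar_cell_osc[where B = "energy v f", OF energy_level_le_energy[OF f] y(2) y(3)] in blast)
qed

end

section \<open>The measure and Riemann sums\<close>

locale gasket_space = gasket_set +
  fixes \<mu> :: "(real^2) measure"
  assumes gasket_measure: "is_gasket_measure v S \<mu>"
begin

sublocale prob_space \<mu>
  using gasket_measure by (simp add: is_gasket_measure_def)

lemma sets_mu: "sets \<mu> = sets (restrict_space borel S)"
  using gasket_measure by (simp add: is_gasket_measure_def)

lemma space_mu: "space \<mu> = S"
  using sets_eq_imp_space_eq[OF sets_mu] by (simp add: space_restrict_space)

lemma measure_cell: "measure \<mu> (cell w) = 1 / 3 ^ length w"
  using gasket_measure by (simp add: is_gasket_measure_def cell_def)

lemma closed_in_sets: "closed A \<Longrightarrow> A \<subseteq> S \<Longrightarrow> A \<in> sets \<mu>"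
  unfolding sets_mu sets_restrict_space
  by (intro image_eqI[of _ _ A]) auto

lemma cell_in_sets [measurable]: "cell w \<in> sets \<mu>"
  by (intro closed_in_sets compact_imp_closed compact_cell cell_subset)

text \<open>A point lies in cells of measure \<open>3 powr (- n)\<close> for all \<open>n\<close>,
  so it is null, and \<open>vstar\<close> is countable. Overlaps of cells may therefore be ignored
  in integrals.\<close>

lemma AE_not_vstar: "AE x in \<mu>. x \<notin> vstar"
proof -
  have "{x} \<in> null_sets \<mu>" if "x \<in> vstar" for x
  proof -
    have xS: "x \<in> S" using that vertices_subset_S by (auto simp: vstar_def)
    have sets: "{x} \<in> sets \<mu>" using xS by (intro closed_in_sets) auto
    have "measure \<mu> {x} \<le> (1/3) ^ n" for n
    proof -
      obtain w where w: "w \<in> words n" "x \<in> cell w" using xS S_cells[of n] by blast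
      then have "measure \<mu> {x} \<le> measure \<mu> (cell w)" by (intro finite_measure_mono) auto
      then show ?thesis using w by (simp add: measure_cell words_def power_divide)
    qed
    moreover have "(\<lambda>n. (1/3 :: real) ^ n) \<longlonglongrightarrow> 0" by (rule LIMSEQ_power_zero) simp
    ultimately have "measure \<mu> {x} \<le> 0" by (intro LIMSEQ_le_const) auto
    then have "measure \<mu> {x} = 0" using measure_nonneg[of \<mu> "{x}"] by linarith
    then show ?thesis using sets by (simp add: null_sets_def emeasure_eq_measure)
  qed
  then have "(\<Union>x\<in>vstar. {x}) \<in> null_sets \<mu>"
    by (intro null_sets_UN' countable_vstar)
  then show ?thesis by (auto dest: AE_not_in)
qed

lemma continuous_measurable:
  fixes f :: "real^2 \<Rightarrow> real"
  shows "continuous_on S f \<Longrightarrow> f \<in> borel_measurable \<mu>"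
  using borel_measurable_continuous_on_restrict[of S f] measurable_cong_sets[OF sets_mu refl, of borel]
  by blast

lemma continuous_integrable:
  fixes f :: "real^2 \<Rightarrow> real"
  assumes "continuous_on S f" shows "integrable \<mu> f"
proof -
  have "bounded (f ` S)" by (intro compact_imp_bounded compact_continuous_image assms compact_S)
  then obtain B where "\<And>x. x \<in> S \<Longrightarrow> norm (f x) \<le> B" by (auto simp: bounded_iff)
  then show ?thesis
    by (intro integrable_const_bound[of _ B] continuous_measurable assms AE_I2) (auto simp: space_mu)
qed

text \<open>The step functions that take on each cell the value of \<open>\<phi>\<close> at its
  corner \<open>i\<close> converge to \<open>\<phi>\<close> off the vertices; the bound of
  \<open>\<phi>\<close> on \<open>S\<close> dominates them.\<close>

lemma riemann_sum:
  fixes \<phi> :: "real^2 \<Rightarrow> real"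
  assumes "continuous_on S \<phi>"
  shows "(\<lambda>n. (\<Sum>w\<in>words n. \<phi> (vtx w i)) / 3 ^ n) \<longlonglongrightarrow> (LINT x|\<mu>. \<phi> x)"
proof -
  let ?\<psi> = "\<lambda>n x. \<Sum>w\<in>words n. indicator (cell w) x * \<phi> (vtx w i)"
  have "bounded (\<phi> ` S)" by (intro compact_imp_bounded compact_continuous_image assms compact_S)
  then obtain B where B: "\<And>x. x \<in> S \<Longrightarrow> norm (\<phi> x) \<le> B" by (auto simp: bounded_iff)
  have eq: "?\<psi> n x = \<phi> (vtx w i)" if "x \<notin> vstar" "w \<in> words n" "x \<in> cell w" for n x w
  proof -
    have "?\<psi> n x = (\<Sum>u\<in>words n. if u = w then \<phi> (vtx w i) else 0)"
    proof (intro sum.cong refl)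
      fix u assume "u \<in> words n"
      then have "x \<in> cell u \<longleftrightarrow> u = w"
        using unique_cell[OF that(1), of u w] that(2,3) unfolding words_def mem_Collect_eq by metis
      then show "indicator (cell u) x * \<phi> (vtx u i) = (if u = w then \<phi> (vtx w i) else 0)"
        by (simp add: indicator_def)
    qed
    then show ?thesis using that(2) by simp
  qed
  have ex: "\<exists>w\<in>words n. x \<in> cell w" if "x \<in> S" for n x using that S_cells[of n] by blast
  have "(\<lambda>n. LINT x|\<mu>. ?\<psi> n x) \<longlonglongrightarrow> (LINT x|\<mu>. \<phi> x)"
  proof (rule integral_dominated_convergence[where w = "\<lambda>_. B"])
    show "?\<psi> n \<in> borel_measurable \<mu>" for n
      by (intro borel_measurable_sum borel_measurable_times borel_measurable_indicator
          borel_measurable_const cell_in_sets)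
    show "AE x in \<mu>. (\<lambda>n. ?\<psi> n x) \<longlonglongrightarrow> \<phi> x"
      using AE_not_vstar AE_space
    proof eventually_elim
      case (elim x)
      obtain w where w: "\<And>n. w n \<in> words n" "\<And>n. x \<in> cell (w n)" using ex elim space_mu by metis
      have "dist (vtx (w n) i) x \<le> diameter S * (1/2) ^ n" for n
        using dist_cell[OF vtx_in_cell w(2)[of n], of i] w(1)[of n] by (simp add: words_def power_divide)
      then have "(\<lambda>n. vtx (w n) i) \<longlonglongrightarrow> x" by (rule LIMSEQ_geometric)
      then have "(\<lambda>n. \<phi> (vtx (w n) i)) \<longlonglongrightarrow> \<phi> x"
        using elim vtx_in_cell cell_subset
        by (intro continuous_on_tendsto_compose[OF assms] always_eventually allI) (auto simp: space_mu)
      then show ?case using eq[OF elim(1) w] by simp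
    qed
    show "AE x in \<mu>. norm (?\<psi> n x) \<le> B" for n
      using AE_not_vstar AE_space
    proof eventually_elim
      case (elim x)
      then obtain w where "w \<in> words n" "x \<in> cell w" using ex space_mu by metis
      then show ?case using eq[OF elim(1)] B vtx_in_cell[of w i] cell_subset[of w] by auto
    qed
  qed (auto intro: continuous_measurable assms)
  moreover have "(LINT x|\<mu>. ?\<psi> n x) = (\<Sum>w\<in>words n. \<phi> (vtx w i)) / 3 ^ n" for n
  proof -
    have "(LINT x|\<mu>. ?\<psi> n x) = (\<Sum>w\<in>words n. measure \<mu> (cell w) * \<phi> (vtx w i))"
      by (subst Bochner_Integration.integral_sum) (auto simp: emeasure_eq_measure)
    also have "\<dots> = (\<Sum>w\<in>words n. \<phi> (vtx w i) / 3 ^ n)"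
      by (intro sum.cong refl) (simp add: measure_cell words_def)
    finally show ?thesis by (simp add: sum_divide_distrib)
  qed
  ultimately show ?thesis by simp
qed

text \<open>The factor 3 counts the corners of a cell. With the factor 2 of
  \<open>level_form_eqn\<close> it yields the constant 6 in the normalization of the
  Laplacian.\<close>

lemma neumann_laplacian_limit:
  fixes f h :: "real^2 \<Rightarrow> real"
  assumes "continuous_on S f" "continuous_on S h"
  shows "(\<lambda>n. (\<Sum>w\<in>words n. \<Sum>i\<in>UNIV. f (vtx w i) * h (vtx w i)) / 3 ^ n) \<longlonglongrightarrow> 3 * (LINT x|\<mu>. f x * h x)"
proof -
  have "(\<lambda>n. \<Sum>i\<in>(UNIV :: 3 set). (\<Sum>w\<in>words n. f (vtx w i) * h (vtx w i)) / 3 ^ n)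
      \<longlonglongrightarrow> (\<Sum>i\<in>(UNIV :: 3 set). LINT x|\<mu>. f x * h x)"
    by (intro tendsto_sum riemann_sum[of "\<lambda>x. f x * h x"] continuous_intros assms)
  then show ?thesis
    by (simp add: sum_divide_distrib[symmetric] sum.swap[of _ "words _"])
qed

end

section \<open>Spectral decimation\<close>

text \<open>The factor by which \<open>eqn\<close> at an old vertex changes when the midpoint
  equations are solved. Its zero 3/2 and its singularities 1/2 and 5/4 are the exceptional values of
  the decimation.\<close>

definition decimation_factor :: "real \<Rightarrow> real" where
  "decimation_factor l = (3 - 2 * l) / ((5 - 4 * l) * (1 - 2 * l))"

text \<open>A backward orbit of the decimation map inside \<open>[0, 1/8]\<close>, an interval free
  of exceptional values on which the estimates for the factor hold.\<close>

definition decimation_seq :: "nat \<Rightarrow> (nat \<Rightarrow> real) \<Rightarrow> bool" where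
  "decimation_seq n lam \<longleftrightarrow> (\<forall>m\<ge>n. 0 \<le> lam m \<and> lam m \<le> 1/8 \<and> lam m = decimation (lam (Suc m)))"

text \<open>Along an orbit the last bound keeps the product of the factors
  \<open>5/3 * decimation_factor l\<close> finite. The second one compares a factor with the growth
  of the sup norm in one extension step, see \<open>mid_value_bound\<close>, so that the same
  product controls the function itself.\<close>

lemma decimation_factor_bounds:
  assumes "0 \<le> l" "l \<le> 1/8"
  shows "1 \<le> 5/3 * decimation_factor l" "1 / (1 - 2 * l) \<le> 5/3 * decimation_factor l"
    "5/3 * decimation_factor l \<le> 1 + 5 * l"
proof -
  have p: "0 < (5 - 4 * l) * (1 - 2 * l)" "0 < 5 - 4 * l" "0 < 1 - 2 * l" using assms by auto
  have "1 / (1 - 2 * l) = (5 - 4 * l) / ((5 - 4 * l) * (1 - 2 * l))" using p by simp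
  also have "\<dots> \<le> (5 / 3 * (3 - 2 * l)) / ((5 - 4 * l) * (1 - 2 * l))"
    using assms p by (intro divide_right_mono) auto
  finally show 2: "1 / (1 - 2 * l) \<le> 5/3 * decimation_factor l" by (simp add: decimation_factor_def)
  have "1 \<le> 1 / (1 - 2 * l)" using assms by simp
  then show "1 \<le> 5/3 * decimation_factor l" using 2 by linarith
  have l2: "l * l \<le> l / 8" "l * l * l \<ge> 0" using assms mult_left_mono[of l "1/8" l] by auto
  have "5 / 3 * (3 - 2 * l) \<le> (1 + 5 * l) * ((5 - 4 * l) * (1 - 2 * l))"
  proof -
    have "(1 + 5 * l) * ((5 - 4 * l) * (1 - 2 * l)) = 5 + 11 * l - 62 * (l * l) + 40 * (l * l * l)"
      by (simp add: algebra_simps)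
    moreover have "5 / 3 * (3 - 2 * l) = 5 - 10 / 3 * l" by (simp add: algebra_simps)
    ultimately show ?thesis using l2 assms by linarith
  qed
  then show "5/3 * decimation_factor l \<le> 1 + 5 * l"
    using p by (simp add: decimation_factor_def divide_le_eq)
qed

lemma decimation_seqD:
  assumes "decimation_seq n lam" "n \<le> m"
  shows "0 \<le> lam m" "lam m \<le> 1/8" "lam m = decimation (lam (Suc m))"
  using assms unfolding decimation_seq_def by blast+

text \<open>A telescoping majorant for the terms \<open>5 * lam (Suc m)\<close> from the upper bound
  of the factors: their sum is at most \<open>2 * lam n\<close>.\<close>

lemma decimation_seq_decay:
  assumes "decimation_seq n lam" "n \<le> m"
  shows "5 * lam (Suc m) \<le> 2 * (lam m - lam (Suc m))"
proof -
  have b: "0 \<le> lam (Suc m)" "lam (Suc m) \<le> 1/8" "lam m = decimation (lam (Suc m))"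
    by (rule decimation_seqD[OF assms(1)], use assms(2) in simp)+
  have "lam (Suc m) * lam (Suc m) \<le> lam (Suc m) * (1/8)" using b by (intro mult_left_mono) auto
  moreover have "lam m = 5 * lam (Suc m) - 4 * (lam (Suc m) * lam (Suc m))"
    using b(3) by (simp add: decimation_def algebra_simps)
  moreover define x y where "x = lam (Suc m)" "y = x * x"
  ultimately have "y \<le> x / 8" "lam m = 5 * x - 4 * y" "0 \<le> x" using b(1) by simp_all
  then show ?thesis unfolding x_y_def(1)[symmetric] by simp
qed

lemma decimation_seq_prod:
  assumes "decimation_seq n lam"
  defines "c \<equiv> \<lambda>k. \<Prod>j<k. 5/3 * decimation_factor (lam (Suc (n + j)))"
  obtains \<kappa> where "c \<longlonglongrightarrow> \<kappa>" "1 \<le> \<kappa>" "\<And>k. c k \<le> \<kappa>" "\<And>k. 1 \<le> c k"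
proof -
  note lam = decimation_seqD[OF assms(1)]
  have f: "1 \<le> 5/3 * decimation_factor (lam (Suc (n + j)))"
    "5/3 * decimation_factor (lam (Suc (n + j))) \<le> 1 + 5 * lam (Suc (n + j))" for j
    using decimation_factor_bounds(1,3)[OF lam(1,2)[of "Suc (n + j)"]] by simp_all
  have c1: "1 \<le> c k" for k unfolding c_def by (intro prod_ge_1) (use f in auto)
  have ub: "c k \<le> exp (2 * (lam n - lam (n + k)))" for k
  proof (induction k)
    case (Suc k)
    have "5/3 * decimation_factor (lam (Suc (n + k))) \<le> exp (5 * lam (Suc (n + k)))"
      using f(2)[of k] exp_ge_add_one_self[of "5 * lam (Suc (n + k))"] by linarith
    also have "\<dots> \<le> exp (2 * (lam (n + k) - lam (Suc (n + k))))"
      using decimation_seq_decay[OF assms(1), of "n + k"] by simp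
    finally have "c k * (5/3 * decimation_factor (lam (Suc (n + k))))
      \<le> exp (2 * (lam n - lam (n + k))) * exp (2 * (lam (n + k) - lam (Suc (n + k))))"
      using Suc c1[of k] f(1)[of k] by (intro mult_mono) auto
    also have "\<dots> = exp (2 * (lam n - lam (n + Suc k)))"
      by (simp add: exp_add[symmetric] algebra_simps)
    finally show ?case by (simp add: c_def)
  qed (simp add: c_def)
  have ub2: "c k \<le> exp (2 * lam n)" for k
    using ub[of k] lam(1)[of "n + k"] by (rule_tac order_trans) auto
  have mono: "incseq c"
  proof (rule incseq_SucI)
    fix k
    have "c k * 1 \<le> c k * (5/3 * decimation_factor (lam (Suc (n + k))))"
      using f(1)[of k] c1[of k] by (intro mult_left_mono) auto
    then show "c k \<le> c (Suc k)" by (simp add: c_def)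
  qed
  obtain \<kappa> where k: "c \<longlonglongrightarrow> \<kappa>" "\<forall>k. c k \<le> \<kappa>"
    using incseq_convergent[OF mono] ub2 by blast
  show ?thesis using that[OF k(1)] k(2) c1 by (meson order_trans)
qed

section \<open>The midpoint equations\<close>

context triangle
begin

definition restr :: "nat \<Rightarrow> (real^2 \<Rightarrow> real) \<Rightarrow> real^2 \<Rightarrow> real" where
  "restr n f x = (if x \<in> gasket_vertices v n then f x else 0)"

definition graph_eigenspace :: "nat \<Rightarrow> real \<Rightarrow> (real^2 \<Rightarrow> real) set" where
  "graph_eigenspace n l =
     {f. (\<forall>x\<in>gasket_vertices v n. eqn n l f x = 0) \<and> (\<forall>x. x \<notin> gasket_vertices v n \<longrightarrow> f x = 0)}"

text \<open>The solution of the three equations at the midpoints of a cell, given the values at its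
  corners. For \<open>l = 0\<close> it is the harmonic rule with weights 1/5 for the opposite corner
  and 2/5 for the two adjacent ones.\<close>

definition mid_value :: "real \<Rightarrow> (real^2 \<Rightarrow> real) \<Rightarrow> 3 list \<Rightarrow> 3 \<Rightarrow> real" where
  "mid_value l f w k = ((\<Sum>j\<in>UNIV. f (vtx w j)) - f (vtx w k) + (\<Sum>j\<in>UNIV. f (vtx w j)) / (1 - 2 * l)) / (5 - 4 * l)"

lemma eqn_cong:
  assumes "\<And>x. x \<in> gasket_vertices v n \<Longrightarrow> f x = g x" "x \<in> gasket_vertices v n"
  shows "eqn n l f x = eqn n l g x"
  unfolding eqn_def
  by (intro sum.cong refl) (use assms in \<open>auto simp: flags_at_def intro!: sum.cong\<close>)

lemma cell_form_cong:
  assumes "\<And>j. f (vtx w j) = f' (vtx w j)" "\<And>j. g (vtx w j) = g' (vtx w j)"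
  shows "cell_form w f g = cell_form w f' g'"
  by (simp add: cell_form_def assms)

lemma level_form_cong:
  assumes "\<And>x. x \<in> gasket_vertices v n \<Longrightarrow> f x = f' x" "\<And>x. x \<in> gasket_vertices v n \<Longrightarrow> g x = g' x"
  shows "level_form n f g = level_form n f' g'"
  unfolding level_form_def
  by (intro arg_cong2[where f = "(*)"] sum.cong refl cell_form_cong assms) auto

lemma midpoint_eqn:
  assumes "w \<in> words n"
  shows "eqn (Suc n) l f (mid w k) = (\<Sum>j\<in>UNIV. f (vtx w j)) - f (vtx w k)
    + (\<Sum>j\<in>UNIV. f (mid w j)) - (5 - 4 * l) * f (mid w k)"
proof -
  have "(w @ [k + 1], k + 2) \<noteq> (w @ [k + 2], k + 1)" by simp
  then have "eqn (Suc n) l f (mid w k) =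
      ((\<Sum>j\<in>UNIV. f (vtx (w @ [k + 1]) j)) - (3 - 2 * l) * f (mid w k)) +
      ((\<Sum>j\<in>UNIV. f (vtx (w @ [k + 2]) j)) - (3 - 2 * l) * f (mid w k))"
    unfolding eqn_def flags_at_mid[OF assms] by (subst sum.insert) auto
  then show ?thesis
    unfolding sum_vtx_snoc sum_three[of _ k] three_add_add by (simp add: algebra_simps)
qed

text \<open>Adding the three midpoint equations gives \<open>Z * (1 - 2 * l) = A\<close> for the sum
  \<open>Z\<close> of the midpoint values and the sum \<open>A\<close> of the corner values. With
  \<open>Z\<close> known the equations decouple.\<close>

lemma midpoint_solution:
  assumes w: "w \<in> words n" and l: "l \<noteq> 1/2" "l \<noteq> 5/4"
  shows "(\<forall>k. eqn (Suc n) l f (mid w k) = 0) \<longleftrightarrow> (\<forall>k. f (mid w k) = mid_value l f w k)"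
proof -
  define A Z where "A = (\<Sum>j\<in>UNIV. f (vtx w j))" and "Z = (\<Sum>j\<in>UNIV. f (mid w j))"
  have l': "1 - 2 * l \<noteq> 0" "5 - 4 * l \<noteq> 0" using l by auto
  have e: "eqn (Suc n) l f (mid w k) = A - f (vtx w k) + Z - (5 - 4 * l) * f (mid w k)" for k
    unfolding A_def Z_def by (rule midpoint_eqn[OF w])
  have m: "(5 - 4 * l) * mid_value l f w k = A - f (vtx w k) + A / (1 - 2 * l)" for k
    unfolding mid_value_def A_def[symmetric] using l' by simp
  show ?thesis
  proof
    assume h: "\<forall>k. eqn (Suc n) l f (mid w k) = 0"
    then have z: "(5 - 4 * l) * f (mid w k) = A - f (vtx w k) + Z" for k using e by simp
    have "(\<Sum>k\<in>UNIV. (5 - 4 * l) * f (mid w k)) = (\<Sum>k\<in>UNIV. A - f (vtx w k) + Z)" using z by simp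
    then have "(5 - 4 * l) * Z = 3 * A - A + 3 * Z"
      by (simp add: sum_distrib_left[symmetric] Z_def[symmetric] A_def[symmetric] sum.distrib sum_subtractf)
    then have "Z * (1 - 2 * l) = A" by (simp add: algebra_simps)
    then have "Z = A / (1 - 2 * l)" using l' by (simp add: nonzero_eq_divide_eq)
    then have "(5 - 4 * l) * f (mid w k) = (5 - 4 * l) * mid_value l f w k" for k using z m by simp
    then show "\<forall>k. f (mid w k) = mid_value l f w k" using l' by simp
  next
    assume h: "\<forall>k. f (mid w k) = mid_value l f w k"
    have "(5 - 4 * l) * Z = (\<Sum>k\<in>UNIV. A - f (vtx w k) + A / (1 - 2 * l))"
      unfolding Z_def sum_distrib_left using h m by simp
    also have "\<dots> = 2 * A + 3 * (A / (1 - 2 * l))"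
      by (simp add: A_def[symmetric] sum.distrib sum_subtractf)
    also have "\<dots> = (5 - 4 * l) * (A / (1 - 2 * l))" using l' by (simp add: field_simps)
    finally have "Z = A / (1 - 2 * l)" using l'(2) unfolding mult_cancel_left by simp
    then show "\<forall>k. eqn (Suc n) l f (mid w k) = 0" using e h m by simp
  qed
qed

lemma eqn_Suc_vertex_raw:
  assumes "x \<in> gasket_vertices v n"
  shows "eqn (Suc n) l f x = (\<Sum>(w, i)\<in>flags_at n x.
    f x + f (mid w (i + 1)) + f (mid w (i + 2)) - (3 - 2 * l) * f x)"
proof -
  have "inj_on (\<lambda>(w :: 3 list, i :: 3). (w @ [i], i)) (flags_at n x)" by (auto intro!: inj_onI)
  then show ?thesis
    unfolding eqn_def flags_at_Suc_vertex[OF assms]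
    by (simp add: sum.reindex case_prod_unfold sum_vtx_snoc del: three_add_add)
      (intro sum.cong refl, auto simp: flags_at_def)
qed

text \<open>The decimation identity holds already for each flag separately, hence for inner vertices
  and for the corners of the triangle alike.\<close>

lemma eqn_Suc_vertex:
  assumes x: "x \<in> gasket_vertices v n" and l: "l \<noteq> 1/2" "l \<noteq> 5/4"
    and f: "\<And>w k. w \<in> words n \<Longrightarrow> f (mid w k) = mid_value l f w k"
  shows "eqn (Suc n) l f x = decimation_factor l * eqn n (decimation l) f x"
proof -
  have l': "1 - 2 * l \<noteq> 0" "5 - 4 * l \<noteq> 0" using l by auto
  have "f x + f (mid w (i + 1)) + f (mid w (i + 2)) - (3 - 2 * l) * f x =
      decimation_factor l * ((\<Sum>j\<in>UNIV. f (vtx w j)) - (3 - 2 * decimation l) * f x)"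
    if "(w, i) \<in> flags_at n x" for w i
  proof -
    have w: "w \<in> words n" "vtx w i = x" using that by (auto simp: flags_at_def)
    define a b where "a = f (vtx w (i + 1))" "b = f (vtx w (i + 2))"
    show ?thesis
      unfolding f[OF w(1)] mid_value_def sum_three[of _ i] a_b_def[symmetric] w(2)
        decimation_factor_def decimation_def
      using l' by (simp add: divide_simps) (simp add: algebra_simps)
  qed
  then show ?thesis
    unfolding eqn_Suc_vertex_raw[OF x] eqn_def[of n] sum_distrib_left
    by (intro sum.cong refl) auto
qed

definition extend :: "nat \<Rightarrow> real \<Rightarrow> (real^2 \<Rightarrow> real) \<Rightarrow> real^2 \<Rightarrow> real" where
  "extend n l f x = (if x \<in> gasket_vertices v n then f x
     else if x \<in> gasket_vertices v (Suc n)
     then (let p = (SOME p. fst p \<in> words n \<and> x = mid (fst p) (snd p)) in mid_value l f (fst p) (snd p)) else 0)"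

lemma extend_vertex [simp]: "x \<in> gasket_vertices v n \<Longrightarrow> extend n l f x = f x"
  by (simp add: extend_def)

lemma extend_off: "x \<notin> gasket_vertices v (Suc n) \<Longrightarrow> extend n l f x = 0"
  using vertices_mono[of n "Suc n"] by (auto simp: extend_def)

lemma extend_mid:
  assumes "w \<in> words n" shows "extend n l f (mid w k) = mid_value l f w k"
proof -
  have "(SOME p. fst p \<in> words n \<and> mid w k = mid (fst p) (snd p)) = (w, k)"
    by (rule some_equality) (use assms mid_inj[OF assms] in \<open>auto simp: prod_eq_iff\<close>)
  then show ?thesis
    using mid_not_vertex[OF assms] mid_in_vertices[OF assms] by (simp add: extend_def)
qed

lemma mid_value_cong: "(\<And>j. f (vtx w j) = g (vtx w j)) \<Longrightarrow> mid_value l f w k = mid_value l g w k"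
  by (simp add: mid_value_def)

text \<open>The midpoint value combines the corner values with the nonnegative weights
  \<open>1\<close>, \<open>2 - 2 * l\<close>, \<open>2 - 2 * l\<close> over
  \<open>(1 - 2 * l) * (5 - 4 * l)\<close>, whose sum is \<open>1 / (1 - 2 * l)\<close>.\<close>

lemma mid_value_bound:
  assumes "0 \<le> l" "l \<le> 1/8" "\<And>j. \<bar>f (vtx w j)\<bar> \<le> B"
  shows "\<bar>mid_value l f w k\<bar> \<le> B / (1 - 2 * l)"
proof -
  have p: "0 < 1 - 2 * l" "0 < 5 - 4 * l" using assms by auto
  define a b c where abc: "a = f (vtx w k)" "b = f (vtx w (k + 1))" "c = f (vtx w (k + 2))"
  have eq: "mid_value l f w k = (a + (2 - 2 * l) * b + (2 - 2 * l) * c) / ((1 - 2 * l) * (5 - 4 * l))"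
    unfolding mid_value_def sum_three[of _ k] abc[symmetric]
    using p by (simp add: divide_simps) (simp add: algebra_simps)
  have ab: "\<bar>a\<bar> \<le> B" "\<bar>b\<bar> \<le> B" "\<bar>c\<bar> \<le> B" using assms(3) by (auto simp: abc)
  have "\<bar>a + (2 - 2 * l) * b + (2 - 2 * l) * c\<bar> \<le> \<bar>a\<bar> + (2 - 2 * l) * \<bar>b\<bar> + (2 - 2 * l) * \<bar>c\<bar>"
    using assms abs_triangle_ineq[of "a + (2 - 2 * l) * b" "(2 - 2 * l) * c"] abs_triangle_ineq[of a "(2 - 2 * l) * b"]
    by (simp add: abs_mult)
  also have "\<dots> \<le> B + (2 - 2 * l) * B + (2 - 2 * l) * B"
    using ab assms by (intro add_mono mult_left_mono) auto
  also have "\<dots> = B * (5 - 4 * l)" by (simp add: algebra_simps)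
  finally have num: "\<bar>a + (2 - 2 * l) * b + (2 - 2 * l) * c\<bar> \<le> B * (5 - 4 * l)" .
  have "\<bar>mid_value l f w k\<bar> \<le> B * (5 - 4 * l) / ((1 - 2 * l) * (5 - 4 * l))"
    unfolding eq abs_divide abs_of_pos[OF mult_pos_pos[OF p]]
    by (rule divide_right_mono[OF num]) (use p in simp)
  then show ?thesis using p by simp
qed

text \<open>No extension step changes earlier values, so the stages fit together;
  \<open>LEAST\<close> selects the first stage at which a vertex occurs.\<close>

lemma extension_exists:
  "\<exists>F. (\<forall>x\<in>gasket_vertices v n. F x = u x) \<and>
     (\<forall>m\<ge>n. \<forall>w\<in>words m. \<forall>k. F (mid w k) = mid_value (lam (Suc m)) F w k)"
proof -
  define g where "g = rec_nat u (\<lambda>k f. extend (n + k) (lam (Suc (n + k))) f)"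
  have g0: "g 0 = u" and gS: "g (Suc k) = extend (n + k) (lam (Suc (n + k))) (g k)" for k
    by (simp_all add: g_def)
  have stable: "g (k + j) x = g k x" if "x \<in> gasket_vertices v (n + k)" for k j x
  proof (induction j)
    case (Suc j)
    have "x \<in> gasket_vertices v (n + (k + j))" using that vertices_mono[of "n + k" "n + (k + j)"] by auto
    then show ?case using Suc by (simp add: gS)
  qed simp
  define F where "F x = g (LEAST k. x \<in> gasket_vertices v (n + k)) x" for x
  have F: "F x = g k x" if "x \<in> gasket_vertices v (n + k)" for x k
  proof -
    let ?L = "LEAST k. x \<in> gasket_vertices v (n + k)"
    have "x \<in> gasket_vertices v (n + ?L)" using that by (rule LeastI)
    moreover have "?L \<le> k" using that by (rule Least_le)
    ultimately show ?thesis using stable[of x ?L "k - ?L"] by (simp add: F_def)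
  qed
  show ?thesis
  proof (intro exI[of _ F] conjI ballI allI impI)
    fix x assume "x \<in> gasket_vertices v n"
    then show "F x = u x" using F[of x 0] g0 by simp
  next
    fix m w k assume m: "n \<le> m" and w: "w \<in> words m"
    define j where "j = m - n"
    have mj: "m = n + j" using m by (simp add: j_def)
    have "F (mid w k) = g (Suc j) (mid w k)" using F mid_in_vertices[OF w] mj by simp
    also have "\<dots> = mid_value (lam (Suc m)) (g j) w k"
      unfolding gS using extend_mid w mj by simp
    also have "\<dots> = mid_value (lam (Suc m)) F w k"
      by (rule mid_value_cong) (use F[of _ j] w mj vtx_in_vertices in metis)
    finally show "F (mid w k) = mid_value (lam (Suc m)) F w k" .
  qed
qed

section \<open>Extension of arbitrary data along an orbit\<close>

context
  fixes n :: nat and lam :: "nat \<Rightarrow> real" and F :: "real^2 \<Rightarrow> real"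
  assumes lam: "decimation_seq n lam"
    and F: "\<And>m w k. n \<le> m \<Longrightarrow> w \<in> words m \<Longrightarrow> F (mid w k) = mid_value (lam (Suc m)) F w k"
begin

lemma lam_props:
  assumes "n \<le> m"
  shows "0 \<le> lam m" "lam m \<le> 1/8" "lam m = decimation (lam (Suc m))" "lam m \<noteq> 1/2" "lam m \<noteq> 5/4"
  using decimation_seqD[OF lam assms] by linarith+

text \<open>The data on level \<open>n\<close> need not solve the equation there. Their residual is
  only multiplied by one decimation factor per level, and the rescaling by 5/3 is that of the
  energy. All later vertices have residual zero, by \<open>extension_eqn_new\<close>.\<close>

lemma extension_eqn_vertex:
  assumes "x \<in> gasket_vertices v n"
  shows "(5/3) ^ (n + k) * eqn (n + k) (lam (n + k)) F x =
    (5/3) ^ n * (\<Prod>j<k. 5/3 * decimation_factor (lam (Suc (n + j)))) * eqn n (lam n) F x"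
proof (induction k)
  case (Suc k)
  have x: "x \<in> gasket_vertices v (n + k)" using assms vertices_mono[of n "n + k"] by auto
  have "eqn (Suc (n + k)) (lam (Suc (n + k))) F x =
      decimation_factor (lam (Suc (n + k))) * eqn (n + k) (lam (n + k)) F x"
    using eqn_Suc_vertex[OF x, of "lam (Suc (n + k))" F] lam_props[of "Suc (n + k)"] lam_props(3)[of "n + k"] F[of "n + k"]
    by simp
  then have "(5/3) ^ (n + Suc k) * eqn (n + Suc k) (lam (n + Suc k)) F x
     = ((5/3) ^ (n + k) * eqn (n + k) (lam (n + k)) F x) * (5/3 * decimation_factor (lam (Suc (n + k))))"
    by (simp add: power_add)
  then show ?case unfolding Suc by (simp add: mult_ac)
qed simp

lemma extension_eqn_new:
  assumes "x \<in> gasket_vertices v (n + k)" "x \<notin> gasket_vertices v n"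
  shows "eqn (n + k) (lam (n + k)) F x = 0"
  using assms
proof (induction k)
  case (Suc k)
  have "x \<in> gasket_vertices v (Suc (n + k))" using Suc.prems by simp
  then show ?case
  proof (cases rule: vertices_SucE)
    case 1
    have "eqn (Suc (n + k)) (lam (Suc (n + k))) F x =
        decimation_factor (lam (Suc (n + k))) * eqn (n + k) (lam (n + k)) F x"
      using eqn_Suc_vertex[OF 1, of "lam (Suc (n + k))" F] lam_props[of "Suc (n + k)"] lam_props(3)[of "n + k"] F[of "n + k"]
      by simp
    then show ?thesis using Suc.IH[OF 1 Suc.prems(2)] by simp
  next
    case (2 w i)
    have "\<forall>i. F (mid w i) = mid_value (lam (Suc (n + k))) F w i" using F[of "n + k" w] 2 by simp
    then have "\<forall>i. eqn (Suc (n + k)) (lam (Suc (n + k))) F (mid w i) = 0"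
      using midpoint_solution[OF 2(1)] lam_props[of "Suc (n + k)"] by simp
    then show ?thesis using 2 by simp
  qed
qed simp

text \<open>In the Green formula on level \<open>n + k\<close> only the vertices of level
  \<open>n\<close> retain a residual, so the sum in the last term does not grow with
  \<open>k\<close>.\<close>

lemma extension_level_form:
  "level_form (n + k) F h =
    2 * (5 ^ (n + k) * lam (n + k)) * ((\<Sum>w\<in>words (n + k). \<Sum>i\<in>UNIV. F (vtx w i) * h (vtx w i)) / 3 ^ (n + k))
    - (5/3) ^ n * (\<Prod>j<k. 5/3 * decimation_factor (lam (Suc (n + j)))) *
      (\<Sum>x\<in>gasket_vertices v n. h x * eqn n (lam n) F x)"
proof -
  let ?m = "n + k" and ?c = "\<Prod>j<k. 5/3 * decimation_factor (lam (Suc (n + j)))"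
  have "(5/3) ^ ?m * (\<Sum>x\<in>gasket_vertices v ?m. h x * eqn ?m (lam ?m) F x)
    = (5/3) ^ ?m * (\<Sum>x\<in>gasket_vertices v n. h x * eqn ?m (lam ?m) F x)"
    using vertices_mono[of n ?m] extension_eqn_new
    by (intro arg_cong2[where f = "(*)"] refl sum.mono_neutral_right) auto
  also have "\<dots> = (\<Sum>x\<in>gasket_vertices v n. h x * ((5/3) ^ ?m * eqn ?m (lam ?m) F x))"
    by (simp only: sum_distrib_left mult_ac)
  also have "\<dots> = (\<Sum>x\<in>gasket_vertices v n. h x * ((5/3) ^ n * ?c * eqn n (lam n) F x))"
    by (intro sum.cong refl) (simp only: extension_eqn_vertex)
  also have "\<dots> = (5/3) ^ n * ?c * (\<Sum>x\<in>gasket_vertices v n. h x * eqn n (lam n) F x)"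
    unfolding sum_distrib_left by (intro sum.cong refl) (simp only: mult_ac)
  finally have 1: "(5/3) ^ ?m * (\<Sum>x\<in>gasket_vertices v ?m. h x * eqn ?m (lam ?m) F x) = \<dots>" .
  show ?thesis
    unfolding level_form_eqn[of ?m F h "lam ?m"] right_diff_distrib 1 by (simp add: power_divide)
qed

lemma extension_bounded:
  shows "\<exists>B\<ge>0. \<forall>x\<in>vstar. \<bar>F x\<bar> \<le> B"
proof -
  obtain \<kappa> where \<kappa>: "\<And>k. (\<Prod>j<k. 5/3 * decimation_factor (lam (Suc (n + j)))) \<le> \<kappa>"
    using decimation_seq_prod[OF lam] by metis
  define M where "M = Max ((\<lambda>x. \<bar>F x\<bar>) ` gasket_vertices v n)"
  have ne: "v 1 \<in> gasket_vertices v n" using vertices_mono[of 0 n] by auto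
  have M: "\<bar>F x\<bar> \<le> M" if "x \<in> gasket_vertices v n" for x unfolding M_def using that by (intro Max_ge) auto
  have M0: "0 \<le> M" using M[OF ne] by linarith
  let ?c = "\<lambda>k. \<Prod>j<k. 5/3 * decimation_factor (lam (Suc (n + j)))"
  have fac: "1 \<le> 5/3 * decimation_factor (lam (Suc (n + k)))"
     "1 / (1 - 2 * lam (Suc (n + k))) \<le> 5/3 * decimation_factor (lam (Suc (n + k)))" for k
    using decimation_factor_bounds[of "lam (Suc (n + k))"] lam_props[of "Suc (n + k)"] by auto
  have c1: "1 \<le> ?c k" for k by (intro prod_ge_1) (use fac in auto)
  have b: "\<bar>F x\<bar> \<le> M * ?c k" if "x \<in> gasket_vertices v (n + k)" for x k
    using that
  proof (induction k arbitrary: x)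
    case (Suc k)
    have nn: "0 \<le> M * ?c k" using M0 c1[of k] by (intro mult_nonneg_nonneg) auto
    have "x \<in> gasket_vertices v (Suc (n + k))" using Suc.prems by simp
    then show ?case
    proof (cases rule: vertices_SucE)
      case 1
      have "M * ?c k * 1 \<le> M * ?c k * (5/3 * decimation_factor (lam (Suc (n + k))))"
        using fac(1) nn by (intro mult_left_mono) auto
      then show ?thesis using Suc.IH[OF 1] by (simp add: mult_ac)
    next
      case (2 w i)
      have "\<bar>F x\<bar> \<le> M * ?c k / (1 - 2 * lam (Suc (n + k)))"
        using mid_value_bound[of "lam (Suc (n + k))" F w "M * ?c k" i] lam_props[of "Suc (n + k)"]
          Suc.IH[of "vtx w _"] 2 F[of "n + k" w i] by simp
      also have "\<dots> = M * ?c k * (1 / (1 - 2 * lam (Suc (n + k))))" by simp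
      also have "\<dots> \<le> M * ?c k * (5/3 * decimation_factor (lam (Suc (n + k))))"
        using fac(2) nn by (intro mult_left_mono) auto
      finally show ?thesis by (simp add: mult_ac)
    qed
  qed (use M in simp)
  have "\<bar>F x\<bar> \<le> M * \<kappa>" if x: "x \<in> vstar" for x
  proof -
    obtain k where "x \<in> gasket_vertices v k" using x by (auto simp: vstar_def)
    then have "x \<in> gasket_vertices v (n + k)" using vertices_mono[of k "n + k"] by auto
    then have "\<bar>F x\<bar> \<le> M * ?c k" by (rule b)
    also have "\<dots> \<le> M * \<kappa>" using \<kappa> M0 by (intro mult_left_mono)
    finally show ?thesis .
  qed
  moreover have "0 \<le> M * \<kappa>" using M0 \<kappa>[of 0] by simp
  ultimately show ?thesis by blast
qed

text \<open>The case \<open>h = F\<close> of \<open>extension_level_form\<close>, with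
  \<open>F\<close> bounded by \<open>extension_bounded\<close> and with convergent, hence bounded,
  coefficients.\<close>

lemma extension_energy_bounded:
  assumes "(\<lambda>m. 5 ^ m * lam m) \<longlonglongrightarrow> l"
  shows "\<exists>B. \<forall>m. energy_level v m F \<le> B"
proof -
  obtain \<kappa> where \<kappa>: "\<And>k. (\<Prod>j<k. 5/3 * decimation_factor (lam (Suc (n + j)))) \<le> \<kappa>"
    "\<And>k. 1 \<le> (\<Prod>j<k. 5/3 * decimation_factor (lam (Suc (n + j))))"
    using decimation_seq_prod[OF lam] by metis
  obtain M where M: "0 \<le> M" "\<And>x. x \<in> vstar \<Longrightarrow> \<bar>F x\<bar> \<le> M" using extension_bounded by blast
  have "Bseq (\<lambda>m. 5 ^ m * lam m)" using assms by (intro convergent_imp_Bseq) (auto simp: convergent_def)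
  then obtain L where L: "0 < L" "\<And>m. norm (5 ^ m * lam m) \<le> L" by (auto simp: Bseq_def)
  let ?D = "\<Sum>x\<in>gasket_vertices v n. F x * eqn n (lam n) F x"
  let ?c = "\<lambda>k. \<Prod>j<k. 5/3 * decimation_factor (lam (Suc (n + j)))"
  define B where "B = 2 * L * (3 * M\<^sup>2) + (5/3) ^ n * \<kappa> * \<bar>?D\<bar>"
  have b: "energy_level v (n + k) F \<le> B" for k
  proof -
    let ?m = "n + k"
    let ?S = "\<Sum>w\<in>words ?m. \<Sum>i\<in>UNIV. F (vtx w i) * F (vtx w i)"
    have "?S \<le> (\<Sum>w\<in>words ?m. \<Sum>i\<in>(UNIV :: 3 set). M\<^sup>2)"
    proof (intro sum_mono)
      fix w :: "3 list" and i :: 3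
      show "F (vtx w i) * F (vtx w i) \<le> M\<^sup>2"
        using power_mono[OF M(2)[OF vtx_in_vstar[of w i]], of 2] by (simp add: power2_eq_square)
    qed
    then have S: "?S / 3 ^ ?m \<le> 3 * M\<^sup>2" by (simp add: card_words field_simps)
    have S0: "0 \<le> ?S / 3 ^ ?m" by (intro divide_nonneg_nonneg sum_nonneg) auto
    have "2 * (5 ^ ?m * lam ?m) * (?S / 3 ^ ?m) \<le> 2 * L * (3 * M\<^sup>2)"
      using L(2)[of ?m] L(1) S S0 lam_props(1)[of ?m] by (intro mult_mono) auto
    moreover have "- ((5/3) ^ n * ?c k * ?D) \<le> (5/3) ^ n * \<kappa> * \<bar>?D\<bar>"
    proof -
      have "- ((5/3) ^ n * ?c k * ?D) \<le> (5/3) ^ n * ?c k * \<bar>?D\<bar>"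
        using \<kappa>(2)[of k] mult_left_mono[of "- ?D" "\<bar>?D\<bar>" "(5/3) ^ n * ?c k"] by simp
      also have "\<dots> \<le> (5/3) ^ n * \<kappa> * \<bar>?D\<bar>"
        using \<kappa>(1)[of k] by (intro mult_right_mono mult_left_mono) auto
      finally show ?thesis .
    qed
    ultimately show ?thesis
      unfolding energy_level_eq extension_level_form B_def by linarith
  qed
  have "energy_level v m F \<le> B" for m
    using energy_level_mono[of m "n + m" F] b[of m] by simp
  then show ?thesis by blast
qed

end

end

section \<open>Eigenfunctions and their restrictions to a level\<close>

context gasket_space
begin

text \<open>The residual of the data survives in the limit with a positive coefficient. As
  \<open>u\<close> is arbitrary, one statement serves three purposes: it extends graph
  eigenfunctions, it gives a function to compare a given eigenfunction with, and for
  \<open>l = 0\<close> it interpolates.\<close>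

lemma extension_weak_form:
  assumes lam: "decimation_seq n lam" and l: "(\<lambda>m. 5 ^ m * lam m) \<longlonglongrightarrow> l"
  shows "\<exists>g\<in>energy_domain v S. \<exists>\<kappa>>0. (\<forall>x\<in>gasket_vertices v n. g x = u x) \<and>
    (\<forall>h\<in>energy_domain v S. energy_form v g h =
       6 * l * (LINT x|\<mu>. g x * h x) - \<kappa> * (\<Sum>x\<in>gasket_vertices v n. h x * eqn n (lam n) u x))"
proof -
  obtain F where F: "\<And>x. x \<in> gasket_vertices v n \<Longrightarrow> F x = u x"
    "\<And>m w k. n \<le> m \<Longrightarrow> w \<in> words m \<Longrightarrow> F (mid w k) = mid_value (lam (Suc m)) F w k"
    using extension_exists[of n u lam] by blast
  obtain B where B: "\<And>m. energy_level v m F \<le> B"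
    using extension_energy_bounded[OF lam F(2) l] by blast
  obtain g where g: "continuous_on S g" "\<And>x. x \<in> vstar \<Longrightarrow> g x = F x"
    using energy_bounded_extension[OF B] by blast
  have gm: "g x = F x" if "x \<in> gasket_vertices v m" for x m using g(2) that by (auto simp: vstar_def)
  have "energy_level v m g = energy_level v m F" for m
    unfolding energy_level_eq by (intro level_form_cong gm)
  then have gdom: "g \<in> energy_domain v S"
    using g(1) energy_bounded_convergent[of g B] B by (simp add: energy_domain_def)
  let ?c = "\<lambda>k. \<Prod>j<k. 5/3 * decimation_factor (lam (Suc (n + j)))"
  obtain \<kappa> where \<kappa>: "?c \<longlonglongrightarrow> \<kappa>" "1 \<le> \<kappa>"
    using decimation_seq_prod[OF lam] by metis
  have "energy_form v g h =
       6 * l * (LINT x|\<mu>. g x * h x) - ((5/3) ^ n * \<kappa>) * (\<Sum>x\<in>gasket_vertices v n. h x * eqn n (lam n) u x)"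
    if h: "h \<in> energy_domain v S" for h
  proof -
    have hc: "continuous_on S h" using h by (simp add: energy_domain_def)
    let ?D = "\<Sum>x\<in>gasket_vertices v n. h x * eqn n (lam n) u x"
    have D: "(\<Sum>x\<in>gasket_vertices v n. h x * eqn n (lam n) F x) = ?D"
      by (intro sum.cong refl) (simp add: eqn_cong[of n F u] F(1))
    have e: "level_form (n + k) g h =
      2 * (5 ^ (n + k) * lam (n + k)) * ((\<Sum>w\<in>words (n + k). \<Sum>i\<in>UNIV. g (vtx w i) * h (vtx w i)) / 3 ^ (n + k))
      - (5/3) ^ n * ?c k * ?D" for k
    proof -
      have lf: "level_form (n + k) g h = level_form (n + k) F h" by (intro level_form_cong gm refl)
      have "level_form (n + k) F h =
        2 * (5 ^ (n + k) * lam (n + k)) * ((\<Sum>w\<in>words (n + k). \<Sum>i\<in>UNIV. F (vtx w i) * h (vtx w i)) / 3 ^ (n + k))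
        - (5/3) ^ n * ?c k * (\<Sum>x\<in>gasket_vertices v n. h x * eqn n (lam n) F x)"
        by (rule extension_level_form[OF lam]) (rule F(2))
      then show ?thesis unfolding lf D by (simp only: g(2)[OF vtx_in_vstar])
    qed
    have "(\<lambda>k. level_form (n + k) g h) \<longlonglongrightarrow> 2 * l * (3 * (LINT x|\<mu>. g x * h x)) - (5/3) ^ n * \<kappa> * ?D"
      unfolding e
      using LIMSEQ_ignore_initial_segment[OF l, of n]
        LIMSEQ_ignore_initial_segment[OF neumann_laplacian_limit[OF g(1) hc], of n] \<kappa>(1)
      by (intro tendsto_intros) (simp_all add: add.commute[of n])
    moreover have "(\<lambda>k. level_form (n + k) g h) \<longlonglongrightarrow> energy_form v g h"
      using LIMSEQ_ignore_initial_segment[OF energy_form_LIMSEQ[OF gdom h], of n] by (simp add: add.commute[of n])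
    ultimately have "energy_form v g h = 2 * l * (3 * (LINT x|\<mu>. g x * h x)) - (5/3) ^ n * \<kappa> * ?D"
      by (rule LIMSEQ_unique[rotated])
    then show ?thesis by simp
  qed
  moreover have "0 < (5/3) ^ n * \<kappa>" using \<kappa>(2) by simp
  moreover have "\<forall>x\<in>gasket_vertices v n. g x = u x" using F(1) gm by auto
  ultimately show ?thesis using gdom by blast
qed

lemma interpolation_exists:
  "\<exists>g\<in>energy_domain v S. \<forall>x\<in>gasket_vertices v n. g x = u x"
  \<comment> \<open>The zero sequence is an orbit of the decimation map; the result is the harmonic
    extension.\<close>
  using extension_weak_form[of n "\<lambda>_. 0" 0 u] by (auto simp: decimation_seq_def decimation_def)

lemma energy_form_diff:
  assumes "f \<in> energy_domain v S" "g \<in> energy_domain v S" "h \<in> energy_domain v S"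
  shows "energy_form v (\<lambda>x. f x - g x) h = energy_form v f h - energy_form v g h"
proof -
  have "cell_form w (\<lambda>x. f x - g x) h = cell_form w f h - cell_form w g h" for w
    unfolding cell_form_def by (simp add: sum_3 algebra_simps)
  then have "level_form n (\<lambda>x. f x - g x) h = level_form n f h - level_form n g h" for n
    by (simp add: level_form_def sum_subtractf right_diff_distrib)
  then have "(\<lambda>n. level_form n (\<lambda>x. f x - g x) h) \<longlonglongrightarrow> energy_form v f h - energy_form v g h"
    using tendsto_diff[OF energy_form_LIMSEQ[OF assms(1,3)] energy_form_LIMSEQ[OF assms(2,3)]] by simp
  then show ?thesis
    using energy_form_LIMSEQ[OF energy_domain_add_diff(2)[OF assms(1,2)] assms(3)] LIMSEQ_unique by blast
qed

lemma eigenspace_iff: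
  "f \<in> eigenspace v S \<mu> l \<longleftrightarrow> f \<in> energy_domain v S \<and> (\<forall>x. x \<notin> S \<longrightarrow> f x = 0) \<and>
    (\<forall>g\<in>energy_domain v S. energy_form v f g = 6 * l * (LINT x|\<mu>. f x * g x))"
proof -
  have "(LINT x|\<mu>. - (l * f x) * g x) = - (l * (LINT x|\<mu>. f x * g x))" for g
    by (simp add: mult.assoc)
  moreover have "(\<lambda>x. - (l * f x)) \<in> borel_measurable \<mu> \<and> integrable \<mu> (\<lambda>x. (- (l * f x))\<^sup>2)"
    if "f \<in> energy_domain v S"
  proof -
    have "continuous_on S f" using that by (simp add: energy_domain_def)
    then show ?thesis by (auto intro!: continuous_measurable continuous_integrable continuous_intros)
  qed
  ultimately show ?thesis by (auto simp: eigenspace_def neumann_laplacian_def)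
qed

text \<open>As \<open>d\<close> vanishes on level \<open>n\<close>, its squared sup norm is at most
  \<open>osc_const\<^sup>2 * (3/5) ^ n\<close> times its energy. The measure has mass 1, so the
  equation bounds the energy by a multiple of itself with coefficient below 1.\<close>

lemma weak_solution_zero:
  assumes d: "d \<in> energy_domain v S" "\<And>x. x \<in> gasket_vertices v n \<Longrightarrow> d x = 0"
    and e: "energy_form v d d = 6 * l * (LINT x|\<mu>. d x * d x)"
    and small: "6 * l * (osc_const\<^sup>2 * (3/5) ^ n) < 1" and l: "0 \<le> l" and x: "x \<in> S"
  shows "d x = 0"
proof -
  let ?b = "osc_const * (sqrt (energy v d) * sqrt (3/5) ^ n)"
  have E0: "0 \<le> energy v d" using energy_nonneg d(1) .
  have sup: "\<bar>d x\<bar> \<le> ?b" if "x \<in> S" for x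
  proof -
    obtain w where "w \<in> words n" "x \<in> cell w" using \<open>x \<in> S\<close> S_cells[of n] by blast
    then show ?thesis using energy_sup_bound[OF d(1), of x w 1] d(2)[of "vtx w 1"] by (simp add: words_def)
  qed
  have c: "continuous_on S d" using d(1) by (simp add: energy_domain_def)
  have b2: "?b\<^sup>2 = energy v d * (osc_const\<^sup>2 * (3/5) ^ n)"
  proof -
    have "(sqrt (3/5) ^ n)\<^sup>2 = ((sqrt (3/5))\<^sup>2) ^ n"
      by (simp only: power_mult[symmetric] mult.commute[of n])
    then show ?thesis using E0 by (simp add: power_mult_distrib)
  qed
  have "(LINT x|\<mu>. d x * d x) \<le> ?b\<^sup>2"
  proof (rule integral_le_const)
    show "integrable \<mu> (\<lambda>x. d x * d x)" by (intro continuous_integrable continuous_intros c)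
    show "AE x in \<mu>. d x * d x \<le> ?b\<^sup>2"
    proof (rule AE_I2)
      fix x assume "x \<in> space \<mu>"
      then have "\<bar>d x\<bar> \<le> ?b" using sup space_mu by simp
      from power_mono[OF this, of 2] show "d x * d x \<le> ?b\<^sup>2" by (simp add: power2_eq_square)
    qed
  qed
  then have "energy v d \<le> 6 * l * (energy v d * (osc_const\<^sup>2 * (3/5) ^ n))"
    using e l unfolding energy_form_self[OF d(1)] b2[symmetric] by (simp add: mult_left_mono)
  then have "energy v d * (1 - 6 * l * (osc_const\<^sup>2 * (3/5) ^ n)) \<le> 0" by (simp add: algebra_simps)
  then have "energy v d = 0" using E0 small by (simp add: mult_le_0_iff)
  then show ?thesis using sup[OF x] by simp
qed

theorem eigenspace_restriction:
  assumes lam: "decimation_seq n lam" and lim: "(\<lambda>m. 5 ^ m * lam m) \<longlonglongrightarrow> l" and l: "0 \<le> l"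
    and small: "6 * l * (osc_const\<^sup>2 * (3/5) ^ n) < 1"
  shows "bij_betw (restr n) (eigenspace v S \<mu> l) (graph_eigenspace n (lam n))"
proof (rule bij_betwI')
  fix f g assume f: "f \<in> eigenspace v S \<mu> l" and g: "g \<in> eigenspace v S \<mu> l"
  show "restr n f = restr n g \<longleftrightarrow> f = g"
  proof
    assume eq: "restr n f = restr n g"
    let ?d = "\<lambda>x. f x - g x"
    have dom: "f \<in> energy_domain v S" "g \<in> energy_domain v S" using f g by (auto simp: eigenspace_iff)
    have d: "?d \<in> energy_domain v S" using energy_domain_add_diff(2)[OF dom] .
    have c: "continuous_on S f" "continuous_on S g" "continuous_on S ?d" using dom d by (auto simp: energy_domain_def)
    have "energy_form v ?d ?d = 6 * l * (LINT x|\<mu>. f x * ?d x) - 6 * l * (LINT x|\<mu>. g x * ?d x)"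
      using energy_form_diff[OF dom d] f g d by (simp add: eigenspace_iff)
    also have "\<dots> = 6 * l * (LINT x|\<mu>. f x * ?d x - g x * ?d x)"
      by (subst Bochner_Integration.integral_diff)
        (auto intro!: continuous_integrable continuous_intros c simp: right_diff_distrib)
    also have "\<dots> = 6 * l * (LINT x|\<mu>. ?d x * ?d x)" by (simp add: left_diff_distrib)
    finally have e: "energy_form v ?d ?d = 6 * l * (LINT x|\<mu>. ?d x * ?d x)" .
    have z: "?d x = 0" if "x \<in> gasket_vertices v n" for x
      using fun_cong[OF eq, of x] that by (simp add: restr_def)
    have "?d x = 0" if "x \<in> S" for x
      by (rule weak_solution_zero[OF d z e small l that])
    then show "f = g" using f g by (auto simp: eigenspace_iff fun_eq_iff) metis
  qed simp
next
  fix f assume f: "f \<in> eigenspace v S \<mu> l"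
  then have fdom: "f \<in> energy_domain v S"
    and fe: "\<And>h. h \<in> energy_domain v S \<Longrightarrow> energy_form v f h = 6 * l * (LINT x|\<mu>. f x * h x)"
    by (auto simp: eigenspace_iff)
  \<comment> \<open>\<open>g\<close> extends the restriction of \<open>f\<close> itself. The
    difference vanishes on level \<open>n\<close>, so tested against itself it does not see the
    residual term, and \<open>weak_solution_zero\<close> gives \<open>f = g\<close> on
    \<open>S\<close>.\<close>
  obtain g \<kappa> where g: "g \<in> energy_domain v S" "0 < \<kappa>" "\<And>x. x \<in> gasket_vertices v n \<Longrightarrow> g x = f x"
    "\<And>h. h \<in> energy_domain v S \<Longrightarrow> energy_form v g h =
       6 * l * (LINT x|\<mu>. g x * h x) - \<kappa> * (\<Sum>x\<in>gasket_vertices v n. h x * eqn n (lam n) f x)"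
    using extension_weak_form[OF lam lim, of f] by blast
  let ?d = "\<lambda>x. f x - g x"
  have d: "?d \<in> energy_domain v S" using energy_domain_add_diff(2)[OF fdom g(1)] .
  have c: "continuous_on S f" "continuous_on S g" "continuous_on S ?d"
    using fdom g(1) d by (auto simp: energy_domain_def)
  have "energy_form v ?d ?d = 6 * l * (LINT x|\<mu>. f x * ?d x) - 6 * l * (LINT x|\<mu>. g x * ?d x)"
    using energy_form_diff[OF fdom g(1) d] fe[OF d] g(4)[OF d] g(3) by simp
  also have "\<dots> = 6 * l * (LINT x|\<mu>. f x * ?d x - g x * ?d x)"
    by (subst Bochner_Integration.integral_diff)
      (auto intro!: continuous_integrable continuous_intros c simp: right_diff_distrib)
  also have "\<dots> = 6 * l * (LINT x|\<mu>. ?d x * ?d x)" by (simp add: left_diff_distrib)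
  finally have e: "energy_form v ?d ?d = 6 * l * (LINT x|\<mu>. ?d x * ?d x)" .
  have fg: "f x = g x" if "x \<in> S" for x
    using weak_solution_zero[OF d _ e small l that] g(3) by simp
  have "eqn n (lam n) f x = 0" if x: "x \<in> gasket_vertices v n" for x
  proof -
    \<comment> \<open>Now that \<open>f\<close> and \<open>g\<close> agree, their weak equations
      force the residual sum to vanish for every test function; a test function peaked at
      \<open>x\<close> isolates the equation at \<open>x\<close>.\<close>
    obtain h where h: "h \<in> energy_domain v S" "\<And>y. y \<in> gasket_vertices v n \<Longrightarrow> h y = (if y = x then 1 else 0)"
      using interpolation_exists[of n "\<lambda>y. if y = x then 1 else 0"] by blast
    have "level_form m f h = level_form m g h" for m
      by (intro level_form_cong fg refl) (use vertices_subset_S in auto)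
    then have "energy_form v f h = energy_form v g h"
      using energy_form_LIMSEQ[OF fdom h(1)] energy_form_LIMSEQ[OF g(1) h(1)] LIMSEQ_unique by simp
    moreover have "(LINT x|\<mu>. f x * h x) = (LINT x|\<mu>. g x * h x)"
      by (intro Bochner_Integration.integral_cong refl) (simp add: space_mu fg)
    ultimately have "(\<Sum>y\<in>gasket_vertices v n. h y * eqn n (lam n) f y) = 0"
      using fe[OF h(1)] g(4)[OF h(1)] g(2) by simp
    moreover have "(\<Sum>y\<in>gasket_vertices v n. h y * eqn n (lam n) f y) =
        (\<Sum>y\<in>gasket_vertices v n. if y = x then eqn n (lam n) f y else 0)"
      by (intro sum.cong refl) (simp add: h(2))
    ultimately show ?thesis using x by simp
  qed
  moreover have "eqn n (lam n) (restr n f) x = eqn n (lam n) f x" if "x \<in> gasket_vertices v n" for x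
    by (rule eqn_cong) (use that in \<open>auto simp: restr_def\<close>)
  ultimately show "restr n f \<in> graph_eigenspace n (lam n)"
    by (auto simp: graph_eigenspace_def restr_def)
next
  fix u assume u: "u \<in> graph_eigenspace n (lam n)"
  obtain g \<kappa> where g: "g \<in> energy_domain v S" "0 < \<kappa>" "\<And>x. x \<in> gasket_vertices v n \<Longrightarrow> g x = u x"
    "\<And>h. h \<in> energy_domain v S \<Longrightarrow> energy_form v g h =
       6 * l * (LINT x|\<mu>. g x * h x) - \<kappa> * (\<Sum>x\<in>gasket_vertices v n. h x * eqn n (lam n) u x)"
    using extension_weak_form[OF lam lim, of u] by blast
  define f where "f x = (if x \<in> S then g x else 0)" for x
  have lev: "level_form m f h = level_form m g h" "energy_level v m f = energy_level v m g" for m h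
    unfolding energy_level_eq
    by (intro level_form_cong refl; use vertices_subset_S in \<open>auto simp: f_def\<close>)+
  have "continuous_on S f" using g(1) continuous_on_cong[of S S f g] by (simp add: f_def energy_domain_def)
  then have fdom: "f \<in> energy_domain v S" using g(1) lev by (simp add: energy_domain_def)
  have "energy_form v f h = 6 * l * (LINT x|\<mu>. f x * h x)" if h: "h \<in> energy_domain v S" for h
  proof -
    have "energy_form v f h = energy_form v g h"
      using energy_form_LIMSEQ[OF fdom h] energy_form_LIMSEQ[OF g(1) h] lev LIMSEQ_unique by simp
    also have "\<dots> = 6 * l * (LINT x|\<mu>. g x * h x)"
      using g(4)[OF h] u by (simp add: graph_eigenspace_def)
    also have "(LINT x|\<mu>. g x * h x) = (LINT x|\<mu>. f x * h x)"
      by (intro Bochner_Integration.integral_cong refl) (simp add: space_mu f_def)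
    finally show ?thesis .
  qed
  then have "f \<in> eigenspace v S \<mu> l" using fdom by (simp add: eigenspace_iff f_def)
  moreover have "u = restr n f"
    using u g(3) vertices_subset_S[of n] by (auto simp: fun_eq_iff restr_def f_def graph_eigenspace_def)
  ultimately show "\<exists>f\<in>eigenspace v S \<mu> l. u = restr n f" by blast
qed

text \<open>\<open>eigen_index\<close> ranges over all nonzero reals, so negative ones must be
  excluded. Comparing signs, the energy and the integral of the square both vanish: the function is
  constant on \<open>S\<close>, and the constant is zero.\<close>

lemma eigenspace_negative:
  assumes "l < 0" shows "eigenspace v S \<mu> l = {\<lambda>_. 0}"
proof (intro equalityI subsetI)
  fix f :: "real^2 \<Rightarrow> real" assume "f \<in> eigenspace v S \<mu> l"
  then have f: "f \<in> energy_domain v S" "\<And>x. x \<notin> S \<Longrightarrow> f x = 0"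
    "energy v f = 6 * l * (LINT x|\<mu>. f x * f x)"
    using energy_form_self[of f S] by (auto simp: eigenspace_iff)
  have "0 \<le> (LINT x|\<mu>. f x * f x)" by (intro Bochner_Integration.integral_nonneg) auto
  moreover have "0 \<le> energy v f" using energy_nonneg f(1) .
  ultimately have z: "(LINT x|\<mu>. f x * f x) = 0" "energy v f = 0"
    using f(3) assms by (simp_all add: zero_le_mult_iff order_antisym)
  have const: "f x = f (vtx [] 1)" if "x \<in> S" for x
    using energy_sup_bound[OF f(1), of x "[]" 1] that z by (simp add: cell_def)
  have "(LINT x|\<mu>. f x * f x) = (LINT x|\<mu>. f (vtx [] 1) * f (vtx [] 1))"
    by (intro Bochner_Integration.integral_cong refl) (use const space_mu in simp)
  then have "f (vtx [] 1) = 0" using z prob_space by simp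
  then show "f \<in> {\<lambda>_. 0}" using const f(2) by auto
next
  fix f :: "real^2 \<Rightarrow> real" assume "f \<in> {\<lambda>_. 0}"
  then have f: "f = (\<lambda>_. 0)" by simp
  have lev: "level_form n (\<lambda>_. 0) g = 0" for n g by (simp add: level_form_def cell_form_def)
  have dom: "(\<lambda>_. 0) \<in> energy_domain v S"
    by (auto simp: energy_domain_def energy_level_eq lev convergent_const)
  have "energy_form v (\<lambda>_. 0) g = 0" if "g \<in> energy_domain v S" for g
    using energy_form_LIMSEQ[OF dom that] by (simp add: lev LIMSEQ_const_iff)
  then show "f \<in> eigenspace v S \<mu> l" unfolding f eigenspace_iff using dom by simp
qed

end

section \<open>Dimensions of the graph eigenspaces\<close>

interpretation fun_space: vector_space "\<lambda>(c::real) (f :: 'a \<Rightarrow> real) x. c * f x"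
  by unfold_locales (auto simp: fun_eq_iff algebra_simps)

interpretation fun_space_pair: vector_space_pair "\<lambda>(c::real) (f :: 'a \<Rightarrow> real) x. c * f x"
    "\<lambda>(c::real) (f :: 'b \<Rightarrow> real) x. c * f x"
  by unfold_locales

abbreviation fun_dim :: "('a \<Rightarrow> real) set \<Rightarrow> nat" where
  "fun_dim \<equiv> vector_space.dim (\<lambda>(c::real) f x. c * f x)"

definition fun_linear :: "(('a \<Rightarrow> real) \<Rightarrow> 'b \<Rightarrow> real) \<Rightarrow> bool" where
  "fun_linear \<phi> \<longleftrightarrow> (\<forall>f g. \<phi> (\<lambda>x. f x + g x) = (\<lambda>y. \<phi> f y + \<phi> g y)) \<and> (\<forall>c f. \<phi> (\<lambda>x. c * f x) = (\<lambda>y. c * \<phi> f y))"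

definition fun_subspace :: "('a \<Rightarrow> real) set \<Rightarrow> bool" where
  "fun_subspace A \<longleftrightarrow> (\<lambda>_. 0) \<in> A \<and> (\<forall>f\<in>A. \<forall>g\<in>A. (\<lambda>x. f x + g x) \<in> A) \<and> (\<forall>c. \<forall>f\<in>A. (\<lambda>x. c * f x) \<in> A)"

lemma fun_dim_bij:
  fixes \<phi> :: "('a \<Rightarrow> real) \<Rightarrow> 'b \<Rightarrow> real"
  assumes "fun_linear \<phi>" "fun_subspace A" "bij_betw \<phi> A B"
  shows "fun_dim A = fun_dim B"
proof -
  have lin: "Vector_Spaces.linear (\<lambda>c f x. c * f x) (\<lambda>c f x. c * f x) \<phi>"
    using assms(1) by unfold_locales (auto simp: fun_linear_def plus_fun_def)
  have sub: "fun_space.subspace A"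
    using assms(2) by (auto simp: fun_space.subspace_def fun_subspace_def zero_fun_def plus_fun_def)
  obtain C where C: "C \<subseteq> A" "fun_space.independent C" "A \<subseteq> fun_space.span C" "card C = fun_dim A"
    using fun_space.basis_exists[of A] by blast
  have span: "fun_space.span C = A"
    using C(1,3) fun_space.span_minimal[OF C(1) sub] by blast
  have inj: "inj_on \<phi> A" and B: "\<phi> ` A = B" using assms(3) by (auto simp: bij_betw_def)
  have "fun_space.independent (\<phi> ` C)"
    using fun_space_pair.linear_independent_injective_image[OF lin C(2)] inj span by simp
  moreover have "fun_space.span (\<phi> ` C) = B"
    using fun_space_pair.linear_span_image[OF lin] span B by simp
  moreover have "card (\<phi> ` C) = card C" using inj C(1) by (meson card_image inj_on_subset)
  ultimately show ?thesis using C fun_space.dim_span_eq_card_independent[of "\<phi> ` C"] by simp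
qed

definition funs_on :: "'a set \<Rightarrow> ('a \<Rightarrow> real) set" where
  "funs_on X = {f. \<forall>x. x \<notin> X \<longrightarrow> f x = 0}"

lemma fun_dim_funs_on:
  assumes "finite X" shows "fun_dim (funs_on X) = card X"
proof -
  let ?\<delta> = "\<lambda>x y. if y = x then 1 else (0::real)"
  have inj: "inj_on ?\<delta> X" by (rule inj_onI) (metis zero_neq_one)
  have sum_app: "(\<Sum>x\<in>A. (\<lambda>y. h x y)) = (\<lambda>y. \<Sum>x\<in>A. h x y)" for A :: "'a set" and h :: "'a \<Rightarrow> 'a \<Rightarrow> real"
    by (induction A rule: infinite_finite_induct) (auto simp: fun_eq_iff)
  show ?thesis
  proof (rule fun_space.dim_unique[of "?\<delta> ` X"])
    show "?\<delta> ` X \<subseteq> funs_on X" by (auto simp: funs_on_def)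
    show "funs_on X \<subseteq> fun_space.span (?\<delta> ` X)"
    proof
      fix f assume f: "f \<in> funs_on X"
      have "f = (\<Sum>x\<in>X. (\<lambda>y. f x * ?\<delta> x y))"
        unfolding sum_app using f assms by (auto simp: fun_eq_iff funs_on_def if_distrib cong: if_cong)
      also have "\<dots> \<in> fun_space.span (?\<delta> ` X)"
        by (intro fun_space.span_sum fun_space.span_scale fun_space.span_base) auto
      finally show "f \<in> fun_space.span (?\<delta> ` X)" .
    qed
    show "fun_space.independent (?\<delta> ` X)"
    proof (rule fun_space.independent_if_scalars_zero)
      fix g and b assume s: "(\<Sum>b\<in>?\<delta> ` X. (\<lambda>y. g b * b y)) = 0" and b: "b \<in> ?\<delta> ` X"
      then obtain x where x: "x \<in> X" "b = ?\<delta> x" by blast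
      have "(\<Sum>b\<in>?\<delta> ` X. (\<lambda>y. g b * b y)) = (\<Sum>x\<in>X. (\<lambda>y. g (?\<delta> x) * ?\<delta> x y))"
        by (rule sum.reindex_cong[OF inj]) auto
      then have "(\<lambda>y. \<Sum>x\<in>X. g (?\<delta> x) * ?\<delta> x y) = 0" using s unfolding sum_app by metis
      from fun_cong[OF this, of x] have "(\<Sum>z\<in>X. g (?\<delta> z) * ?\<delta> z x) = 0" by simp
      moreover have "(\<Sum>z\<in>X. g (?\<delta> z) * ?\<delta> z x) = (\<Sum>z\<in>X. if z = x then g (?\<delta> z) else 0)"
        by (intro sum.cong) auto
      ultimately show "g b = 0" using x assms by simp
    qed (use assms in auto)
    show "card (?\<delta> ` X) = card X" by (rule card_image[OF inj])
  qed
qed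

lemma fun_dim_zero: "fun_dim {\<lambda>_ :: 'a. 0} = 0"
proof -
  have "funs_on {} = {\<lambda>_ :: 'a. 0}" by (auto simp: funs_on_def)
  then show ?thesis using fun_dim_funs_on[of "{} :: 'a set"] by simp
qed

context triangle
begin

text \<open>The conservation laws of a flow through the midpoints: the eigenfunctions for the exceptional value
  \<open>5/4\<close> vanish on the previous level, and each is determined by such a flow.\<close>

definition flows :: "nat \<Rightarrow> (3 list \<times> 3 \<Rightarrow> real) set" where
  "flows n = {z. (\<forall>w\<in>words n. (\<Sum>i\<in>UNIV. z (w, i)) = 0) \<and>
     (\<forall>x\<in>gasket_vertices v n. (\<Sum>p\<in>flags_at n x. z p) = 0) \<and> (\<forall>p. fst p \<notin> words n \<longrightarrow> z p = 0)}"

lemma flows_subspace: "fun_subspace (flows n)"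
  unfolding fun_subspace_def flows_def by (auto simp: sum.distrib sum_distrib_left[symmetric])

lemma eqn_linear:
  "eqn n l (\<lambda>x. f x + g x) x = eqn n l f x + eqn n l g x" "eqn n l (\<lambda>x. c * f x) x = c * eqn n l f x"
  unfolding eqn_def
  by (simp_all add: sum.distrib[symmetric] sum_distrib_left case_prod_unfold algebra_simps)

lemma graph_eigenspace_subspace: "fun_subspace (graph_eigenspace n l)"
  unfolding fun_subspace_def graph_eigenspace_def
  by (auto simp: eqn_linear) (simp add: eqn_def)

lemma restr_linear: "fun_linear (restr n)"
  by (auto simp: fun_linear_def restr_def)

lemma eqn_restr: "x \<in> gasket_vertices v n \<Longrightarrow> eqn n l (restr n f) x = eqn n l f x"
  by (rule eqn_cong) (auto simp: restr_def)

text \<open>The factor is kept in the target space on purpose: where it is nonzero the target is a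
  graph eigenspace, and at 3/2, where it vanishes, the target consists of all functions on level
  \<open>n\<close>.\<close>

lemma restr_bij:
  assumes l: "l \<noteq> 1/2" "l \<noteq> 5/4"
  shows "bij_betw (restr n) (graph_eigenspace (Suc n) l)
    {u \<in> funs_on (gasket_vertices v n). \<forall>x\<in>gasket_vertices v n. decimation_factor l * eqn n (decimation l) u x = 0}"
    (is "bij_betw _ _ ?U")
proof (rule bij_betwI[where g = "extend n l"])
  have mid: "f (mid w k) = mid_value l f w k" if "f \<in> graph_eigenspace (Suc n) l" "w \<in> words n" for f w k
    using midpoint_solution[OF that(2) l, of f] that(1) mid_in_vertices[OF that(2)]
    by (auto simp: graph_eigenspace_def)
  show "restr n \<in> graph_eigenspace (Suc n) l \<rightarrow> ?U"
  proof
    fix f assume f: "f \<in> graph_eigenspace (Suc n) l"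
    have "decimation_factor l * eqn n (decimation l) (restr n f) x = 0" if x: "x \<in> gasket_vertices v n" for x
    proof -
      have "x \<in> gasket_vertices v (Suc n)" using x by (simp add: vertices_Suc)
      then have "eqn (Suc n) l f x = 0" using f by (simp add: graph_eigenspace_def)
      then show ?thesis using eqn_Suc_vertex[OF x l mid[OF f]] eqn_restr[OF x] by simp
    qed
    then show "restr n f \<in> ?U" by (auto simp: funs_on_def restr_def)
  qed
  show "extend n l \<in> ?U \<rightarrow> graph_eigenspace (Suc n) l"
  proof
    fix u assume u: "u \<in> ?U"
    let ?f = "extend n l u"
    have m: "?f (mid w k) = mid_value l ?f w k" if "w \<in> words n" for w k
      unfolding extend_mid[OF that] by (rule mid_value_cong) (use that in simp)
    have "eqn (Suc n) l ?f x = 0" if "x \<in> gasket_vertices v (Suc n)" for x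
      using that
    proof (cases rule: vertices_SucE)
      case 1
      have "eqn n (decimation l) ?f x = eqn n (decimation l) u x" by (rule eqn_cong) (use 1 in auto)
      moreover have "decimation_factor l * eqn n (decimation l) u x = 0" using u 1 by blast
      ultimately show ?thesis using eqn_Suc_vertex[OF 1 l m] by simp
    next
      case (2 w k)
      then show ?thesis using midpoint_solution[OF 2(1) l, of ?f] m by simp
    qed
    then show "?f \<in> graph_eigenspace (Suc n) l"
      by (auto simp: graph_eigenspace_def extend_off)
  qed
  fix f assume f: "f \<in> graph_eigenspace (Suc n) l"
  show "extend n l (restr n f) = f"
  proof
    fix x
    show "extend n l (restr n f) x = f x"
    proof (cases "x \<in> gasket_vertices v (Suc n)")
      case True
      then show ?thesis
      proof (cases rule: vertices_SucE)
        case (2 w k)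
        have "mid_value l (restr n f) w k = mid_value l f w k"
          by (rule mid_value_cong) (use 2 in \<open>simp add: restr_def\<close>)
        then show ?thesis using extend_mid[OF 2(1)] mid[OF f 2(1)] 2 by simp
      qed (simp add: restr_def)
    qed (use f in \<open>simp add: extend_off graph_eigenspace_def\<close>)
  qed
next
  fix u assume u: "u \<in> ?U"
  then show "restr n (extend n l u) = u" by (auto simp: restr_def funs_on_def fun_eq_iff)
qed

lemma dim_decimation:
  assumes "l \<noteq> 1/2" "l \<noteq> 5/4" "l \<noteq> 3/2"
  shows "fun_dim (graph_eigenspace (Suc n) l) = fun_dim (graph_eigenspace n (decimation l))"
proof -
  have "decimation_factor l \<noteq> 0" using assms by (auto simp: decimation_factor_def)
  then have "{u \<in> funs_on (gasket_vertices v n). \<forall>x\<in>gasket_vertices v n. decimation_factor l * eqn n (decimation l) u x = 0}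
      = graph_eigenspace n (decimation l)"
    by (auto simp: graph_eigenspace_def funs_on_def)
  then show ?thesis
    using fun_dim_bij[OF restr_linear graph_eigenspace_subspace restr_bij[OF assms(1,2), of n]] by simp
qed

lemma dim_three_halves_Suc:
  "fun_dim (graph_eigenspace (Suc n) (3/2)) = card (gasket_vertices v n)"
proof -
  have "decimation_factor (3/2) = 0" by (simp add: decimation_factor_def)
  then have "bij_betw (restr n) (graph_eigenspace (Suc n) (3/2)) (funs_on (gasket_vertices v n))"
    using restr_bij[of "3/2" n] by simp
  then show ?thesis
    using fun_dim_bij[OF restr_linear graph_eigenspace_subspace] fun_dim_funs_on[OF finite_vertices] by metis
qed

lemma eqn_0: "eqn 0 l f (v i) = (\<Sum>j\<in>UNIV. f (v j)) - (3 - 2 * l) * f (v i)"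
  by (simp add: eqn_def flags_at_0)

text \<open>For 3/2 the three equations on level 0 coincide: the values have sum zero, so two of
  them are free.\<close>

lemma dim_three_halves_0: "fun_dim (graph_eigenspace 0 (3/2)) = 2"
proof -
  let ?\<phi> = "\<lambda>f x. if x \<in> {v 1, v 2} then f x else (0 :: real)"
  let ?\<psi> = "\<lambda>f x. if x = v 3 then - f (v 1) - f (v 2) else (f x :: real)"
  have ne: "v 1 \<noteq> v 2" "v 1 \<noteq> v 3" "v 2 \<noteq> v 3" "v 3 \<noteq> v 1" "v 3 \<noteq> v 2" using v_inj by fastforce+
  have mem: "f \<in> graph_eigenspace 0 (3/2) \<longleftrightarrow> f (v 1) + f (v 2) + f (v 3) = 0 \<and> (\<forall>x. x \<notin> {v 1, v 2, v 3} \<longrightarrow> f x = 0)" for f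
  proof -
    have e: "eqn 0 (3/2) f (v i) = f (v 1) + f (v 2) + f (v 3)" for i by (simp add: eqn_0 sum_3)
    have rv: "gasket_vertices v 0 = {v 1, v 2, v 3}" by (auto simp: UNIV_3)
    show ?thesis unfolding graph_eigenspace_def rv mem_Collect_eq by (simp add: e)
  qed
  have "bij_betw ?\<phi> (graph_eigenspace 0 (3/2)) (funs_on {v 1, v 2})"
  proof (rule bij_betwI[where g = ?\<psi>])
    show "?\<phi> \<in> graph_eigenspace 0 (3/2) \<rightarrow> funs_on {v 1, v 2}" by (auto simp: funs_on_def)
    show "?\<psi> \<in> funs_on {v 1, v 2} \<rightarrow> graph_eigenspace 0 (3/2)"
      using ne by (auto simp: funs_on_def mem)
    show "?\<psi> (?\<phi> f) = f" if "f \<in> graph_eigenspace 0 (3/2)" for f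
    proof
      fix x show "?\<psi> (?\<phi> f) x = f x"
        using that ne unfolding mem by (cases "x \<in> {v 1, v 2, v 3}") auto
    qed
    show "?\<phi> (?\<psi> f) = f" if "f \<in> funs_on {v 1, v 2}" for f
      using that ne by (auto simp: fun_eq_iff funs_on_def)
  qed
  moreover have "fun_linear ?\<phi>" by (auto simp: fun_linear_def)
  ultimately have "fun_dim (graph_eigenspace 0 (3/2)) = fun_dim (funs_on {v 1, v 2})"
    using fun_dim_bij graph_eigenspace_subspace by blast
  also have "\<dots> = card {v 1, v 2}" by (rule fun_dim_funs_on) simp
  finally show ?thesis using ne by simp
qed

lemma dim_three_halves: "fun_dim (graph_eigenspace n (3/2)) = (3 ^ n + 3) div 2"
  by (cases n) (simp_all add: dim_three_halves_0 dim_three_halves_Suc card_vertices)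

lemma dim_zero_level:
  assumes "l \<noteq> 0" "l \<noteq> 3/2"
  shows "fun_dim (graph_eigenspace 0 l) = 0"
proof -
  have "f = (\<lambda>_. 0)" if f: "f \<in> graph_eigenspace 0 l" for f
  proof -
    let ?A = "\<Sum>j\<in>UNIV. f (v j)"
    have e: "?A = (3 - 2 * l) * f (v i)" for i
      using f eqn_0[of l f i] by (auto simp: graph_eigenspace_def)
    have "(\<Sum>i\<in>(UNIV :: 3 set). ?A) = (\<Sum>i\<in>UNIV. (3 - 2 * l) * f (v i))" using e by simp
    then have "3 * ?A = (3 - 2 * l) * ?A" by (simp only: sum_distrib_left[symmetric]) simp
    then have "?A = 0" using assms by (simp add: algebra_simps)
    then have v0: "f (v i) = 0" for i using e[of i] assms by auto
    show ?thesis
    proof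
      fix x show "f x = 0"
        using f v0 by (cases "x \<in> range v") (auto simp: graph_eigenspace_def)
    qed
  qed
  moreover have "(\<lambda>_. 0) \<in> graph_eigenspace 0 l"
    using graph_eigenspace_subspace by (simp add: fun_subspace_def)
  ultimately have "graph_eigenspace 0 l = {\<lambda>_. 0}" by blast
  then show ?thesis using fun_dim_zero by metis
qed

text \<open>Sibling subcells meet pairwise in midpoints, so any two of the three values are
  opposite. In a cycle of odd length this makes them zero.\<close>

lemma sum_flags_zero:
  fixes X :: "3 list \<Rightarrow> real"
  assumes "\<And>x. x \<in> gasket_vertices v n \<Longrightarrow> (\<Sum>(w, i)\<in>flags_at n x. X w) = 0" "w \<in> words n"
  shows "X w = 0"
proof (cases n)
  case 0
  then show ?thesis using assms(1)[of "v 1"] assms(2) by (simp add: flags_at_0)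
next
  case (Suc m)
  obtain u i where u: "u \<in> words m" "w = u @ [i]" using assms(2) Suc by (auto simp: words_Suc)
  have e: "X (u @ [k + 1]) + X (u @ [k + 2]) = 0" for k
    using assms(1)[of "mid u k"] mid_in_vertices[OF u(1)] Suc by (simp add: flags_at_mid[OF u(1)])
  show ?thesis using e[of "i + 1"] e[of "i + 2"] e[of i] u by simp
qed

lemma sum_flags_weighted:
  fixes g :: "3 list \<times> 3 \<Rightarrow> real"
  assumes "\<And>x. x \<in> gasket_vertices v n \<Longrightarrow> (\<Sum>p\<in>flags_at n x. g p) = 0"
  shows "(\<Sum>w\<in>words n. \<Sum>i\<in>UNIV. f (vtx w i) * g (w, i)) = 0"
proof -
  have "(\<Sum>w\<in>words n. \<Sum>i\<in>UNIV. f (vtx w i) * g (w, i)) =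
      (\<Sum>x\<in>gasket_vertices v n. \<Sum>p\<in>flags_at n x. f (vtx (fst p) (snd p)) * g p)"
    using sum_flags_group[of "\<lambda>p. f (vtx (fst p) (snd p)) * g p" n]
    by (simp add: sum.cartesian_product case_prod_unfold)
  also have "\<dots> = (\<Sum>x\<in>gasket_vertices v n. f x * (\<Sum>p\<in>flags_at n x. g p))"
    unfolding sum_distrib_left by (intro sum.cong refl) (auto simp: flags_at_def)
  finally show ?thesis using assms by simp
qed

text \<open>For 1/2 the midpoint system is singular, and adding its equations forces the corner sums
  \<open>A\<close> to vanish. The vertex equations paired with \<open>f\<close> then become minus a
  sum of squares, so \<open>f\<close> vanishes on level \<open>n\<close>. What remains are the
  midpoint sums \<open>Z\<close>, which \<open>sum_flags_zero\<close> eliminates.\<close>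

lemma dim_half_Suc: "fun_dim (graph_eigenspace (Suc n) (1/2)) = 0"
proof -
  have "f = (\<lambda>_. 0)" if f: "f \<in> graph_eigenspace (Suc n) (1/2)" for f
  proof -
    define A Z where "A w = (\<Sum>j\<in>UNIV. f (vtx w j))" and "Z w = (\<Sum>j\<in>UNIV. f (mid w j))" for w
    have e: "3 * f (mid w k) = A w - f (vtx w k) + Z w" if w: "w \<in> words n" for w k
    proof -
      have "eqn (Suc n) (1/2) f (mid w k) = 0"
        using f mid_in_vertices[OF w] by (auto simp: graph_eigenspace_def)
      then show ?thesis using midpoint_eqn[OF w, of "1/2" f k] by (simp add: A_def Z_def)
    qed
    have A0: "A w = 0" if w: "w \<in> words n" for w
    proof -
      have "(\<Sum>k\<in>UNIV. 3 * f (mid w k)) = (\<Sum>k\<in>UNIV. A w - f (vtx w k) + Z w)" using e[OF w] by simp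
      then have "3 * Z w = 3 * A w - A w + 3 * Z w"
        by (simp add: sum_distrib_left[symmetric] Z_def[symmetric] A_def[symmetric] sum.distrib sum_subtractf)
      then show ?thesis by simp
    qed
    have fl: "(\<Sum>p\<in>flags_at n x. Z (fst p) - f (vtx (fst p) (snd p))) = 0" if x: "x \<in> gasket_vertices v n" for x
    proof -
      have "x \<in> gasket_vertices v (Suc n)" using x by (simp add: vertices_Suc)
      then have "0 = eqn (Suc n) (1/2) f x" using f by (simp add: graph_eigenspace_def)
      also have "\<dots> = (\<Sum>p\<in>flags_at n x. 2/3 * (Z (fst p) - f (vtx (fst p) (snd p))))"
        unfolding eqn_Suc_vertex_raw[OF x]
      proof (intro sum.cong refl)
        fix p assume p: "p \<in> flags_at n x"
        obtain w i where wi: "p = (w, i)" by (cases p)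
        have w: "w \<in> words n" "vtx w i = x" using p wi by (auto simp: flags_at_def)
        have "Z w = f (mid w i) + f (mid w (i + 1)) + f (mid w (i + 2))" by (simp add: Z_def sum_three[of _ i])
        then show "(case p of (w, i) \<Rightarrow> f x + f (mid w (i + 1)) + f (mid w (i + 2)) - (3 - 2 * (1/2)) * f x) =
            2/3 * (Z (fst p) - f (vtx (fst p) (snd p)))"
          using e[OF w(1), of i] A0[OF w(1)] w(2) wi by simp
      qed
      finally have "2/3 * (\<Sum>p\<in>flags_at n x. Z (fst p) - f (vtx (fst p) (snd p))) = 0"
        by (simp only: sum_distrib_left)
      then show ?thesis by simp
    qed
    have "(\<Sum>w\<in>words n. \<Sum>i\<in>UNIV. f (vtx w i) * (Z w - f (vtx w i))) = 0"
      using sum_flags_weighted[of n "\<lambda>p. Z (fst p) - f (vtx (fst p) (snd p))" f] fl by simp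
    moreover have "(\<Sum>i\<in>UNIV. f (vtx w i) * (Z w - f (vtx w i))) = - (\<Sum>i\<in>UNIV. (f (vtx w i))\<^sup>2)"
      if w: "w \<in> words n" for w
    proof -
      have "(\<Sum>i\<in>UNIV. f (vtx w i) * (Z w - f (vtx w i))) = A w * Z w - (\<Sum>i\<in>UNIV. (f (vtx w i))\<^sup>2)"
        by (simp add: A_def sum_distrib_right right_diff_distrib sum_subtractf power2_eq_square)
      then show ?thesis using A0[OF w] by simp
    qed
    ultimately have "(\<Sum>w\<in>words n. \<Sum>i\<in>UNIV. (f (vtx w i))\<^sup>2) = 0" by (simp add: sum_negf)
    then have "(\<Sum>i\<in>UNIV. (f (vtx w i))\<^sup>2) = 0" if "w \<in> words n" for w
      using that by (subst (asm) sum_nonneg_eq_0_iff) (auto intro: sum_nonneg)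
    then have f0: "f (vtx w i) = 0" if "w \<in> words n" for w i
      using that by (subst (asm) sum_nonneg_eq_0_iff) auto
    have "(\<Sum>(w, i)\<in>flags_at n x. Z w) = 0" if x: "x \<in> gasket_vertices v n" for x
    proof -
      have "(\<Sum>(w, i)\<in>flags_at n x. Z w) = (\<Sum>p\<in>flags_at n x. Z (fst p) - f (vtx (fst p) (snd p)))"
        by (intro sum.cong refl) (auto simp: flags_at_def f0)
      then show ?thesis using fl[OF x] by simp
    qed
    then have Z0: "Z w = 0" if "w \<in> words n" for w using sum_flags_zero[of n Z] that by blast
    have m0: "f (mid w k) = 0" if "w \<in> words n" for w k using e[OF that] A0[OF that] Z0[OF that] f0[OF that] by simp
    show ?thesis
    proof
      fix x
      show "f x = 0"
      proof (cases "x \<in> gasket_vertices v (Suc n)")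
        case True
        then show ?thesis by (cases rule: vertices_SucE) (auto elim!: verticesE simp: f0 m0)
      qed (use f in \<open>simp add: graph_eigenspace_def\<close>)
    qed
  qed
  moreover have "(\<lambda>_. 0) \<in> graph_eigenspace (Suc n) (1/2)"
    using graph_eigenspace_subspace by (simp add: fun_subspace_def)
  ultimately have "graph_eigenspace (Suc n) (1/2) = {\<lambda>_. 0}" by blast
  then show ?thesis using fun_dim_zero by metis
qed

text \<open>For 5/4 the coefficient \<open>5 - 4 * l\<close> is zero: each midpoint equation
  involves only corner values and the midpoint sum, so all corners of a cell carry one value
  \<open>c w\<close>, and \<open>Z w = - 2 * c w\<close>. Pairing the vertex equations with
  \<open>f\<close> leaves a negative multiple of the sum of the squares of \<open>c\<close>.\<close>

lemma five_fourths_vanishes: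
  assumes f: "f \<in> graph_eigenspace (Suc n) (5/4)"
  shows "w \<in> words n \<Longrightarrow> f (vtx w i) = 0" "w \<in> words n \<Longrightarrow> (\<Sum>k\<in>UNIV. f (mid w k)) = 0"
    "x \<in> gasket_vertices v n \<Longrightarrow> (\<Sum>p\<in>flags_at n x. f (mid (fst p) (snd p))) = 0"
proof -
  define Z where "Z w = (\<Sum>j\<in>UNIV. f (mid w j))" for w
  define c where "c w = f (vtx w 1)" for w
  have e: "f (vtx w k) = c w \<and> Z w = - 2 * c w" if w: "w \<in> words n" for w k
  proof -
    have "eqn (Suc n) (5/4) f (mid w k) = 0" for k
      using f mid_in_vertices[OF w] by (auto simp: graph_eigenspace_def)
    then have k: "f (vtx w k) = (\<Sum>j\<in>UNIV. f (vtx w j)) + Z w" for k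
      using midpoint_eqn[OF w, of "5/4" f k] by (simp add: Z_def)
    then have 1: "f (vtx w k) = c w" for k unfolding c_def by metis
    then have "(\<Sum>j\<in>UNIV. f (vtx w j)) = 3 * c w" by simp
    then show ?thesis using k[of 1] 1 by simp
  qed
  have fl: "(\<Sum>p\<in>flags_at n x. c (fst p) / 2 + Z (fst p) - f (mid (fst p) (snd p))) = 0"
    if x: "x \<in> gasket_vertices v n" for x
  proof -
    have "x \<in> gasket_vertices v (Suc n)" using x by (simp add: vertices_Suc)
    then have "0 = eqn (Suc n) (5/4) f x" using f by (simp add: graph_eigenspace_def)
    also have "\<dots> = (\<Sum>p\<in>flags_at n x. c (fst p) / 2 + Z (fst p) - f (mid (fst p) (snd p)))"
      unfolding eqn_Suc_vertex_raw[OF x]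
    proof (intro sum.cong refl)
      fix p assume p: "p \<in> flags_at n x"
      obtain w i where wi: "p = (w, i)" by (cases p)
      have w: "w \<in> words n" "vtx w i = x" using p wi by (auto simp: flags_at_def)
      have "Z w = f (mid w i) + f (mid w (i + 1)) + f (mid w (i + 2))" by (simp add: Z_def sum_three[of _ i])
      then show "(case p of (w, i) \<Rightarrow> f x + f (mid w (i + 1)) + f (mid w (i + 2)) - (3 - 2 * (5/4)) * f x) =
          c (fst p) / 2 + Z (fst p) - f (mid (fst p) (snd p))"
        using e[OF w(1), of i] w(2) wi by simp
    qed
    finally show ?thesis by simp
  qed
  have "(\<Sum>w\<in>words n. \<Sum>i\<in>UNIV. f (vtx w i) * (c w / 2 + Z w - f (mid w i))) = 0"
    using sum_flags_weighted[of n "\<lambda>p. c (fst p) / 2 + Z (fst p) - f (mid (fst p) (snd p))" f] fl by simp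
  moreover have "(\<Sum>i\<in>UNIV. f (vtx w i) * (c w / 2 + Z w - f (mid w i))) = - (5/2) * (c w)\<^sup>2"
    if w: "w \<in> words n" for w
  proof -
    have "(\<Sum>i\<in>UNIV. f (vtx w i) * (c w / 2 + Z w - f (mid w i))) = (\<Sum>i\<in>UNIV. c w * (c w / 2 + Z w) - c w * f (mid w i))"
      using e[OF w] by (intro sum.cong) (auto simp: algebra_simps)
    also have "\<dots> = 3 * (c w * (c w / 2 + Z w)) - c w * Z w"
      by (simp add: sum_subtractf Z_def sum_distrib_left)
    also have "\<dots> = - (5/2) * (c w)\<^sup>2"
      using e[OF w, of 1] by (simp add: power2_eq_square algebra_simps)
    finally show ?thesis .
  qed
  ultimately have "(\<Sum>w\<in>words n. - (5/2) * (c w)\<^sup>2) = 0" by simp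
  then have "- (5/2) * (\<Sum>w\<in>words n. (c w)\<^sup>2) = 0" by (simp only: sum_distrib_left)
  then have "(\<Sum>w\<in>words n. (c w)\<^sup>2) = 0" by simp
  then have c0: "c w = 0" if "w \<in> words n" for w using that by (subst (asm) sum_nonneg_eq_0_iff) auto
  show "w \<in> words n \<Longrightarrow> f (vtx w i) = 0" using e c0 by simp
  show "w \<in> words n \<Longrightarrow> (\<Sum>k\<in>UNIV. f (mid w k)) = 0" using e c0 unfolding Z_def by simp
  assume x: "x \<in> gasket_vertices v n"
  have "(\<Sum>p\<in>flags_at n x. c (fst p) / 2 + Z (fst p) - f (mid (fst p) (snd p)))
      = (\<Sum>p\<in>flags_at n x. - f (mid (fst p) (snd p)))"
    by (intro sum.cong refl) (use e c0 in \<open>auto simp: flags_at_def\<close>)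
  then show "(\<Sum>p\<in>flags_at n x. f (mid (fst p) (snd p))) = 0" using fl[OF x] by (simp add: sum_negf)
qed

text \<open>The value at the midpoint opposite to the corner \<open>k\<close> is read as the flow
  out of the cell through \<open>k\<close>. The midpoint equations become conservation in cells, the
  equations at old vertices conservation at vertices.\<close>

lemma dim_five_fourths_flows: "fun_dim (graph_eigenspace (Suc n) (5/4)) = fun_dim (flows n)"
proof -
  let ?\<phi> = "\<lambda>f (p :: 3 list \<times> 3). if fst p \<in> words n then f (mid (fst p) (snd p)) else (0::real)"
  let ?P = "\<lambda>x p. fst p \<in> words n \<and> x = mid (fst p) (snd p)"
  let ?\<psi> = "\<lambda>z x. if \<exists>p. ?P x p then z (SOME p. ?P x p) else (0::real)"
  have psi_mid: "?\<psi> z (mid w k) = z (w, k)" if w: "w \<in> words n" for z w k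
  proof -
    have "(SOME p. ?P (mid w k) p) = (w, k)"
      by (rule some_equality) (use w mid_inj[OF w] in \<open>auto simp: prod_eq_iff\<close>)
    moreover have "\<exists>p. ?P (mid w k) p" using w by (intro exI[of _ "(w, k)"]) simp
    ultimately show ?thesis by simp
  qed
  have psi_vtx: "?\<psi> z x = 0" if "x \<in> gasket_vertices v n" for z x
    using that mid_not_vertex by auto
  have psi_off: "?\<psi> z x = 0" if "x \<notin> gasket_vertices v (Suc n)" for z x
    using that mid_in_vertices by auto
  have "bij_betw ?\<phi> (graph_eigenspace (Suc n) (5/4)) (flows n)"
  proof (rule bij_betwI[where g = ?\<psi>])
    show "?\<phi> \<in> graph_eigenspace (Suc n) (5/4) \<rightarrow> flows n"
    proof
      fix f assume f: "f \<in> graph_eigenspace (Suc n) (5/4)"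
      have "(\<Sum>p\<in>flags_at n x. ?\<phi> f p) = (\<Sum>p\<in>flags_at n x. f (mid (fst p) (snd p)))" for x
        by (intro sum.cong) (auto simp: flags_at_def)
      then show "?\<phi> f \<in> flows n"
        using five_fourths_vanishes(2,3)[OF f] by (simp add: flows_def)
    qed
    show "?\<psi> \<in> flows n \<rightarrow> graph_eigenspace (Suc n) (5/4)"
    proof
      fix z assume z: "z \<in> flows n"
      let ?f = "?\<psi> z"
      have f0: "?f (vtx w j) = 0" if "w \<in> words n" for w j using psi_vtx that by simp
      have fm: "?f (mid w j) = z (w, j)" if "w \<in> words n" for w j using psi_mid that by simp
      have "eqn (Suc n) (5/4) ?f x = 0" if "x \<in> gasket_vertices v (Suc n)" for x
        using that
      proof (cases rule: vertices_SucE)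
        case 1
        have "eqn (Suc n) (5/4) ?f x = (\<Sum>p\<in>flags_at n x. - z p)"
          unfolding eqn_Suc_vertex_raw[OF 1]
        proof (intro sum.cong refl)
          fix p assume p: "p \<in> flags_at n x"
          obtain w i where wi: "p = (w, i)" by (cases p)
          have w: "w \<in> words n" using p wi by (auto simp: flags_at_def)
          have "(\<Sum>i\<in>UNIV. z (w, i)) = 0" using z w by (simp add: flows_def)
          then have "z (w, i) + z (w, i + 1) + z (w, i + 2) = 0" by (simp add: sum_three[of _ i])
          then show "(case p of (w, i) \<Rightarrow> ?f x + ?f (mid w (i + 1)) + ?f (mid w (i + 2)) - (3 - 2 * (5/4)) * ?f x) = - z p"
            unfolding wi prod.case fm[OF w] psi_vtx[OF 1] by simp
        qed
        then show ?thesis using z 1 by (simp add: flows_def sum_negf)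
      next
        case (2 w k)
        have "(\<Sum>i\<in>UNIV. z (w, i)) = 0" using z 2 by (simp add: flows_def)
        then show ?thesis
          unfolding 2(2) midpoint_eqn[OF 2(1)] f0[OF 2(1)] fm[OF 2(1)] by simp
      qed
      then show "?f \<in> graph_eigenspace (Suc n) (5/4)"
        unfolding graph_eigenspace_def using psi_off by blast
    qed
    show "?\<psi> (?\<phi> f) = f" if f: "f \<in> graph_eigenspace (Suc n) (5/4)" for f
    proof
      fix x
      show "?\<psi> (?\<phi> f) x = f x"
      proof (cases "x \<in> gasket_vertices v (Suc n)")
        case True
        then show ?thesis
        proof (cases rule: vertices_SucE)
          case 1
          then have "f x = 0" using five_fourths_vanishes(1)[OF f] by (auto elim: verticesE)
          show ?thesis unfolding \<open>f x = 0\<close> by (rule psi_vtx[OF 1])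
        next
          case (2 w k)
          have "?\<psi> (?\<phi> f) (mid w k) = ?\<phi> f (w, k)" by (rule psi_mid[OF 2(1)])
          also have "\<dots> = f (mid w k)" using 2(1) by simp
          finally show ?thesis unfolding 2(2) .
        qed
      next
        case False
        then have "f x = 0" using f by (simp add: graph_eigenspace_def)
        show ?thesis unfolding \<open>f x = 0\<close> by (rule psi_off[OF False])
      qed
    qed
    show "?\<phi> (?\<psi> z) = z" if z: "z \<in> flows n" for z
    proof
      fix p show "?\<phi> (?\<psi> z) p = z p"
        using psi_mid[where w = "fst p" and z = z and k = "snd p"] z by (cases p) (auto simp: flows_def)
    qed
  qed
  moreover have "fun_linear ?\<phi>" by (auto simp: fun_linear_def)
  ultimately show ?thesis using fun_dim_bij graph_eigenspace_subspace by blast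
qed

text \<open>The flow through the midpoint \<open>k\<close>, from the subcell \<open>k + 1\<close> to
  the subcell \<open>k + 2\<close>. Conservation in the subcells fixes the differences of the three
  numbers; the free constant \<open>t\<close>, the value for \<open>k = 1\<close>, is a circulation
  around the hole of \<open>w\<close>.\<close>

definition circulation :: "(3 list \<times> 3 \<Rightarrow> real) \<Rightarrow> real \<Rightarrow> 3 list \<Rightarrow> 3 \<Rightarrow> real" where
  "circulation d t w k = (if k = 1 then t else if k = 2 then t - d (w, 3) else t - d (w, 3) - d (w, 1))"

lemma circulation_diff:
  assumes "(\<Sum>i\<in>UNIV. d (w, i)) = 0"
  shows "d (w, i) = circulation d t w (i + 1) - circulation d t w (i + 2)"
  using assms exhaust_3[of i] by (elim disjE) (simp_all add: circulation_def sum_3 three_wrap)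

text \<open>A flow on level \<open>n + 1\<close> amounts to a flow on level \<open>n\<close>
  together with one free circulation for each word of length \<open>n\<close>. Thus flows have one
  coordinate per hole, that is, per word shorter than \<open>n\<close>.\<close>

lemma flows_iso:
  "\<exists>\<phi>. fun_linear \<phi> \<and> bij_betw \<phi> (flows n) (funs_on (\<Union>m<n. words m))"
proof (induction n)
  case 0
  have "z = (\<lambda>_. 0)" if z: "z \<in> flows 0" for z
  proof
    fix p :: "3 list \<times> 3"
    have "z ([], i) = 0" for i
    proof -
      have "(\<Sum>p\<in>flags_at 0 (v i). z p) = 0" using z by (simp add: flows_def)
      then show ?thesis by (simp add: flags_at_0)
    qed
    then show "z p = 0" using z by (cases p; cases "fst p = []") (auto simp: flows_def)
  qed
  moreover have "(\<lambda>_. 0) \<in> flows 0" using flows_subspace by (simp add: fun_subspace_def)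
  ultimately have "flows 0 = {\<lambda>_. 0}" by blast
  moreover have "funs_on {} = {\<lambda>_ :: 3 list. 0}" by (auto simp: funs_on_def)
  ultimately show ?case
    by (intro exI[of _ "\<lambda>_ _. 0"]) (auto simp: fun_linear_def bij_betw_def)
next
  case (Suc n)
  obtain \<phi> where lin: "fun_linear \<phi>" and bij: "bij_betw \<phi> (flows n) (funs_on (\<Union>m<n. words m))"
    using Suc by blast
  let ?W = "\<Union>m<n. words m"
  define \<psi> where "\<psi> = inv_into (flows n) \<phi>"
  \<comment> \<open>The coarse flow: what leaves each old cell through its old corners.
    \<open>glue\<close> is the inverse construction, rebuilding the midpoint flows from a coarse
    flow and the circulations \<open>t\<close>.\<close>
  define d where "d z = (\<lambda>p :: 3 list \<times> 3. if fst p \<in> words n then z (fst p @ [snd p], snd p) else (0 :: real))" for z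
  define glue where "glue y t = (\<lambda>(w', j).
      if w' \<in> words (Suc n) then (let w = butlast w'; i = last w' in
        if j = i then y (w, i) else if j = i + 1 then circulation y (t w) w (i + 2) else - circulation y (t w) w (i + 1))
      else (0 :: real))" for y :: "3 list \<times> 3 \<Rightarrow> real" and t
  \<comment> \<open>The coordinate at a word of length \<open>n\<close> is the flow through the
    midpoint 1, the value that \<open>circulation\<close> takes as its parameter.\<close>
  define \<Phi> where "\<Phi> z = (\<lambda>w. if w \<in> words n then z (w @ [2], 3) else \<phi> (d z) w)" for z
  have len: "w \<in> words n \<Longrightarrow> w \<notin> ?W" for w by (auto simp: words_def)
  have anti: "z (w @ [k + 2], k + 1) = - z (w @ [k + 1], k + 2)" if z: "z \<in> flows (Suc n)" and w: "w \<in> words n" for z w k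
  proof -
    have "(\<Sum>p\<in>flags_at (Suc n) (mid w k). z p) = 0"
      using z mid_in_vertices[OF w] by (simp add: flows_def)
    moreover have "(w @ [k + 1], k + 2) \<noteq> (w @ [k + 2], k + 1)" by simp
    ultimately show ?thesis unfolding flags_at_mid[OF w] by simp
  qed
  have cell: "z (w @ [i], i) = z (w @ [i + 2], i) - z (w @ [i], i + 1)"
    if z: "z \<in> flows (Suc n)" and w: "w \<in> words n" for z w i
  proof -
    have "(\<Sum>j\<in>UNIV. z (w @ [i], j)) = 0" using z w by (simp add: flows_def words_def)
    then have "z (w @ [i], i) + z (w @ [i], i + 1) + z (w @ [i], i + 2) = 0" by (simp add: sum_three[of _ i])
    then show ?thesis using anti[OF z w, of "i + 1"] by simp
  qed
  have d_flow: "d z \<in> flows n" if z: "z \<in> flows (Suc n)" for z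
  proof -
    have "(\<Sum>i\<in>UNIV. d z (w, i)) = 0" if w: "w \<in> words n" for w
      using cell[OF z w, of 1] cell[OF z w, of 2] cell[OF z w, of 3] w
      by (simp add: d_def sum_3 three_wrap)
    moreover have "(\<Sum>p\<in>flags_at n x. d z p) = 0" if x: "x \<in> gasket_vertices v n" for x
    proof -
      have inj: "inj_on (\<lambda>(w :: 3 list, i :: 3). (w @ [i], i)) (flags_at n x)" by (auto intro!: inj_onI)
      have "x \<in> gasket_vertices v (Suc n)" using x by (simp add: vertices_Suc)
      then have "0 = (\<Sum>p\<in>flags_at (Suc n) x. z p)" using z by (simp add: flows_def)
      also have "\<dots> = (\<Sum>p\<in>flags_at n x. d z p)"
        unfolding flags_at_Suc_vertex[OF x] sum.reindex[OF inj]
        by (intro sum.cong refl) (auto simp: d_def flags_at_def)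
      finally show ?thesis by simp
    qed
    ultimately show ?thesis by (auto simp: flows_def d_def)
  qed
  have circ: "z (w @ [k + 1], k + 2) = circulation (d z) (z (w @ [2], 3)) w k"
    if z: "z \<in> flows (Suc n)" and w: "w \<in> words n" for z w k
    using cell[OF z w, of 3] cell[OF z w, of 1] w exhaust_3[of k]
    by (elim disjE) (simp_all add: circulation_def d_def three_wrap)
  have glue_app: "glue y t (w @ [i], i) = y (w, i)" "glue y t (w @ [i], i + 1) = circulation y (t w) w (i + 2)"
    "glue y t (w @ [i], i + 2) = - circulation y (t w) w (i + 1)" if "w \<in> words n" for y t w i
    using that by (simp_all add: glue_def words_def)
  have glue_flow: "glue y t \<in> flows (Suc n)" if y: "y \<in> flows n" for y t
  proof -
    have y0: "(\<Sum>i\<in>UNIV. y (w, i)) = 0" if "w \<in> words n" for w using y that by (simp add: flows_def)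
    have "(\<Sum>j\<in>UNIV. glue y t (w', j)) = 0" if w': "w' \<in> words (Suc n)" for w'
    proof -
      obtain w i where w: "w \<in> words n" "w' = w @ [i]" using w' by (auto simp: words_Suc)
      show ?thesis
        unfolding w(2) sum_three[of _ i] glue_app[OF w(1)]
        using circulation_diff[where d = y and w = w and i = i and t = "t w", OF y0[OF w(1)]] by simp
    qed
    moreover have "(\<Sum>p\<in>flags_at (Suc n) x. glue y t p) = 0" if "x \<in> gasket_vertices v (Suc n)" for x
      using that
    proof (cases rule: vertices_SucE)
      case 1
      have inj: "inj_on (\<lambda>(w :: 3 list, i :: 3). (w @ [i], i)) (flags_at n x)" by (auto intro!: inj_onI)
      have "(\<Sum>p\<in>flags_at (Suc n) x. glue y t p) = (\<Sum>p\<in>flags_at n x. y p)"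
        unfolding flags_at_Suc_vertex[OF 1] sum.reindex[OF inj]
        by (intro sum.cong refl) (auto simp: glue_app flags_at_def)
      then show ?thesis using y 1 by (simp add: flows_def)
    next
      case (2 w k)
      have "(w @ [k + 1], k + 2) \<noteq> (w @ [k + 2], k + 1)" by simp
      then have "(\<Sum>p\<in>flags_at (Suc n) x. glue y t p) = glue y t (w @ [k + 1], k + 2) + glue y t (w @ [k + 2], k + 1)"
        unfolding 2(2) flags_at_mid[OF 2(1)] by simp
      then show ?thesis
        using glue_app(2)[OF 2(1), of y t "k + 1"] glue_app(3)[OF 2(1), of y t "k + 2"] by simp
    qed
    moreover have "\<forall>p. fst p \<notin> words (Suc n) \<longrightarrow> glue y t p = 0" by (auto simp: glue_def)
    ultimately show ?thesis by (simp add: flows_def)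
  qed
  have d_glue: "d (glue y t) = y" if y: "y \<in> flows n" for y t
    using y by (auto simp: d_def fun_eq_iff glue_app flows_def)
  have glue_d: "glue (d z) (\<lambda>w. z (w @ [2], 3)) = z" if z: "z \<in> flows (Suc n)" for z
  proof
    fix p :: "3 list \<times> 3"
    obtain w' j where p: "p = (w', j)" by (cases p)
    show "glue (d z) (\<lambda>w. z (w @ [2], 3)) p = z p"
    proof (cases "w' \<in> words (Suc n)")
      case True
      then obtain w i where w: "w \<in> words n" "w' = w @ [i]" by (auto simp: words_Suc)
      show ?thesis
      proof (cases j i rule: three_cases)
        case 1
        then show ?thesis using p w glue_app(1)[OF w(1)] by (simp add: d_def)
      next
        case 2
        then show ?thesis using p w glue_app(2)[OF w(1)] circ[OF z w(1), of "i + 2"] by simp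
      next
        case 3
        then show ?thesis using p w glue_app(3)[OF w(1)] circ[OF z w(1), of "i + 1"] anti[OF z w(1), of "i + 1"] by simp
      qed
    qed (use p z in \<open>simp add: glue_def flows_def\<close>)
  qed
  have "bij_betw \<Phi> (flows (Suc n)) (funs_on (\<Union>m<Suc n. words m))"
  proof (rule bij_betwI[where g = "\<lambda>h. glue (\<psi> (\<lambda>w. if w \<in> ?W then h w else 0)) h"])
    have phi_in: "\<phi> y \<in> funs_on ?W" if "y \<in> flows n" for y using bij that by (auto simp: bij_betw_def)
    have psi_in: "\<psi> h \<in> flows n" "\<phi> (\<psi> h) = h" if "h \<in> funs_on ?W" for h
      using bij that by (auto simp: bij_betw_def \<psi>_def inv_into_into f_inv_into_f)
    have psi_phi: "\<psi> (\<phi> y) = y" if "y \<in> flows n" for y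
      using bij that by (auto simp: bij_betw_def \<psi>_def)
    have cut: "(\<lambda>w. if w \<in> ?W then h w else 0) \<in> funs_on ?W" for h :: "3 list \<Rightarrow> real" by (simp add: funs_on_def)
    have Un: "(\<Union>m<Suc n. words m) = ?W \<union> words n" by (auto simp: lessThan_Suc)
    show "\<Phi> \<in> flows (Suc n) \<rightarrow> funs_on (\<Union>m<Suc n. words m)"
    proof
      fix z assume "z \<in> flows (Suc n)"
      then have "\<phi> (d z) \<in> funs_on ?W" using phi_in d_flow by simp
      then show "\<Phi> z \<in> funs_on (\<Union>m<Suc n. words m)" unfolding Un by (auto simp: funs_on_def \<Phi>_def)
    qed
    show "(\<lambda>h. glue (\<psi> (\<lambda>w. if w \<in> ?W then h w else 0)) h) \<in> funs_on (\<Union>m<Suc n. words m) \<rightarrow> flows (Suc n)"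
      using glue_flow psi_in(1)[OF cut] by blast
    show "glue (\<psi> (\<lambda>w. if w \<in> ?W then \<Phi> z w else 0)) (\<Phi> z) = z" if z: "z \<in> flows (Suc n)" for z
    proof -
      have "(\<lambda>w. if w \<in> ?W then \<Phi> z w else 0) = \<phi> (d z)"
        using phi_in[OF d_flow[OF z]] len by (auto simp: fun_eq_iff \<Phi>_def funs_on_def)
      then have "\<psi> (\<lambda>w. if w \<in> ?W then \<Phi> z w else 0) = d z" using psi_phi[OF d_flow[OF z]] by simp
      moreover have "glue y (\<Phi> z) = glue y (\<lambda>w. z (w @ [2], 3))" for y
        by (auto simp: glue_def fun_eq_iff \<Phi>_def words_def Let_def)
      ultimately show ?thesis using glue_d[OF z] by simp
    qed
    show "\<Phi> (glue (\<psi> (\<lambda>w. if w \<in> ?W then h w else 0)) h) = h" if h: "h \<in> funs_on (\<Union>m<Suc n. words m)" for h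
    proof
      fix w
      let ?y = "\<psi> (\<lambda>w. if w \<in> ?W then h w else 0)"
      have y: "?y \<in> flows n" "\<phi> ?y = (\<lambda>w. if w \<in> ?W then h w else 0)" using psi_in[OF cut] by auto
      show "\<Phi> (glue ?y h) w = h w"
      proof (cases "w \<in> words n")
        case True
        then show ?thesis using glue_app(2)[OF True, of ?y h 2] by (simp add: \<Phi>_def circulation_def three_wrap)
      next
        case False
        then have "\<Phi> (glue ?y h) w = \<phi> ?y w" by (simp only: \<Phi>_def d_glue[OF y(1)] False if_False)
        also have "\<dots> = h w" using y(2) h False unfolding Un by (auto simp: funs_on_def)
        finally show ?thesis .
      qed
    qed
  qed
  moreover have "fun_linear \<Phi>"
  proof -
    have "d (\<lambda>x. f x + g x) = (\<lambda>p. d f p + d g p)" "d (\<lambda>x. c * f x) = (\<lambda>p. c * d f p)" for c f g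
      by (auto simp: d_def)
    moreover have "\<phi> (\<lambda>x. f x + g x) = (\<lambda>y. \<phi> f y + \<phi> g y)" "\<phi> (\<lambda>x. c * f x) = (\<lambda>y. c * \<phi> f y)" for c f g
      using lin by (simp_all add: fun_linear_def)
    ultimately show ?thesis unfolding fun_linear_def \<Phi>_def by (intro conjI allI ext) simp_all
  qed
  ultimately show ?case by blast
qed

lemma dim_five_fourths: "fun_dim (graph_eigenspace (Suc n) (5/4)) = (3 ^ n - 1) div 2"
proof -
  have "card (\<Union>m<n. words m) = (\<Sum>m<n. 3 ^ m)"
    by (subst card_UN_disjoint) (auto simp: words_def card_words[unfolded words_def] finite_words[unfolded words_def])
  also have "\<dots> = (3 ^ n - 1) div 2"
    by (induction n) auto
  finally have "card (\<Union>m<n. words m) = (3 ^ n - 1) div 2" .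
  moreover have "finite (\<Union>m<n. words m)" by simp
  ultimately show ?thesis
    using flows_iso[of n] fun_dim_bij[OF _ flows_subspace] fun_dim_funs_on dim_five_fourths_flows by metis
qed

end

section \<open>Forward orbits of the exceptional values\<close>

lemma decimation_iterate_neg: "y < 0 \<Longrightarrow> (decimation ^^ k) y < 0"
  by (induction k) (auto simp: decimation_def mult_neg_pos)

lemma decimation_iterate_0: "(decimation ^^ k) 0 = 0"
  by (induction k) (auto simp: decimation_def)

text \<open>The orbits are explicit: 1/2 and 3/4 map to 3/2, then to negative numbers forever, and
  5/4 maps to the fixed point 0. A point that reaches 3/4 or 5/4 after at least one step is
  therefore not exceptional, and \<open>dim_decimation\<close> applies along its whole way.\<close>

lemma decimation_iterate_exceptional:
  assumes "y \<in> {0, 1/2, 3/4, 5/4, 3/2}"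
  shows "(decimation ^^ Suc k) y \<le> 0 \<or> (decimation ^^ Suc k) y = 3/2"
proof -
  have 3: "(decimation ^^ Suc k) (3/2) < 0" for k
    unfolding funpow_Suc_right o_def by (rule decimation_iterate_neg) (simp add: decimation_def)
  have 5: "(decimation ^^ Suc k) (5/4) = 0" for k
    unfolding funpow_Suc_right o_def by (simp add: decimation_def decimation_iterate_0)
  have 1: "(decimation ^^ Suc k) y = (decimation ^^ k) (3/2)" if "y = 1/2 \<or> y = 3/4"
  proof -
    have "decimation (1/2) = 3/2" "decimation (3/4) = 3/2" by (simp_all add: decimation_def)
    then have "decimation y = 3/2" using that by metis
    then show ?thesis by (simp only: funpow_Suc_right o_def)
  qed
  show ?thesis
  proof (cases "y = 1/2 \<or> y = 3/4")
    case True
    then show ?thesis using 1 3[of "k - 1"] by (cases k) auto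
  next
    case False
    then have "y = 0 \<or> y = 5/4 \<or> y = 3/2" using assms by auto
    then show ?thesis using 3[of k] 5[of k] decimation_iterate_0[of "Suc k"] by (metis less_imp_le order_refl)
  qed
qed

lemma decimation_iterate_not_exceptional:
  assumes "(decimation ^^ Suc k) y \<in> {3/4, 5/4}"
  shows "y \<notin> {0, 1/2, 3/4, 5/4, 3/2}"
  using decimation_iterate_exceptional[of y k] assms by auto

context triangle
begin

lemma dim_three_fourths: "fun_dim (graph_eigenspace (Suc n) (3/4)) = (3 ^ n + 3) div 2"
proof -
  have d: "decimation (3/4) = 3/2" by (simp add: decimation_def)
  have "fun_dim (graph_eigenspace (Suc n) (3/4)) = fun_dim (graph_eigenspace n (decimation (3/4)))"
    by (rule dim_decimation) auto
  then show ?thesis unfolding d dim_three_halves .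
qed

lemma dim_born:
  assumes "(decimation ^^ k) l = z" "z \<in> {3/4, 5/4}"
  shows "fun_dim (graph_eigenspace (n + k) l) = fun_dim (graph_eigenspace n z)"
  using assms(1)
proof (induction k arbitrary: l)
  case (Suc k)
  have "l \<notin> {0, 1/2, 3/4, 5/4, 3/2}"
    by (rule decimation_iterate_not_exceptional[of k]) (use Suc.prems assms(2) in simp)
  then have "fun_dim (graph_eigenspace (Suc (n + k)) l) = fun_dim (graph_eigenspace (n + k) (decimation l))"
    by (intro dim_decimation) auto
  also have "\<dots> = fun_dim (graph_eigenspace n z)"
    by (rule Suc.IH) (use Suc.prems in \<open>simp only: funpow_Suc_right o_def\<close>)
  finally show ?case by simp
qed simp

text \<open>The conditions \<open>l \<noteq> 0\<close> and \<open>l \<noteq> 3/2\<close> persist on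
  the way down, since the only preimages of 0 are 0 and 5/4 and those of 3/2 are 1/2 and 3/4. The
  descent ends either at 1/2, with trivial eigenspace, or on level 0, where only 0 and 3/2 occur.
  The range of \<open>m\<close> starts at 1 because nothing is born from 3/4 or 5/4 on level
  0.\<close>

lemma dim_unborn:
  assumes "\<And>m. m \<in> {1..n} \<Longrightarrow> (decimation ^^ (n - m)) l \<notin> {3/4, 5/4}" "l \<noteq> 0" "l \<noteq> 3/2"
  shows "fun_dim (graph_eigenspace n l) = 0"
  using assms
proof (induction n arbitrary: l)
  case 0
  then show ?case by (intro dim_zero_level)
next
  case (Suc n)
  have l: "l \<noteq> 3/4" "l \<noteq> 5/4" using Suc.prems(1)[of "Suc n"] by auto
  show ?case
  proof (cases "l = 1/2")
    case True
    show ?thesis unfolding True by (rule dim_half_Suc)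
  next
    case False
    have "fun_dim (graph_eigenspace n (decimation l)) = 0"
    proof (rule Suc.IH)
      fix m assume m: "m \<in> {1..n}"
      then have "Suc n - m = Suc (n - m)" by auto
      then show "(decimation ^^ (n - m)) (decimation l) \<notin> {3/4, 5/4}"
        using Suc.prems(1)[of m] m by (simp add: funpow_swap1)
    next
      show "decimation l \<noteq> 0" using l Suc.prems by (auto simp: decimation_def)
      have "decimation l - 3/2 = - (2 * l - 1) * (4 * l - 3) / 2"
        by (simp add: decimation_def algebra_simps)
      then show "decimation l \<noteq> 3/2" using l False by auto
    qed
    then show ?thesis using dim_decimation[of l n] False l Suc.prems by simp
  qed
qed

end

section \<open>Inverse branches and the Koenigs function\<close>

definition branch :: "bool \<Rightarrow> real \<Rightarrow> real" where
  "branch b x = (5 + (if b then 1 else - 1) * sqrt (25 - 16 * x)) / 8"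

fun branches :: "bool list \<Rightarrow> real \<Rightarrow> real" where
  "branches [] x = x"
| "branches (b # w) x = branch b (branches w x)"

lemma decimation_branch:
  assumes "x \<le> 25/16" shows "decimation (branch b x) = x"
proof -
  have s: "sqrt (25 - 16 * x) * sqrt (25 - 16 * x) = 25 - 16 * x" using assms by simp
  have "decimation (branch b x) = (25 - sqrt (25 - 16 * x) * sqrt (25 - 16 * x)) / 16"
    by (simp add: decimation_def branch_def field_simps)
  then show ?thesis unfolding s by simp
qed

text \<open>5/8 is the critical point of the decimation map and separates the two branches.\<close>

lemma branch_decimation: "y = branch (5/8 < y) (decimation y)"
proof -
  have "25 - 16 * decimation y = (8 * y - 5)\<^sup>2"
    by (simp add: decimation_def power2_eq_square algebra_simps)
  then have "sqrt (25 - 16 * decimation y) = \<bar>8 * y - 5\<bar>" by simp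
  then show ?thesis by (auto simp: branch_def)
qed

lemma branch_range:
  assumes "0 \<le> x" "x \<le> 5/4"
  shows "0 \<le> branch b x" "branch b x \<le> 5/4" "5/8 \<le> branch True x" "branch False x < 5/8"
proof -
  define r where "r = sqrt (25 - 16 * x)"
  have "sqrt (25 - 16 * x) \<le> sqrt 25" using assms by (intro real_sqrt_le_mono) auto
  then have "r \<le> 5" "0 < r" using assms by (simp_all add: r_def)
  then show "0 \<le> branch b x" "branch b x \<le> 5/4" "5/8 \<le> branch True x" "branch False x < 5/8"
    by (auto simp: branch_def r_def[symmetric])
qed

lemma branch_pos:
  assumes "0 < x" "x \<le> 5/4" shows "0 < branch b x"
proof -
  have "branch b x \<noteq> 0" using decimation_branch[of x b] assms by (auto simp: decimation_def)
  then show ?thesis using branch_range(1)[of x b] assms by simp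
qed

text \<open>The rationalized form shows the zero at the origin as a factor. It underlies the
  estimates and is the formula copied by the complex version \<open>csmall\<close>.\<close>

lemma branch_False:
  assumes "x \<le> 25/16" shows "branch False x = 2 * x / (5 + sqrt (25 - 16 * x))"
proof -
  have "0 \<le> sqrt (25 - 16 * x)" using assms by simp
  then have p: "0 < 5 + sqrt (25 - 16 * x)" by linarith
  have s: "sqrt (25 - 16 * x) * sqrt (25 - 16 * x) = 25 - 16 * x" using assms by simp
  have "(5 - sqrt (25 - 16 * x)) * (5 + sqrt (25 - 16 * x)) = 16 * x"
    using s by (simp add: algebra_simps)
  then show ?thesis using p by (simp add: branch_def field_simps)
qed

lemma branches_range:
  assumes "0 \<le> x" "x \<le> 5/4" shows "0 \<le> branches w x \<and> branches w x \<le> 5/4"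
proof (induction w)
  case (Cons b w)
  then show ?case using branch_range(1,2)[of "branches w x" b] by simp
qed (use assms in simp)

lemma branches_pos:
  assumes "0 < x" "x \<le> 5/4" shows "0 < branches w x"
  using assms branches_range[of x] by (induction w) (auto intro!: branch_pos)

lemma decimation_branches:
  assumes "0 \<le> x" "x \<le> 5/4" shows "(decimation ^^ length w) (branches w x) = x"
proof (induction w)
  case (Cons b w)
  have "decimation (branch b (branches w x)) = branches w x"
    using branches_range[OF assms, of w] by (intro decimation_branch) auto
  then show ?case using Cons by (simp add: funpow_swap1)
qed simp

lemma branches_append: "branches (u @ w) x = branches u (branches w x)"
  by (induction u) auto

lemma branches_inj:
  assumes "0 \<le> x" "x \<le> 5/4" "branches w x = branches w' x" "length w = length w'"
  shows "w = w'"
  using assms(4,3)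
proof (induction w w' rule: list_induct2)
  case (Cons a u a' u')
  have r: "0 \<le> branches u x" "branches u x \<le> 5/4" "0 \<le> branches u' x" "branches u' x \<le> 5/4"
    using branches_range[OF assms(1,2)] by auto
  have "branch a (branches u x) = branch a' (branches u' x)" using Cons.prems by simp
  moreover from this have "branches u x = branches u' x"
    using decimation_branch[of "branches u x" a] decimation_branch[of "branches u' x" a'] r by simp
  moreover have "a = a'"
    using branch_range(3,4)[OF r(1,2)] calculation by (cases a; cases a') auto
  ultimately show ?case using Cons.IH by simp
qed simp

lemma decimation_preimage:
  assumes "(decimation ^^ k) y = x"
  shows "\<exists>w. length w = k \<and> y = branches w x"
  using assms
proof (induction k arbitrary: y)
  case (Suc k)
  then obtain w where "length w = k" "decimation y = branches w x" by (metis funpow_swap1 comp_apply funpow.simps(2))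
  then show ?case using branch_decimation[of y] by (intro exI[of _ "(5/8 < y) # w"]) simp
qed simp

section \<open>Iterates of the small branch and their linearization\<close>

abbreviation small_iter :: "nat \<Rightarrow> real \<Rightarrow> real" where
  "small_iter n \<equiv> branch False ^^ n"

lemma small_iter_branches: "small_iter n x = branches (replicate n False) x"
  by (induction n) auto

lemma branch_False_bounds:
  assumes "0 \<le> x" "x \<le> 5/4"
  shows "x \<le> 5 * branch False x" "branch False x \<le> 2/5 * x" "5 * branch False x \<le> x * (1 + 16/25 * x)"
proof -
  define r where "r = sqrt (25 - 16 * x)"
  have r: "0 \<le> r" "r \<le> 5" "r * r = 25 - 16 * x"
    using assms real_sqrt_le_mono[of "25 - 16 * x" 25] by (auto simp: r_def)
  have eq: "branch False x = 2 * x / (5 + r)" unfolding r_def using assms by (intro branch_False) auto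
  show "x \<le> 5 * branch False x" unfolding eq using r assms mult_left_mono[of r 5 x] by (simp add: field_simps)
  show "branch False x \<le> 2/5 * x" unfolding eq using r assms mult_nonneg_nonneg[of x r] by (simp add: field_simps)
  have "10 \<le> (1 + 16/25 * x) * (5 + r)"
  proof -
    have "(5 - r) * (5 + r) = 16 * x" using r by (simp add: algebra_simps)
    then have x16: "1 + 16/25 * x = 1 + (5 - r) * (5 + r) / 25" by simp
    have "(1 + 16/25 * x) * (5 + r) = 5 + r + (5 - r) * ((5 + r) * (5 + r)) / 25"
      unfolding x16 by (simp add: algebra_simps)
    moreover have "(5 - r) * (5 * 5) \<le> (5 - r) * ((5 + r) * (5 + r))"
      using r by (intro mult_left_mono mult_mono) auto
    ultimately show ?thesis by simp
  qed
  then have "5 * (2 * x) \<le> x * (1 + 16/25 * x) * (5 + r)"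
    using mult_left_mono[of 10 "(1 + 16/25 * x) * (5 + r)" x] assms by (simp add: mult_ac)
  then show "5 * branch False x \<le> x * (1 + 16/25 * x)" unfolding eq using r by (simp add: field_simps)
qed

lemma small_iter_range:
  assumes "0 \<le> x" "x \<le> 5/4" shows "0 \<le> small_iter n x" "small_iter n x \<le> 5/4"
  using branches_range[OF assms] by (simp_all add: small_iter_branches)

lemma small_iter_pos: "0 < x \<Longrightarrow> x \<le> 5/4 \<Longrightarrow> 0 < small_iter n x"
  using branches_pos by (simp add: small_iter_branches)

lemma small_iter_le:
  assumes "0 \<le> x" "x \<le> 5/4" shows "small_iter n x \<le> (2/5) ^ n * x"
proof (induction n)
  case (Suc n)
  have "small_iter (Suc n) x \<le> 2/5 * small_iter n x"
    using branch_False_bounds(2)[OF small_iter_range[OF assms, of n]] by simp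
  also have "\<dots> \<le> 2/5 * ((2/5) ^ n * x)" using Suc by simp
  finally show ?case by simp
qed simp

lemma small_iter_scaled_bounds:
  assumes "0 \<le> x" "x \<le> 5/4"
  shows "5 ^ n * small_iter n x \<le> 5 ^ Suc n * small_iter (Suc n) x"
    "5 ^ n * small_iter n x \<le> x * exp (16/15 * (x - small_iter n x))" "x \<le> 5 ^ n * small_iter n x"
proof -
  have inc: "5 ^ n * small_iter n x \<le> 5 ^ Suc n * small_iter (Suc n) x" for n
    using branch_False_bounds(1)[OF small_iter_range[OF assms, of n]] by simp
  then show "5 ^ n * small_iter n x \<le> 5 ^ Suc n * small_iter (Suc n) x" .
  show "x \<le> 5 ^ n * small_iter n x"
    using lift_Suc_mono_le[of "\<lambda>n. 5 ^ n * small_iter n x", OF inc, of 0 n] by simp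
  show "5 ^ n * small_iter n x \<le> x * exp (16/15 * (x - small_iter n x))"
  proof (induction n)
    case (Suc n)
    let ?y = "small_iter n x"
    have y: "0 \<le> ?y" "?y \<le> 5/4" by (rule small_iter_range[OF assms])+
    \<comment> \<open>The small branch shrinks by at least 2/5, so \<open>?y\<close> minus its image
      is at least \<open>3/5 * ?y\<close>; hence 16/15, and the exponents telescope.\<close>
    have "16/25 * ?y \<le> 16/15 * (?y - small_iter (Suc n) x)"
      using branch_False_bounds(2)[OF y] by simp
    then have "1 + 16/25 * ?y \<le> exp (16/15 * (?y - small_iter (Suc n) x))"
      by (meson add_mono exp_ge_add_one_self order_trans order_refl)
    then have "?y * (1 + 16/25 * ?y) \<le> ?y * exp (16/15 * (?y - small_iter (Suc n) x))"
      using y by (intro mult_left_mono) auto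
    then have "5 * branch False ?y \<le> ?y * exp (16/15 * (?y - small_iter (Suc n) x))"
      using branch_False_bounds(3)[OF y] by linarith
    then have "5 ^ n * (5 * branch False ?y) \<le> 5 ^ n * (?y * exp (16/15 * (?y - small_iter (Suc n) x)))"
      by (intro mult_left_mono) auto
    also have "\<dots> = (5 ^ n * ?y) * exp (16/15 * (?y - small_iter (Suc n) x))" by simp
    also have "\<dots> \<le> (x * exp (16/15 * (x - ?y))) * exp (16/15 * (?y - small_iter (Suc n) x))"
      using Suc by (intro mult_right_mono) auto
    also have "\<dots> = x * exp (16/15 * (x - small_iter (Suc n) x))"
      by (simp add: exp_add[symmetric] algebra_simps)
    finally show ?case by simp
  qed simp
qed

text \<open>The Koenigs linearization of the small branch at its fixed point 0, where the derivative
  is 1/5: one step of the small branch divides it by 5.\<close>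

definition koenigs :: "real \<Rightarrow> real" where
  "koenigs x = lim (\<lambda>n. 5 ^ n * small_iter n x)"

lemma koenigs_LIMSEQ:
  assumes "0 \<le> x" "x \<le> 5/4"
  shows "(\<lambda>n. 5 ^ n * small_iter n x) \<longlonglongrightarrow> koenigs x"
proof -
  have "incseq (\<lambda>n. 5 ^ n * small_iter n x)"
    by (intro incseq_SucI small_iter_scaled_bounds(1) assms)
  moreover have "5 ^ n * small_iter n x \<le> x * exp (16/15 * x)" for n
    using small_iter_scaled_bounds(2)[OF assms, of n] small_iter_range(1)[OF assms, of n] assms
    by (rule_tac order_trans) (auto intro!: mult_left_mono)
  ultimately obtain L where "(\<lambda>n. 5 ^ n * small_iter n x) \<longlonglongrightarrow> L"
    using incseq_convergent by blast
  then show ?thesis by (simp add: koenigs_def limI)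
qed

lemma koenigs_bounds:
  assumes "0 \<le> x" "x \<le> 5/4"
  shows "x \<le> koenigs x" "koenigs x \<le> x * exp (16/15 * x)" "5 ^ n * small_iter n x \<le> koenigs x"
proof -
  show "x \<le> koenigs x"
    using koenigs_LIMSEQ[OF assms] by (rule LIMSEQ_le_const) (use small_iter_scaled_bounds(3)[OF assms] in blast)
  have "5 ^ n * small_iter n x \<le> x * exp (16/15 * x)" for n
    using small_iter_scaled_bounds(2)[OF assms, of n] small_iter_range(1)[OF assms, of n] assms
    by (rule_tac order_trans) (auto intro!: mult_left_mono)
  then show "koenigs x \<le> x * exp (16/15 * x)"
    by (intro LIMSEQ_le_const2[OF koenigs_LIMSEQ[OF assms]]) blast
  show "5 ^ n * small_iter n x \<le> koenigs x"
    by (rule incseq_le[OF _ koenigs_LIMSEQ[OF assms]])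
      (intro incseq_SucI small_iter_scaled_bounds(1) assms)
qed

lemma koenigs_small_iter:
  assumes "0 \<le> x" "x \<le> 5/4" shows "koenigs x = 5 ^ k * koenigs (small_iter k x)"
proof -
  have 1: "(\<lambda>n. 5 ^ (n + k) * small_iter (n + k) x) \<longlonglongrightarrow> koenigs x"
    by (rule LIMSEQ_ignore_initial_segment[OF koenigs_LIMSEQ[OF assms]])
  have 2: "(\<lambda>n. 5 ^ k * (5 ^ n * small_iter n (small_iter k x))) \<longlonglongrightarrow> 5 ^ k * koenigs (small_iter k x)"
    by (intro tendsto_intros koenigs_LIMSEQ small_iter_range assms)
  have 3: "5 ^ (n + k) * small_iter (n + k) x = 5 ^ k * (5 ^ n * small_iter n (small_iter k x))" for n
    by (simp add: power_add funpow_add)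
  show ?thesis by (rule LIMSEQ_unique[OF 1[unfolded 3] 2])
qed

text \<open>Limits preserve only weak inequalities. The induction therefore also shows that
  \<open>small_iter n x / x\<close> grows with \<open>x\<close>; then \<open>koenigs x / x\<close>
  is nondecreasing and positive, which gives a strict inequality.\<close>

lemma koenigs_strict_mono:
  assumes "0 < x" "x < y" "y \<le> 5/4" shows "koenigs x < koenigs y"
proof -
  have "small_iter n x \<le> small_iter n y \<and> small_iter n x * y \<le> small_iter n y * x" for n
  proof (induction n)
    case (Suc n)
    define a b where ab: "a = small_iter n x" "b = small_iter n y"
    have r: "0 < a" "a \<le> 5/4" "0 < b" "b \<le> 5/4"
      using small_iter_pos[of x n] small_iter_pos[of y n] small_iter_range(2)[of x n] small_iter_range(2)[of y n]
        assms unfolding ab by simp_all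
    have h: "a \<le> b" "a * y \<le> b * x" using Suc ab by auto
    define p q where pq: "p = 5 + sqrt (25 - 16 * a)" "q = 5 + sqrt (25 - 16 * b)"
    have "0 \<le> sqrt (25 - 16 * b)" using r by simp
    then have q: "0 < q" unfolding pq by linarith
    have qp: "q \<le> p" unfolding pq using h by simp
    note q = q qp
    have e: "branch False a = 2 * a / p" "branch False b = 2 * b / q"
      unfolding pq using r by (auto intro!: branch_False)
    have "2 * a / p \<le> 2 * b / q" using h q r by (intro frac_le) auto
    moreover have "(2 * (a * y)) / p \<le> (2 * (b * x)) / q"
      using h q r assms by (intro frac_le) auto
    ultimately show ?case using e ab by (simp add: mult_ac)
  qed (use assms in simp)
  then have "(5 ^ n * small_iter n x) * y \<le> (5 ^ n * small_iter n y) * x" for n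
    by (simp add: mult.assoc)
  then have "koenigs x * y \<le> koenigs y * x"
    using assms by (intro LIMSEQ_le[OF tendsto_mult_right[OF koenigs_LIMSEQ] tendsto_mult_right[OF koenigs_LIMSEQ]]) auto
  moreover have "koenigs x * x < koenigs x * y"
    using koenigs_bounds(1)[of x] assms by (intro mult_strict_left_mono) auto
  ultimately have "koenigs x * x < koenigs y * x" by linarith
  then show ?thesis using assms by simp
qed

lemma koenigs_inj:
  assumes "0 < x" "x \<le> 5/4" "0 < y" "y \<le> 5/4" "koenigs x = koenigs y" shows "x = y"
  using koenigs_strict_mono[of x y] koenigs_strict_mono[of y x] assms by (metis less_irrefl linorder_neqE)

lemma continuous_on_small_iter: "continuous_on A (small_iter n)"
proof -
  have "continuous_on UNIV (small_iter n)"
    by (induction n) (auto simp: branch_def intro!: continuous_intros)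
  then show ?thesis by (rule continuous_on_subset) simp
qed

text \<open>The convergence is uniform on \<open>[0, 1/8]\<close>, so the limit is continuous there;
  the intermediate value theorem applies because \<open>koenigs (1/8)\<close> is at least
  1/8.\<close>

lemma koenigs_surj:
  assumes "0 < t" "t \<le> 1/8" obtains x where "0 < x" "x \<le> 1/8" "koenigs x = t"
proof -
  have bound: "dist (5 ^ n * small_iter n x) (koenigs x) \<le> 3 * (2/5) ^ n" if "x \<in> {0..1/8}" for n x
  proof -
    have x: "0 \<le> x" "x \<le> 5/4" "x \<le> 1/8" using that by auto
    let ?y = "small_iter n x"
    have y: "0 \<le> ?y" "?y \<le> 5/4" by (rule small_iter_range[OF x(1,2)])+
    have yle: "?y \<le> (2/5) ^ n" "?y \<le> 1/8"
    proof -
      have "?y \<le> (2/5) ^ n * x" by (rule small_iter_le[OF x(1,2)])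
      moreover have "(2/5) ^ n * x \<le> (2/5) ^ n" using x by (simp add: mult_left_le)
      moreover have "(2/5) ^ n * x \<le> x" using x by (simp add: mult_left_le_one_le power_le_one)
      ultimately show "?y \<le> (2/5) ^ n" "?y \<le> 1/8" using x(3) by linarith+
    qed
    have e: "exp (16/15 * ?y) \<le> 1 + 3 * ?y"
    proof -
      have "exp (16/15 * ?y) \<le> 1 + 16/15 * ?y + (16/15 * ?y)\<^sup>2"
        using y yle by (intro exp_bound) auto
      moreover have "?y * ?y \<le> ?y * (1/8)" using y yle by (intro mult_left_mono) auto
      then have "(16/15 * ?y)\<^sup>2 \<le> 1/2 * ?y" using y by (simp add: power2_eq_square)
      ultimately show ?thesis using y by simp
    qed
    have a1: "5 ^ n * ?y \<le> 1"
    proof -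
      have "5 ^ n * ?y \<le> koenigs x" by (rule koenigs_bounds(3)[OF x(1,2)])
      also have "\<dots> \<le> x * exp (16/15 * x)" by (rule koenigs_bounds(2)[OF x(1,2)])
      also have "\<dots> \<le> 1/8 * exp 1" using x by (intro mult_mono) auto
      also have "\<dots> \<le> 1" using exp_le by simp
      finally show ?thesis .
    qed
    have "koenigs x = 5 ^ n * koenigs ?y" by (rule koenigs_small_iter[OF x(1,2)])
    also have "\<dots> \<le> 5 ^ n * (?y * exp (16/15 * ?y))" using koenigs_bounds(2)[OF y] by simp
    also have "\<dots> \<le> 5 ^ n * (?y * (1 + 3 * ?y))" using e y by (intro mult_left_mono) auto
    also have "\<dots> = 5 ^ n * ?y + (5 ^ n * ?y) * (3 * ?y)" by (simp add: algebra_simps)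
    also have "\<dots> \<le> 5 ^ n * ?y + 1 * (3 * (2/5) ^ n)"
      using a1 y yle by (intro add_left_mono mult_mono) auto
    finally show ?thesis using koenigs_bounds(3)[OF x(1,2), of n] by (simp add: dist_real_def)
  qed
  have "uniform_limit {0..1/8} (\<lambda>n x. 5 ^ n * small_iter n x) koenigs sequentially"
  proof (rule uniform_limitI)
    fix e :: real assume "0 < e"
    have "(\<lambda>n. 3 * (2/5 :: real) ^ n) \<longlonglongrightarrow> 0"
      by (intro tendsto_mult_right_zero LIMSEQ_power_zero) auto
    then have "\<forall>\<^sub>F n in sequentially. 3 * (2/5 :: real) ^ n < e"
      using \<open>0 < e\<close> by (rule order_tendstoD)
    then show "\<forall>\<^sub>F n in sequentially. \<forall>x\<in>{0..1/8}. dist (5 ^ n * small_iter n x) (koenigs x) < e"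
    proof eventually_elim
      case (elim n)
      then show ?case using bound[of _ n] by (meson le_less_trans)
    qed
  qed
  then have "continuous_on {0..1/8} koenigs"
    by (rule uniform_limit_theorem[rotated])
      (auto intro!: always_eventually continuous_intros continuous_on_small_iter)
  moreover have "koenigs 0 = 0" using koenigs_bounds(1,2)[of 0] by simp
  moreover have "t \<le> koenigs (1/8)" using koenigs_bounds(1)[of "1/8"] assms by simp
  ultimately obtain x where "0 \<le> x" "x \<le> 1/8" "koenigs x = t"
    using IVT'[of koenigs 0 t "1/8"] assms by auto
  then show ?thesis using that \<open>koenigs 0 = 0\<close> assms by (metis less_le)
qed

lemma decimation_seq_small_iter:
  assumes "0 \<le> x" "x \<le> 1/8"
  shows "decimation_seq n (\<lambda>m. small_iter (m - n) x)"
  unfolding decimation_seq_def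
proof (intro allI impI conjI)
  fix m assume m: "n \<le> m"
  have x: "0 \<le> x" "x \<le> 5/4" using assms by auto
  show "0 \<le> small_iter (m - n) x" by (rule small_iter_range[OF x])
  have "(2/5) ^ (m - n) * x \<le> 1 * x" using x by (intro mult_right_mono power_le_one) auto
  then show "small_iter (m - n) x \<le> 1/8" using small_iter_le[OF x, of "m - n"] assms by linarith
  have "Suc m - n = Suc (m - n)" using m by simp
  then show "small_iter (m - n) x = decimation (small_iter (Suc m - n) x)"
    using decimation_branch[of "small_iter (m - n) x" False] small_iter_range[OF x, of "m - n"] by simp
qed

lemma decimation_seq_limit:
  assumes "0 \<le> x" "x \<le> 5/4"
  shows "(\<lambda>m. 5 ^ m * small_iter (m - n) x) \<longlonglongrightarrow> 5 ^ n * koenigs x"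
proof -
  have "(\<lambda>k. 5 ^ n * (5 ^ k * small_iter k x)) \<longlonglongrightarrow> 5 ^ n * koenigs x"
    by (intro tendsto_intros koenigs_LIMSEQ assms)
  then have "(\<lambda>k. 5 ^ (k + n) * small_iter ((k + n) - n) x) \<longlonglongrightarrow> 5 ^ n * koenigs x"
    by (simp add: power_add mult_ac)
  then show ?thesis by (rule LIMSEQ_offset)
qed

section \<open>The transfer operator\<close>

definition bwords :: "nat \<Rightarrow> bool list set" where
  "bwords n = {w. length w = n}"

lemma bwords_0 [simp]: "bwords 0 = {[]}"
  by (auto simp: bwords_def)

lemma bwords_Suc: "bwords (Suc n) = (#) False ` bwords n \<union> (#) True ` bwords n"
  by (auto simp: bwords_def length_Suc_conv image_iff)

lemma finite_bwords [simp]: "finite (bwords n)"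
  by (induction n) (auto simp: bwords_Suc)

lemma sum_bwords_Suc: "(\<Sum>w\<in>bwords (Suc n). f w) = (\<Sum>w\<in>bwords n. f (False # w) + f (True # w))"
  for f :: "bool list \<Rightarrow> 'a :: comm_monoid_add"
proof -
  have "(\<Sum>w\<in>bwords (Suc n). f w) = (\<Sum>w\<in>(#) False ` bwords n. f w) + (\<Sum>w\<in>(#) True ` bwords n. f w)"
    unfolding bwords_Suc by (rule sum.union_disjoint) auto
  then show ?thesis by (simp add: sum.reindex sum.distrib)
qed

lemma card_bwords: "card (bwords n) = 2 ^ n"
  using sum_bwords_Suc[of "\<lambda>_. 1 :: nat"] by (induction n) (simp_all add: sum_distrib_left[symmetric])

definition transfer :: "nat \<Rightarrow> (real \<Rightarrow> 'a :: real_normed_vector) \<Rightarrow> real \<Rightarrow> 'a" where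
  "transfer k g x = (\<Sum>w\<in>bwords k. g (branches w x))"

lemma transfer_0 [simp]: "transfer 0 g x = g x"
  by (simp add: transfer_def)

lemma transfer_Suc: "transfer (Suc k) g x = transfer k (\<lambda>y. g (branch False y) + g (branch True y)) x"
  by (simp add: transfer_def sum_bwords_Suc)

text \<open>Peels off the branch that is applied first, to the argument \<open>x\<close>;
  \<open>transfer_Suc\<close> peels off the one applied last.\<close>

lemma transfer_Suc': "transfer (Suc k) g x = transfer k g (branch False x) + transfer k g (branch True x)"
proof (induction k arbitrary: g)
  case (Suc k)
  show ?case unfolding transfer_Suc[of "Suc k"] Suc.IH by (simp only: transfer_Suc)
qed (simp add: transfer_Suc)

lemma norm_transfer_le:
  assumes "0 \<le> x" "x \<le> 5/4" "\<And>y. 0 \<le> y \<Longrightarrow> y \<le> 5/4 \<Longrightarrow> norm (g y) \<le> B"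
  shows "norm (transfer k g x) \<le> 2 ^ k * B"
proof -
  have "norm (transfer k g x) \<le> (\<Sum>w\<in>bwords k. B)"
    unfolding transfer_def using branches_range[OF assms(1,2)] assms(3) by (intro sum_norm_le) auto
  then show ?thesis by (simp add: card_bwords)
qed

text \<open>On a power of \<open>y - 5/8\<close> the transfer operator acts by halving the degree (odd powers are killed), so it
  contracts, modulo constants, a weighted norm on the coefficients of a power series at \<open>5/8\<close>. The
  weights are chosen to make the contraction rate \<open>2/5\<close>, which is less than \<open>1 / sqrt 5\<close>, while keeping them
  below the powers of a number less than \<open>15/16\<close>, the radius of convergence.\<close>

definition osc_weight :: "nat \<Rightarrow> real" where
  "osc_weight m = (if m = 0 then 0 else if m = 1 then 1/2 else (7/8) ^ m)"

lemma osc_weight_bounds: "0 \<le> osc_weight m" "osc_weight m \<le> (7/8) ^ m"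
  by (auto simp: osc_weight_def)

text \<open>From \<open>l = 4\<close> on the binomial theorem gives \<open>(29/16) ^ l\<close>, and
  the surplus \<open>(29/49) ^ l\<close> is at most 1/5. Smaller \<open>l\<close> are computed. For
  \<open>l = 1\<close> the pure power 7/8 in degree 1 would be too large; this explains the weight
  1/2.\<close>

lemma osc_weight_contraction:
  "2 / 4 ^ l * (\<Sum>j\<le>l. real (l choose j) * (15/16) ^ (l - j) * osc_weight j) \<le> 2/5 * osc_weight (2 * l)"
proof -
  consider "l = 0" | "l = 1" | "l = 2" | "l = 3" | "4 \<le> l" by linarith
  then show ?thesis
  proof cases
    case 5
    have "(\<Sum>j\<le>l. real (l choose j) * (15/16) ^ (l - j) * osc_weight j) \<le>
      (\<Sum>j\<le>l. real (l choose j) * (15/16) ^ (l - j) * (7/8) ^ j)"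
      by (intro sum_mono mult_left_mono osc_weight_bounds) auto
    also have "\<dots> = (7/8 + 15/16) ^ l"
      unfolding binomial_ring by (intro sum.cong refl) (simp add: mult_ac)
    finally have "2 / 4 ^ l * (\<Sum>j\<le>l. real (l choose j) * (15/16) ^ (l - j) * osc_weight j)
      \<le> 2 / 4 ^ l * (29/16) ^ l" by (intro mult_left_mono) auto
    also have "(29/16 :: real) ^ l = 4 ^ l * ((29/49) ^ l * (49/64) ^ l)"
      by (simp only: power_mult_distrib[symmetric]) simp
    also have "2 / 4 ^ l * (4 ^ l * ((29/49) ^ l * (49/64) ^ l)) = 2 * ((29/49 :: real) ^ l * (49/64) ^ l)"
      by simp
    also have "\<dots> \<le> 2 * (1/5 * (49/64) ^ l)"
    proof -
      have "(29/49 :: real) ^ l \<le> (29/49) ^ 4" using 5 by (intro power_decreasing) auto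
      also have "\<dots> \<le> 1/5" by (simp add: power_divide)
      finally show ?thesis by (intro mult_left_mono mult_right_mono) auto
    qed
    also have "\<dots> = 2/5 * osc_weight (2 * l)"
      using 5 by (simp add: osc_weight_def power_mult power_divide)
    finally show ?thesis .
  qed (simp_all add: osc_weight_def numeral_2_eq_2 numeral_3_eq_3)
qed

lemma sum_swap_coeffs:
  fixes c :: "'a :: comm_ring_1"
  shows "(\<Sum>w\<in>A. c * (\<Sum>j\<in>B. a j * b w j)) = c * (\<Sum>j\<in>B. a j * (\<Sum>w\<in>A. b w j))"
  by (simp only: sum_distrib_left) (rule sum.swap)

lemma transfer_power_osc:
  assumes "0 \<le> x" "x \<le> 5/4" "0 \<le> y" "y \<le> 5/4"
  shows "\<bar>transfer k (\<lambda>z. (z - 5/8) ^ m) x - transfer k (\<lambda>z. (z - 5/8) ^ m) y\<bar> \<le> 5/2 * (2/5) ^ k * osc_weight m"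
proof (induction k arbitrary: m)
  case 0
  have a: "\<bar>x - 5/8\<bar> \<le> 5/8" "\<bar>y - 5/8\<bar> \<le> 5/8" unfolding abs_le_iff using assms by auto
  have "\<bar>(x - 5/8) ^ m\<bar> \<le> (5/8) ^ m" "\<bar>(y - 5/8) ^ m\<bar> \<le> (5/8) ^ m"
    using power_mono[OF a(1), of m] power_mono[OF a(2), of m] by (auto simp: power_abs)
  then have "\<bar>(x - 5/8) ^ m - (y - 5/8) ^ m\<bar> \<le> 2 * (5/8) ^ m" by linarith
  moreover have "(5/8 :: real) ^ m \<le> (7/8) ^ m" by (intro power_mono) auto
  \<comment> \<open>Degree 1 determines the constant 5/2: there both sides are 5/4.\<close>
  have "2 * (5/8) ^ m \<le> 5/2 * osc_weight m" if "m \<noteq> 0"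
  proof (cases "m = 1")
    case False
    then have "osc_weight m = (7/8) ^ m" using that by (simp add: osc_weight_def)
    moreover have "0 \<le> (7/8 :: real) ^ m" by simp
    ultimately show ?thesis using \<open>(5/8 :: real) ^ m \<le> (7/8) ^ m\<close> by linarith
  qed (simp add: osc_weight_def)
  then show ?case using \<open>\<bar>(x - 5/8) ^ m - (y - 5/8) ^ m\<bar> \<le> 2 * (5/8) ^ m\<close>
    by (cases "m = 0") (auto simp: osc_weight_def)
next
  case (Suc k)
  have sub: "(branch False z - 5/8) ^ m + (branch True z - 5/8) ^ m =
      (if even m then 2 / 4 ^ (m div 2) * (\<Sum>j\<le>m div 2. (real (m div 2 choose j) * (15/16) ^ (m div 2 - j) * (-1) ^ j) * (z - 5/8) ^ j) else 0)"
    if z: "z \<le> 25/16" for z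
  proof -
    define r where "r = sqrt (25 - 16 * z) / 8"
    \<comment> \<open>Relative to the critical point 5/8 the two branches are \<open>- r\<close> and
      \<open>r\<close>. Odd powers cancel, and even ones are powers of \<open>r * r\<close>, which
      is affine in \<open>z - 5/8\<close>.\<close>
    have r2: "r * r = (15/16 - (z - 5/8)) / 4" using z by (simp add: r_def field_simps)
    have b: "branch False z - 5/8 = - r" "branch True z - 5/8 = r" by (simp_all add: branch_def r_def field_simps)
    show ?thesis
    proof (cases "even m")
      case True
      then obtain l where m: "m = 2 * l" by blast
      have "(- r) ^ m + r ^ m = 2 * (r * r) ^ l"
        by (simp add: m power_mult power2_eq_square)
      also have "\<dots> = 2 / 4 ^ l * ((- (z - 5/8)) + 15/16) ^ l"
        unfolding r2 by (simp add: power_divide)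
      also have "\<dots> = 2 / 4 ^ l * (\<Sum>j\<le>l. (real (l choose j) * (15/16) ^ (l - j) * (-1) ^ j) * (z - 5/8) ^ j)"
        unfolding binomial_ring
        by (rule arg_cong[where f = "(*) (2 / 4 ^ l)"], rule sum.cong[OF refl])
          (simp only: power_minus[of "z - 5/8"] mult_ac)
      finally show ?thesis unfolding b using True m by simp
    next
      case False
      then show ?thesis unfolding b by simp
    qed
  qed
  have tr: "transfer (Suc k) (\<lambda>z. (z - 5/8) ^ m) u =
    (if even m then 2 / 4 ^ (m div 2) * (\<Sum>j\<le>m div 2. (real (m div 2 choose j) * (15/16) ^ (m div 2 - j) * (-1) ^ j)
       * transfer k (\<lambda>z. (z - 5/8) ^ j) u) else 0)" if u: "0 \<le> u" "u \<le> 5/4" for u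
  proof -
    have "transfer (Suc k) (\<lambda>z. (z - 5/8) ^ m) u =
      (\<Sum>w\<in>bwords k. if even m then 2 / 4 ^ (m div 2) * (\<Sum>j\<le>m div 2. (real (m div 2 choose j) * (15/16) ^ (m div 2 - j) * (-1) ^ j)
       * (branches w u - 5/8) ^ j) else 0)"
      unfolding transfer_Suc unfolding transfer_def
      by (intro sum.cong refl sub order_trans[OF conjunct2[OF branches_range[OF u]]]) simp
    also have "\<dots> = (if even m then 2 / 4 ^ (m div 2) * (\<Sum>j\<le>m div 2. (real (m div 2 choose j) * (15/16) ^ (m div 2 - j) * (-1) ^ j)
       * transfer k (\<lambda>z. (z - 5/8) ^ j) u) else 0)"
    proof (cases "even m")
      case True
      show ?thesis unfolding if_P[OF True] transfer_def
        by (rule sum_swap_coeffs[where a = "\<lambda>j. real (m div 2 choose j) * (15/16) ^ (m div 2 - j) * (-1) ^ j"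
              and b = "\<lambda>w j. (branches w u - 5/8) ^ j"])
    qed simp
    finally show ?thesis .
  qed
  show ?case
  proof (cases "even m")
    case True
    then obtain l where m: "m = 2 * l" by blast
    let ?c = "\<lambda>j. real (l choose j) * (15/16) ^ (l - j)"
    let ?d = "\<lambda>j. transfer k (\<lambda>z. (z - 5/8) ^ j) x - transfer k (\<lambda>z. (z - 5/8) ^ j) y"
    have diff: "transfer (Suc k) (\<lambda>z. (z - 5/8) ^ m) x - transfer (Suc k) (\<lambda>z. (z - 5/8) ^ m) y =
        2 / 4 ^ l * (\<Sum>j\<le>l. (?c j * (-1) ^ j) * ?d j)"
      unfolding tr[OF assms(1,2)] tr[OF assms(3,4)] using True m
      by (simp add: right_diff_distrib[symmetric] sum_subtractf[symmetric] del: times_divide_eq_left)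
    have "\<bar>2 / 4 ^ l * (\<Sum>j\<le>l. (?c j * (-1) ^ j) * ?d j)\<bar> \<le>
        2 / 4 ^ l * (\<Sum>j\<le>l. ?c j * (5/2 * (2/5) ^ k * osc_weight j))"
    proof -
      have "\<bar>\<Sum>j\<le>l. (?c j * (-1) ^ j) * ?d j\<bar> \<le> (\<Sum>j\<le>l. ?c j * (5/2 * (2/5) ^ k * osc_weight j))"
      proof (rule order_trans[OF sum_abs], rule sum_mono)
        fix j
        have "\<bar>(?c j * (-1) ^ j) * ?d j\<bar> = ?c j * \<bar>?d j\<bar>"
          by (simp add: abs_mult power_abs)
        also have "\<dots> \<le> ?c j * (5/2 * (2/5) ^ k * osc_weight j)"
          using Suc.IH[of j] by (intro mult_left_mono) auto
        finally show "\<bar>(?c j * (-1) ^ j) * ?d j\<bar> \<le> ?c j * (5/2 * (2/5) ^ k * osc_weight j)" .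
      qed
      then show ?thesis unfolding abs_mult by (intro mult_mono) auto
    qed
    also have "\<dots> = 5/2 * (2/5) ^ k * (2 / 4 ^ l * (\<Sum>j\<le>l. ?c j * osc_weight j))"
      unfolding sum_distrib_left by (intro sum.cong refl) (simp only: mult_ac)
    also have "\<dots> \<le> 5/2 * (2/5) ^ k * (2/5 * osc_weight (2 * l))"
      by (intro mult_left_mono osc_weight_contraction) auto
    finally show ?thesis unfolding diff using m by (simp add: mult.commute)
  next
    case False
    then show ?thesis
      unfolding tr[OF assms(1,2)] tr[OF assms(3,4)] using osc_weight_bounds(1)[of m] by simp
  qed
qed

section \<open>Complex powers and the Koenigs function\<close>

definition zeta_term :: "real \<Rightarrow> complex \<Rightarrow> complex" where
  "zeta_term x s = complex_of_real x powr (- s / 2)"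

lemma zeta_term_exp: "0 < x \<Longrightarrow> zeta_term x s = exp (- s / 2 * of_real (ln x))"
  by (simp add: zeta_term_def powr_def Ln_of_real)

lemma norm_zeta_term: "0 < x \<Longrightarrow> norm (zeta_term x s) = x powr (- Re s / 2)"
  by (simp add: zeta_term_def norm_powr_real_powr)

lemma zeta_term_mult: "0 < x \<Longrightarrow> 0 < y \<Longrightarrow> zeta_term (x * y) s = zeta_term x s * zeta_term y s"
  by (simp add: zeta_term_exp ln_mult exp_add[symmetric] algebra_simps)

lemma zeta_term_power: "0 < x \<Longrightarrow> zeta_term (x ^ n) s = zeta_term x s ^ n"
proof (induction n)
  case 0
  show ?case by (simp add: zeta_term_def)
next
  case (Suc n)
  then show ?case by (simp add: zeta_term_mult)
qed

lemma zeta_term_holomorphic [holomorphic_intros]: "0 < x \<Longrightarrow> zeta_term x holomorphic_on A"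
proof -
  assume x: "0 < x"
  have "(\<lambda>s. exp (- s / 2 * of_real (ln x))) holomorphic_on A" by (intro holomorphic_intros) auto
  then show ?thesis using x by (simp add: zeta_term_exp[OF x, abs_def])
qed

lemma branch_True_range:
  assumes "0 \<le> y" "y \<le> 5/4"
  shows "5/8 \<le> branch True y" "branch True y \<le> 5/4" "0 < branch True y" "0 \<le> branch True y"
  using branch_range(2)[OF assms, of True] branch_range(3)[OF assms] by simp_all

text \<open>The large branch in front keeps the argument at least 5/8, away from the singularity of
  the logarithm at 0. This makes power series around 5/8 and bounds uniform in \<open>j\<close>
  possible.\<close>

definition koenigs_approx :: "nat \<Rightarrow> complex \<Rightarrow> real \<Rightarrow> complex" where
  "koenigs_approx j s y = zeta_term (5 ^ j * small_iter j (branch True y)) s"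

definition koenigs_power :: "complex \<Rightarrow> real \<Rightarrow> complex" where
  "koenigs_power s y = zeta_term (koenigs (branch True y)) s"

text \<open>Holomorphic versions, in the variable \<open>u = y - 5/8\<close>, of the branches and of the logarithm of
  the approximations to the Koenigs function.\<close>

definition cbranch :: "complex \<Rightarrow> complex" where
  "cbranch u = (5 + csqrt (15 - 16 * u)) / 8"

definition csmall :: "complex \<Rightarrow> complex" where
  "csmall z = 2 * z / (5 + csqrt (25 - 16 * z))"

definition corbit :: "nat \<Rightarrow> complex \<Rightarrow> complex" where
  "corbit k u = (csmall ^^ k) (cbranch u)"

text \<open>A small step multiplied by 5 divides its argument by
  \<open>(5 + sqrt (25 - 16 * x)) / 10\<close>, so the logarithm is built from one logarithm per
  step. These factors tend to 1 geometrically along the orbit, and principal values suffice.\<close>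

definition clog :: "nat \<Rightarrow> complex \<Rightarrow> complex" where
  "clog j u = Ln (cbranch u) - (\<Sum>k<j. Ln ((5 + csqrt (25 - 16 * corbit k u)) / 10))"

lemma norm_5_csqrt: "5 \<le> norm (5 + csqrt w)"
proof -
  have "5 \<le> Re (5 + csqrt w)" using Re_csqrt[of w] by (simp del: csqrt.simps)
  then show ?thesis using complex_Re_le_cmod[of "5 + csqrt w"] by linarith
qed

lemma not_nonpos_Re: "0 < Re z \<Longrightarrow> z \<notin> \<real>\<^sub>\<le>\<^sub>0"
  by (auto simp: complex_nonpos_Reals_iff)

text \<open>25/16 is the branch point of the square root in \<open>csmall\<close>. Since
  \<open>csmall\<close> contracts, a start below it keeps the whole orbit in its domain of
  holomorphy. The radius 15/16 is the branch point of \<open>cbranch\<close> itself.\<close>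

lemma cbranch_bounds:
  assumes "norm u < 15/16"
  shows "norm (cbranch u) < 25/16" "5/8 \<le> Re (cbranch u)"
proof -
  have "norm (15 - 16 * u) \<le> 15 + 16 * norm u" using norm_triangle_ineq4[of 15 "16 * u"] by (simp add: norm_mult)
  then have "norm (15 - 16 * u) \<le> 36" using assms by linarith
  then have "norm (csqrt (15 - 16 * u)) \<le> sqrt 36" unfolding norm_csqrt by (rule real_sqrt_le_mono)
  moreover have "sqrt 36 = (6 :: real)" by (rule real_sqrt_unique) auto
  ultimately have "norm (5 + csqrt (15 - 16 * u)) \<le> 11"
    using norm_triangle_ineq[of 5 "csqrt (15 - 16 * u)"] by simp
  then show "norm (cbranch u) < 25/16" by (simp add: cbranch_def norm_divide)
  show "5/8 \<le> Re (cbranch u)"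
    using Re_csqrt[of "15 - 16 * u"] by (simp add: cbranch_def del: csqrt.simps)
qed

lemma norm_csmall: "norm (csmall z) \<le> 2/5 * norm z"
proof -
  have "norm (csmall z) = 2 * norm z / norm (5 + csqrt (25 - 16 * z))"
    by (simp add: csmall_def norm_divide norm_mult)
  also have "\<dots> \<le> 2 * norm z / 5" by (intro frac_le norm_5_csqrt) auto
  finally show ?thesis by simp
qed

lemma norm_corbit:
  assumes "norm u < 15/16" shows "norm (corbit k u) \<le> (2/5) ^ k * norm (cbranch u)"
proof (induction k)
  case (Suc k)
  have "norm (corbit (Suc k) u) \<le> 2/5 * norm (corbit k u)" using norm_csmall by (simp add: corbit_def)
  then show ?case using Suc by simp
qed (simp add: corbit_def)

lemma norm_corbit_less:
  assumes "norm u < 15/16" shows "norm (corbit k u) < 25/16"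
proof -
  have "(2/5 :: real) ^ k * norm (cbranch u) \<le> 1 * norm (cbranch u)"
    by (intro mult_right_mono power_le_one) auto
  then show ?thesis using norm_corbit[OF assms, of k] cbranch_bounds(1)[OF assms] by linarith
qed

lemma Re_corbit_pos:
  assumes "norm u < 15/16" shows "0 < Re (25 - 16 * corbit k u)"
  using norm_corbit_less[OF assms, of k] complex_Re_le_cmod[of "corbit k u"] by simp

lemma cbranch_holomorphic: "cbranch holomorphic_on ball 0 (15/16)"
  unfolding cbranch_def
proof (intro holomorphic_intros)
  fix u :: complex assume "u \<in> ball 0 (15/16)"
  then have "0 < Re (15 - 16 * u)" using complex_Re_le_cmod[of u] by simp
  then show "15 - 16 * u \<notin> \<real>\<^sub>\<le>\<^sub>0" by (rule not_nonpos_Re)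
qed auto

lemma csqrt_corbit_holomorphic:
  assumes "corbit k holomorphic_on ball 0 (15/16)"
  shows "(\<lambda>u. csqrt (25 - 16 * corbit k u)) holomorphic_on ball 0 (15/16)"
proof (intro holomorphic_intros assms)
  fix u :: complex assume "u \<in> ball 0 (15/16)"
  then show "25 - 16 * corbit k u \<notin> \<real>\<^sub>\<le>\<^sub>0" using Re_corbit_pos by (intro not_nonpos_Re) auto
qed

lemma corbit_holomorphic: "corbit k holomorphic_on ball 0 (15/16)"
proof (induction k)
  case 0
  have "corbit 0 = cbranch" by (auto simp: corbit_def)
  then show ?case using cbranch_holomorphic by simp
next
  case (Suc k)
  have "5 + csqrt (25 - 16 * corbit k u) \<noteq> 0" for u using norm_5_csqrt[of "25 - 16 * corbit k u"] by auto
  then have "(\<lambda>u. 2 * corbit k u / (5 + csqrt (25 - 16 * corbit k u))) holomorphic_on ball 0 (15/16)"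
    by (intro holomorphic_intros Suc csqrt_corbit_holomorphic) auto
  moreover have "corbit (Suc k) = (\<lambda>u. 2 * corbit k u / (5 + csqrt (25 - 16 * corbit k u)))"
    by (auto simp: corbit_def csmall_def)
  ultimately show ?case by simp
qed

lemma clog_holomorphic: "clog j holomorphic_on ball 0 (15/16)"
  unfolding clog_def
proof (intro holomorphic_intros cbranch_holomorphic csqrt_corbit_holomorphic corbit_holomorphic)
  fix u :: complex assume u: "u \<in> ball 0 (15/16)"
  then show "cbranch u \<notin> \<real>\<^sub>\<le>\<^sub>0" using cbranch_bounds(2)[of u] by (intro not_nonpos_Re) auto
  show "(5 + csqrt (25 - 16 * corbit i u)) / 10 \<notin> \<real>\<^sub>\<le>\<^sub>0" for i
  proof (rule not_nonpos_Re)
    show "0 < Re ((5 + csqrt (25 - 16 * corbit i u)) / 10)"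
      using Re_csqrt[of "25 - 16 * corbit i u"] by (simp del: csqrt.simps)
  qed
qed (use Re_corbit_pos not_nonpos_Re in auto)

text \<open>Independent of \<open>j\<close>: the first logarithm is at most \<open>1 + pi\<close>,
  hence at most 5, and the others at most \<open>(2/5) ^ k\<close>, in total at most 2.\<close>

lemma norm_clog_le:
  assumes u: "norm u < 15/16" shows "norm (clog j u) \<le> 7"
proof -
  have "norm (Ln (cbranch u)) \<le> 5"
  proof -
    let ?z = "cbranch u"
    have z: "5/8 \<le> norm ?z" "norm ?z < 25/16"
      using cbranch_bounds[OF u] complex_Re_le_cmod[of ?z] by linarith+
    then have z0: "?z \<noteq> 0" by auto
    have "ln (norm ?z) \<le> norm ?z - 1" using z by (intro ln_le_minus_one) linarith
    moreover have "ln (5/8) \<le> ln (norm ?z)" using z by (subst ln_le_cancel_iff) linarith+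
    moreover have "ln (8/5 :: real) \<le> 8/5 - 1" by (intro ln_le_minus_one) simp
    moreover have "ln (5/8 :: real) = - ln (8/5)" by (simp add: ln_div)
    ultimately have "\<bar>Re (Ln ?z)\<bar> \<le> 1" using z z0 by simp
    moreover have "\<bar>Im (Ln ?z)\<bar> \<le> pi" using mpi_less_Im_Ln[OF z0] Im_Ln_le_pi[OF z0] by linarith
    ultimately show ?thesis using cmod_le[of "Ln ?z"] pi_less_4 by linarith
  qed
  moreover have t: "norm (Ln ((5 + csqrt (25 - 16 * corbit k u)) / 10)) \<le> (2/5) ^ k" for k
  proof -
    let ?z = "corbit k u" and ?c = "csqrt (25 - 16 * corbit k u)"
    have "(5 - ?c) * (5 + ?c) = 25 - ?c\<^sup>2" by (simp add: power2_eq_square algebra_simps del: csqrt.simps power2_csqrt)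
    then have "(5 - ?c) * (5 + ?c) = 16 * ?z" by simp
    then have "norm (5 - ?c) * norm (5 + ?c) = 16 * norm ?z" by (metis norm_mult norm_numeral)
    moreover have "norm (5 - ?c) * 5 \<le> norm (5 - ?c) * norm (5 + ?c)" by (intro mult_left_mono norm_5_csqrt) auto
    ultimately have n: "norm ((?c - 5) / 10) \<le> 8/25 * norm ?z"
      by (simp add: norm_divide norm_minus_commute[of ?c 5] del: csqrt.simps)
    have small: "norm ((?c - 5) / 10) < 1/2" using n norm_corbit_less[OF u, of k] by linarith
    have "norm (Ln (1 + (?c - 5) / 10)) \<le> 2 * norm ((?c - 5) / 10)" by (rule norm_Ln_le[OF small])
    also have "\<dots> \<le> 16/25 * norm ?z" using n by linarith
    also have "\<dots> \<le> 16/25 * ((2/5) ^ k * norm (cbranch u))" using norm_corbit[OF u, of k] by simp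
    also have "\<dots> \<le> 16/25 * ((2/5) ^ k * (25/16))"
      using cbranch_bounds(1)[OF u] by (intro mult_left_mono) auto
    finally have "norm (Ln (1 + (?c - 5) / 10)) \<le> (2/5) ^ k" by simp
    moreover have "1 + (?c - 5) / 10 = (5 + ?c) / 10" by (simp add: field_simps del: csqrt.simps)
    ultimately show ?thesis by simp
  qed
  moreover have "norm (\<Sum>k<j. Ln ((5 + csqrt (25 - 16 * corbit k u)) / 10)) \<le> 2"
  proof -
    have "norm (\<Sum>k<j. Ln ((5 + csqrt (25 - 16 * corbit k u)) / 10)) \<le> (\<Sum>k<j. (2/5) ^ k)"
      by (intro sum_norm_le t)
    also have "\<dots> \<le> 2" by (simp add: sum_gp_strict) (rule order_trans[of _ 0], auto)
    finally show ?thesis .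
  qed
  ultimately show ?thesis
    unfolding clog_def
    using norm_triangle_ineq4[of "Ln (cbranch u)" "\<Sum>k<j. Ln ((5 + csqrt (25 - 16 * corbit k u)) / 10)"] by linarith
qed

lemma cbranch_of_real:
  assumes "0 \<le> y" "y \<le> 5/4" shows "cbranch (of_real (y - 5/8)) = of_real (branch True y)"
proof -
  have "15 - 16 * complex_of_real (y - 5/8) = of_real (25 - 16 * y)" by (simp add: algebra_simps)
  moreover have "csqrt (of_real (25 - 16 * y)) = of_real (sqrt (25 - 16 * y))"
    using assms by (intro csqrt_of_real) auto
  ultimately show ?thesis by (simp add: cbranch_def branch_def del: csqrt.simps of_real_diff of_real_mult)
qed

lemma csqrt_25_of_real:
  assumes "0 \<le> y" "y \<le> 5/4" shows "csqrt (25 - 16 * of_real y) = of_real (sqrt (25 - 16 * y))"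
proof -
  have "25 - 16 * complex_of_real y = of_real (25 - 16 * y)" by simp
  then show ?thesis using csqrt_of_real[of "25 - 16 * y"] assms by (simp del: csqrt.simps of_real_diff of_real_mult)
qed

lemma corbit_of_real:
  assumes "0 \<le> y" "y \<le> 5/4"
  shows "corbit k (of_real (y - 5/8)) = of_real (small_iter k (branch True y))"
proof (induction k)
  case 0
  then show ?case using cbranch_of_real[OF assms] by (simp add: corbit_def)
next
  case (Suc k)
  let ?x = "small_iter k (branch True y)"
  have x: "0 \<le> ?x" "?x \<le> 5/4" by (rule small_iter_range[OF branch_True_range(4,2)[OF assms]])+
  have "corbit (Suc k) (of_real (y - 5/8)) = csmall (of_real ?x)" using Suc by (simp add: corbit_def)
  also have "\<dots> = of_real (branch False ?x)"
    using x csqrt_25_of_real[OF x] by (subst branch_False) (simp_all add: csmall_def del: csqrt.simps)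
  finally show ?case by simp
qed

lemma clog_of_real:
  assumes "0 \<le> y" "y \<le> 5/4"
  shows "clog j (of_real (y - 5/8)) = of_real (ln (5 ^ j * small_iter j (branch True y)))"
proof (induction j)
  case 0
  have "0 < branch True y" by (rule branch_True_range[OF assms])
  then show ?case using cbranch_of_real[OF assms] by (simp add: clog_def Ln_of_real)
next
  case (Suc j)
  note bt = branch_True_range(3,2)[OF assms]
  let ?x = "small_iter j (branch True y)"
  have x: "0 < ?x" "?x \<le> 5/4" using bt small_iter_pos[of "branch True y" j] small_iter_range[of "branch True y" j] by auto
  have s0: "0 \<le> sqrt (25 - 16 * ?x)" using x by simp
  define p where "p = (5 + sqrt (25 - 16 * ?x)) / 10"
  have p: "0 < p" using s0 by (simp add: p_def add_pos_nonneg)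
  have p5: "5 * p = (5 + sqrt (25 - 16 * ?x)) / 2" by (simp add: p_def)
  have "small_iter (Suc j) (branch True y) = ?x / (5 * p)"
    unfolding p5 using branch_False[of ?x] x by simp
  then have e: "5 ^ Suc j * small_iter (Suc j) (branch True y) = (5 ^ j * ?x) / p" using p by simp
  have "clog (Suc j) (of_real (y - 5/8)) = clog j (of_real (y - 5/8)) - Ln ((5 + csqrt (25 - 16 * corbit j (of_real (y - 5/8)))) / 10)"
    by (simp add: clog_def)
  also have "(5 + csqrt (25 - 16 * corbit j (of_real (y - 5/8)))) / 10 = complex_of_real p"
    unfolding corbit_of_real[OF assms] using csqrt_25_of_real[of ?x] x by (simp add: p_def del: csqrt.simps)
  also have "Ln (complex_of_real p) = of_real (ln p)" using p by (rule Ln_of_real)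
  finally show ?case unfolding e Suc using p x by (simp add: ln_div)
qed

lemma koenigs_approx_exp:
  assumes "0 \<le> y" "y \<le> 5/4"
  shows "koenigs_approx j s y = exp (- s / 2 * clog j (of_real (y - 5/8)))"
proof -
  have "0 < branch True y" "branch True y \<le> 5/4" by (rule branch_True_range[OF assms])+
  then have "0 < 5 ^ j * small_iter j (branch True y)" using small_iter_pos by simp
  then show ?thesis unfolding koenigs_approx_def clog_of_real[OF assms] by (rule zeta_term_exp)
qed

text \<open>The function is expanded at 5/8 and \<open>transfer_power_osc\<close> is applied to each
  power. The factor \<open>exp (4 * norm s)\<close> absorbs the bound 7 for \<open>clog\<close>,
  halved.\<close>

lemma koenigs_approx_osc:
  assumes "0 \<le> x" "x \<le> 5/4" "0 \<le> y" "y \<le> 5/4"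
  shows "norm (transfer k (koenigs_approx j s) x - transfer k (koenigs_approx j s) y) \<le> 73 * exp (4 * norm s) * (2/5) ^ k"
proof -
  define h where "h u = exp (- s / 2 * clog j u)" for u
  have hol: "h holomorphic_on ball 0 (15/16)"
    unfolding h_def by (intro holomorphic_intros clog_holomorphic) auto
  have hb: "norm (h u) \<le> exp (4 * norm s)" if "norm u < 15/16" for u
  proof -
    have "norm (- s / 2 * clog j u) \<le> norm s / 2 * 7"
      using norm_clog_le[OF that, of j] by (simp add: norm_mult mult_left_mono)
    also have "\<dots> \<le> 4 * norm s" by simp
    finally have "norm (- s / 2 * clog j u) \<le> 4 * norm s" .
    then show ?thesis unfolding h_def using norm_exp[of "- s / 2 * clog j u"] by (meson exp_le_cancel_iff order_trans)
  qed
  define a where "a m = (deriv ^^ m) h 0 / fact m" for m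
  \<comment> \<open>The radius 29/32 lies between the base 28/32 of the weights and the radius 30/32
    of holomorphy. The ratio 28/29 sums to 29, and \<open>5/2 * 29\<close> is below 73.\<close>
  have ab: "norm (a m) \<le> exp (4 * norm s) / (29/32) ^ m" for m
  proof -
    have "norm ((deriv ^^ m) h 0) \<le> fact m * exp (4 * norm s) / (29/32) ^ m"
    proof (rule Cauchy_inequality)
      show "h holomorphic_on ball 0 (29/32)" by (rule holomorphic_on_subset[OF hol]) auto
      show "continuous_on (cball 0 (29/32)) h"
        by (rule holomorphic_on_imp_continuous_on, rule holomorphic_on_subset[OF hol]) auto
      show "norm (h x) \<le> exp (4 * norm s)" if "norm (0 - x) = 29/32" for x
        using that by (intro hb) simp
    qed simp
    then show ?thesis by (simp add: a_def norm_divide divide_simps mult_ac)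
  qed
  have ser: "(\<lambda>m. a m * of_real ((z - 5/8) ^ m)) sums koenigs_approx j s z" if z: "0 \<le> z" "z \<le> 5/4" for z
  proof -
    have "\<bar>z - 5/8\<bar> \<le> 5/8" unfolding abs_le_iff using z by auto
    then have "complex_of_real (z - 5/8) \<in> ball 0 (15/16)" by (simp del: of_real_diff)
    from holomorphic_power_series[OF hol this] show ?thesis
      by (simp add: a_def h_def koenigs_approx_exp[OF z] del: of_real_diff)
  qed
  have tser: "(\<lambda>m. a m * of_real (transfer k (\<lambda>z. (z - 5/8) ^ m) z)) sums transfer k (koenigs_approx j s) z"
    if z: "0 \<le> z" "z \<le> 5/4" for z
  proof -
    have "(\<lambda>m. \<Sum>w\<in>bwords k. a m * of_real ((branches w z - 5/8) ^ m)) sums (\<Sum>w\<in>bwords k. koenigs_approx j s (branches w z))"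
      using branches_range[OF z] by (intro sums_sum ser) auto
    then show ?thesis by (simp add: transfer_def sum_distrib_left)
  qed
  let ?d = "\<lambda>m. transfer k (\<lambda>z. (z - 5/8) ^ m) x - transfer k (\<lambda>z. (z - 5/8) ^ m) y"
  have s: "(\<lambda>m. a m * of_real (?d m)) sums (transfer k (koenigs_approx j s) x - transfer k (koenigs_approx j s) y)"
    using sums_diff[OF tser[OF assms(1,2)] tser[OF assms(3,4)]] by (simp add: right_diff_distrib)
  let ?K = "exp (4 * norm s) * (5/2 * (2/5) ^ k)"
  have "(\<lambda>m. ?K * (28/29) ^ m) sums (?K * (1 / (1 - 28/29)))"
    by (intro sums_mult geometric_sums) simp
  then have "norm (transfer k (koenigs_approx j s) x - transfer k (koenigs_approx j s) y) \<le> ?K * (1 / (1 - 28/29))"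
  proof (rule norm_sums_le[OF s])
    fix m
    have "norm (a m * of_real (?d m)) = norm (a m) * \<bar>?d m\<bar>" by (simp only: norm_mult norm_of_real)
    also have "\<dots> \<le> (exp (4 * norm s) / (29/32) ^ m) * (5/2 * (2/5) ^ k * (7/8) ^ m)"
    proof (intro mult_mono ab)
      have "\<bar>?d m\<bar> \<le> 5/2 * (2/5) ^ k * osc_weight m" by (rule transfer_power_osc[OF assms])
      also have "\<dots> \<le> 5/2 * (2/5) ^ k * (7/8) ^ m" by (intro mult_left_mono osc_weight_bounds) auto
      finally show "\<bar>?d m\<bar> \<le> 5/2 * (2/5) ^ k * (7/8) ^ m" .
    qed auto
    also have "\<dots> = ?K * ((7/8) ^ m / (29/32) ^ m)" by simp
    also have "(7/8 :: real) ^ m / (29/32) ^ m = (28/29) ^ m" by (simp add: power_divide[symmetric])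
    finally show "norm (a m * of_real (?d m)) \<le> ?K * (28/29) ^ m" .
  qed
  also have "\<dots> \<le> 73 * exp (4 * norm s) * (2/5) ^ k" by simp
  finally show ?thesis .
qed

lemma koenigs_branch_bounds:
  assumes "0 \<le> y" "y \<le> 5/4" shows "5/8 \<le> koenigs (branch True y)" "0 < koenigs (branch True y)"
proof -
  have "5/8 \<le> branch True y" "branch True y \<le> 5/4" by (rule branch_True_range[OF assms])+
  then show "5/8 \<le> koenigs (branch True y)" using koenigs_bounds(1)[of "branch True y"] by linarith
  then show "0 < koenigs (branch True y)" by linarith
qed

lemma zeta_term_tendsto:
  assumes "f \<longlonglongrightarrow> x" "0 < x" "\<And>n. 0 < f n"
  shows "(\<lambda>n. zeta_term (f n) s) \<longlonglongrightarrow> zeta_term x s"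
proof -
  have "(\<lambda>n. exp (- s / 2 * of_real (ln (f n)))) \<longlonglongrightarrow> exp (- s / 2 * of_real (ln x))"
    using assms by (intro tendsto_intros) auto
  then show ?thesis using assms by (simp add: zeta_term_exp)
qed

lemma koenigs_approx_LIMSEQ:
  assumes "0 \<le> y" "y \<le> 5/4"
  shows "(\<lambda>j. koenigs_approx j s y) \<longlonglongrightarrow> koenigs_power s y"
proof -
  note b = branch_True_range(3,2)[OF assms]
  then have "0 < 5 ^ j * small_iter j (branch True y)" for j using small_iter_pos by simp
  then show ?thesis
    unfolding koenigs_approx_def koenigs_power_def
    using b koenigs_branch_bounds[OF assms] by (intro zeta_term_tendsto koenigs_LIMSEQ) auto
qed

lemma transfer_koenigs_LIMSEQ:
  assumes "0 \<le> y" "y \<le> 5/4"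
  shows "(\<lambda>j. transfer k (koenigs_approx j s) y) \<longlonglongrightarrow> transfer k (koenigs_power s) y"
  unfolding transfer_def using branches_range[OF assms] by (intro tendsto_sum koenigs_approx_LIMSEQ) auto

lemma koenigs_power_osc:
  assumes "0 \<le> x" "x \<le> 5/4" "0 \<le> y" "y \<le> 5/4"
  shows "norm (transfer k (koenigs_power s) x - transfer k (koenigs_power s) y) \<le> 73 * exp (4 * norm s) * (2/5) ^ k"
proof -
  have "(\<lambda>j. norm (transfer k (koenigs_approx j s) x - transfer k (koenigs_approx j s) y))
     \<longlonglongrightarrow> norm (transfer k (koenigs_power s) x - transfer k (koenigs_power s) y)"
    by (intro tendsto_intros transfer_koenigs_LIMSEQ assms)
  then show ?thesis by (rule LIMSEQ_le_const2) (use koenigs_approx_osc[OF assms] in blast)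
qed

lemma transfer_koenigs_holomorphic:
  assumes "0 \<le> x" "x \<le> 5/4" shows "(\<lambda>s. transfer k (koenigs_power s) x) holomorphic_on A"
  unfolding transfer_def koenigs_power_def
  using branches_range[OF assms] koenigs_branch_bounds(2) by (intro holomorphic_intros) auto

section \<open>The zeta function of the polynomial\<close>

lemma poly_gasket_poly: "poly gasket_poly x = decimation x"
  by (simp add: gasket_poly_def decimation_def algebra_simps)

lemma degree_gasket_poly: "degree gasket_poly = 2"
  by (simp add: gasket_poly_def)

lemma pderiv_gasket_poly: "poly (pderiv gasket_poly) 0 = 5"
  by (simp add: gasket_poly_def pderiv_pCons)

lemma poly_poly_iter: "poly (poly_iter gasket_poly n) x = (decimation ^^ n) x"
  unfolding poly_iter_def by (induction n) (auto simp: poly_pcompose poly_gasket_poly)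

lemma degree_poly_iter: "degree (poly_iter gasket_poly n) = 2 ^ n"
  unfolding poly_iter_def by (induction n) (auto simp: degree_pcompose degree_gasket_poly)

lemma poly_map_of_real: "poly (map_poly complex_of_real p) (of_real x) = of_real (poly p x)"
  by (induction p) (auto simp: map_poly_pCons)

text \<open>The branches supply \<open>2 ^ n\<close> different roots and the degree allows no more,
  so every root is simple and real.\<close>

lemma proots_poly_iter:
  assumes z: "0 \<le> z" "z \<le> 5/4"
  shows "proots (map_poly complex_of_real (poly_iter gasket_poly n - [:z:])) =
    mset_set ((\<lambda>w. complex_of_real (branches w z)) ` bwords n)"
proof -
  let ?p = "poly_iter gasket_poly n - [:z:]"
  let ?q = "map_poly complex_of_real ?p"
  let ?A = "(\<lambda>w. complex_of_real (branches w z)) ` bwords n"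
  have dp: "degree ?q \<le> 2 ^ n"
    using degree_diff_le[of "poly_iter gasket_poly n" "2 ^ n" "[:z:]"] degree_poly_iter
    by (subst degree_map_poly) auto
  have "?p \<noteq> 0"
  proof
    assume p0: "?p = 0"
    have "(decimation ^^ n) x - z = 0" for x using arg_cong[OF p0, of "\<lambda>p. poly p x"] by (simp add: poly_poly_iter)
    then have "(decimation ^^ n) 0 = z" "(decimation ^^ n) (-1) = z" by auto
    then show False using decimation_iterate_0[of n] decimation_iterate_neg[of "-1" n] by auto
  qed
  then have q0: "?q \<noteq> 0" by (simp add: map_poly_eq_0_iff)
  have inj: "inj_on (\<lambda>w. complex_of_real (branches w z)) (bwords n)"
    using branches_inj[OF z] by (auto intro!: inj_onI simp: bwords_def)
  have card: "card ?A = 2 ^ n" using card_image[OF inj] by (simp add: card_bwords)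
  have "mset_set ?A \<subseteq># proots ?q"
  proof (rule mset_subset_eqI)
    fix a
    show "count (mset_set ?A) a \<le> count (proots ?q) a"
    proof (cases "a \<in> ?A")
      case True
      then obtain w where w: "length w = n" "a = complex_of_real (branches w z)" by (auto simp: bwords_def)
      then have "poly ?q a = 0"
        using decimation_branches[OF z, of w] by (simp only: w poly_map_of_real) (simp add: poly_poly_iter)
      then have "order a ?q \<noteq> 0" using q0 by (simp add: order_root)
      then show ?thesis using True q0 by simp
    qed simp
  qed
  moreover have "size (proots ?q) \<le> size (mset_set ?A)" using dp card size_proots_le[of ?q] by simp
  ultimately show ?thesis by (metis mset_subset_size leD subset_mset.le_imp_less_or_eq)
qed

lemma poly_zeta_approx_eq:
  assumes z: "0 < z" "z \<le> 5/4"
  shows "poly_zeta_approx gasket_poly z s n = transfer n (\<lambda>y. zeta_term (5 ^ n * y) s) z"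
proof -
  have inj: "inj_on (\<lambda>w. complex_of_real (branches w z)) (bwords n)"
    using branches_inj[of z] z by (auto intro!: inj_onI simp: bwords_def)
  have "poly_zeta_approx gasket_poly z s n =
     (\<Sum>a\<in>(\<lambda>w. complex_of_real (branches w z)) ` bwords n. (complex_of_real (5 ^ n) * a) powr (- s / 2))"
    unfolding poly_zeta_approx_def using z
    by (subst proots_poly_iter) (auto simp: pderiv_gasket_poly sum_unfold_sum_mset)
  also have "\<dots> = (\<Sum>w\<in>bwords n. zeta_term (5 ^ n * branches w z) s)"
    by (simp add: sum.reindex[OF inj] zeta_term_def)
  finally show ?thesis by (simp add: transfer_def)
qed

abbreviation zeta_base :: "complex \<Rightarrow> complex" where
  "zeta_base \<equiv> zeta_term 5"

text \<open>Words are sorted by the large branch that is applied last: \<open>k\<close> letters are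
  applied before it and only small branches after it. The remaining summand is the word without a
  large branch. The parameter \<open>j\<close> counts small steps already split off and is needed
  for the induction.\<close>

lemma transfer_zeta_split:
  assumes z: "0 < z" "z \<le> 5/4"
  shows "transfer n (\<lambda>y. zeta_term (5 ^ (n + j) * small_iter j y) s) z =
    zeta_term (5 ^ (n + j) * small_iter (n + j) z) s +
    (\<Sum>k<n. zeta_base s ^ (k + 1) * transfer k (koenigs_approx (n + j - 1 - k) s) z)"
proof (induction n arbitrary: j)
  case (Suc n)
  have pos: "0 < branches w z" "branches w z \<le> 5/4" for w using branches_pos[OF z] branches_range[of z w] z by auto
  have "transfer (Suc n) (\<lambda>y. zeta_term (5 ^ (Suc n + j) * small_iter j y) s) z =
     transfer n (\<lambda>y. zeta_term (5 ^ (n + Suc j) * small_iter (Suc j) y) s) z +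
     transfer n (\<lambda>y. zeta_term (5 ^ (Suc n + j) * small_iter j (branch True y)) s) z"
    unfolding transfer_Suc unfolding transfer_def sum.distrib by (simp add: funpow_swap1)
  also have "transfer n (\<lambda>y. zeta_term (5 ^ (Suc n + j) * small_iter j (branch True y)) s) z =
      zeta_base s ^ (n + 1) * transfer n (koenigs_approx j s) z"
    unfolding transfer_def sum_distrib_left
  proof (intro sum.cong refl)
    fix w
    have b: "0 < branch True (branches w z)" "branch True (branches w z) \<le> 5/4"
      using branch_pos pos branch_range(2) by (auto simp: less_imp_le)
    have "zeta_term (5 ^ (Suc n + j) * small_iter j (branch True (branches w z))) s =
       zeta_term (5 ^ (n + 1) * (5 ^ j * small_iter j (branch True (branches w z)))) s"
      by (simp add: power_add mult_ac)
    also have "\<dots> = zeta_base s ^ (n + 1) * koenigs_approx j s (branches w z)"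
      using small_iter_pos[OF b] by (subst zeta_term_mult) (auto simp: zeta_term_power koenigs_approx_def simp del: power_Suc)
    finally show "zeta_term (5 ^ (Suc n + j) * small_iter j (branch True (branches w z))) s =
       zeta_base s ^ (n + 1) * koenigs_approx j s (branches w z)" .
  qed
  finally show ?case unfolding Suc by (simp add: algebra_simps)
qed simp

definition poly_zeta_series :: "real \<Rightarrow> complex \<Rightarrow> nat \<Rightarrow> complex" where
  "poly_zeta_series z s k = zeta_base s ^ (k + 1) * transfer k (koenigs_power s) z"

lemma norm_zeta_base: "norm (zeta_base s) = 5 powr (- Re s / 2)"
  by (simp add: norm_zeta_term)

lemma norm_zeta_base_less:
  assumes "ln 4 / ln 5 < Re s" shows "2 * norm (zeta_base s) < 1"
proof -
  have "ln 4 < Re s * ln 5" using assms by (simp add: divide_less_eq)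
  then have "ln 2 < Re s / 2 * ln 5" using ln_realpow[of 2 2] by simp
  then have "exp (- Re s / 2 * ln 5) < exp (- ln 2)" by (subst exp_less_cancel_iff) simp
  then show ?thesis by (simp add: norm_zeta_base powr_def exp_minus)
qed

lemma zeta_term_norm_le:
  assumes "5/8 \<le> x" "0 \<le> Re s" shows "norm (zeta_term x s) \<le> (5/8) powr (- Re s / 2)"
  using assms by (subst norm_zeta_term) (auto intro!: powr_mono2')

text \<open>Tannery's theorem: the \<open>k\<close>-th term has \<open>2 ^ k\<close> summands and a
  factor \<open>zeta_base s ^ (k + 1)\<close>, so a geometric series with ratio
  \<open>2 * norm (zeta_base s)\<close> dominates, uniformly in the length of the words.\<close>

lemma poly_zeta_LIMSEQ:
  assumes z: "0 < z" "z \<le> 5/4" and s: "ln 4 / ln 5 < Re s"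
  shows "poly_zeta_approx gasket_poly z s \<longlonglongrightarrow> zeta_term (koenigs z) s + (\<Sum>k. poly_zeta_series z s k)"
    "summable (\<lambda>k. norm (poly_zeta_series z s k))"
proof -
  have s0: "0 \<le> Re s" using s by (smt (verit) ln_ge_zero divide_nonneg_nonneg)
  define q where "q = 2 * norm (zeta_base s)"
  have q: "0 \<le> q" "q < 1" using norm_zeta_base_less[OF s] by (auto simp: q_def)
  let ?B = "(5/8) powr (- Re s / 2) * norm (zeta_base s)"
  have kb: "norm (koenigs_approx j s y) \<le> (5/8) powr (- Re s / 2)" if "0 \<le> y" "y \<le> 5/4" for j y
    unfolding koenigs_approx_def
  proof (rule zeta_term_norm_le[OF _ s0])
    show "5/8 \<le> 5 ^ j * small_iter j (branch True y)"
      using small_iter_scaled_bounds(3)[of "branch True y" j] branch_range[OF that] by (auto intro: order_trans)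
  qed
  define a where "a k n = (if k < n then zeta_base s ^ (k + 1) * transfer k (koenigs_approx (n - 1 - k) s) z else 0)" for k n
  have ab: "norm (a k n) \<le> ?B * q ^ k" for k n
  proof (cases "k < n")
    case True
    have "norm (a k n) = norm (zeta_base s) ^ (k + 1) * norm (transfer k (koenigs_approx (n - 1 - k) s) z)"
      using True by (simp add: a_def norm_mult norm_power)
    also have "\<dots> \<le> norm (zeta_base s) ^ (k + 1) * (2 ^ k * (5/8) powr (- Re s / 2))"
      using z by (intro mult_left_mono norm_transfer_le kb) auto
    also have "\<dots> = ?B * q ^ k" by (simp add: q_def power_mult_distrib)
    finally show ?thesis .
  qed (use q in \<open>simp add: a_def\<close>)
  have lim: "(\<lambda>n. a k n) \<longlonglongrightarrow> poly_zeta_series z s k" for k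
  proof (rule LIMSEQ_offset[of _ "k + 1"])
    have "a k (n + (k + 1)) = zeta_base s ^ (k + 1) * transfer k (koenigs_approx n s) z" for n
      by (simp add: a_def)
    then show "(\<lambda>n. a k (n + (k + 1))) \<longlonglongrightarrow> poly_zeta_series z s k"
      unfolding poly_zeta_series_def using z by (simp only:) (intro tendsto_intros transfer_koenigs_LIMSEQ; simp)
  qed
  have sq: "summable (\<lambda>k. ?B * q ^ k)" using q by (intro summable_mult summable_geometric) auto
  have ev: "\<forall>\<^sub>F (k, n) in sequentially \<times>\<^sub>F sequentially. norm (a k n) \<le> ?B * q ^ k"
    by (intro always_eventually) (use ab in auto)
  have T: "summable (\<lambda>k. norm (poly_zeta_series z s k))"
    "(\<lambda>n. \<Sum>k. a k n) \<longlonglongrightarrow> (\<Sum>k. poly_zeta_series z s k)"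
    using tannerys_theorem[OF lim ev sq sequentially_bot] by auto
  show "summable (\<lambda>k. norm (poly_zeta_series z s k))" by (rule T)
  have sum_a: "(\<Sum>k. a k n) = (\<Sum>k<n. zeta_base s ^ (k + 1) * transfer k (koenigs_approx (n - 1 - k) s) z)" for n
    by (subst suminf_finite[of "{..<n}"]) (auto simp: a_def)
  have eq: "poly_zeta_approx gasket_poly z s n = zeta_term (5 ^ n * small_iter n z) s + (\<Sum>k. a k n)" for n
    using transfer_zeta_split[OF z, of n 0 s] by (simp add: poly_zeta_approx_eq[OF z] sum_a)
  have "(\<lambda>n. zeta_term (5 ^ n * small_iter n z) s) \<longlonglongrightarrow> zeta_term (koenigs z) s"
    using z koenigs_bounds(1)[of z] small_iter_pos[of z] by (intro zeta_term_tendsto koenigs_LIMSEQ) auto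
  from tendsto_add[OF this T(2)]
  show "poly_zeta_approx gasket_poly z s \<longlonglongrightarrow> zeta_term (koenigs z) s + (\<Sum>k. poly_zeta_series z s k)"
    unfolding eq[symmetric] .
qed

lemma poly_zeta_eq:
  assumes z: "0 < z" "z \<le> 5/4" and s: "ln 4 / ln 5 < Re s"
  shows "poly_zeta gasket_poly z s = zeta_term (koenigs z) s + (\<Sum>k. poly_zeta_series z s k)"
  unfolding poly_zeta_def by (rule limI[OF poly_zeta_LIMSEQ(1)[OF assms]])

section \<open>Analytic continuation\<close>

lemma holomorphic_suminf:
  fixes f :: "nat \<Rightarrow> complex \<Rightarrow> complex"
  assumes "open S" and hol: "\<And>k. f k holomorphic_on S"
    and bound: "\<And>k s. s \<in> S \<Longrightarrow> norm (f k s) \<le> C * exp (c * norm s) * q ^ k"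
    and q: "0 \<le> q" "q < 1" and c: "0 \<le> c" "0 \<le> C"
  shows "(\<lambda>s. \<Sum>k. f k s) holomorphic_on S"
proof (rule holomorphic_uniform_sequence[OF assms(1)])
  show "(\<lambda>s. \<Sum>k<n. f k s) holomorphic_on S" for n by (intro holomorphic_intros hol)
  fix x assume x: "x \<in> S"
  obtain d where d: "0 < d" "cball x d \<subseteq> S" using assms(1) x open_contains_cball by blast
  have "uniform_limit (cball x d) (\<lambda>n s. \<Sum>k<n. f k s) (\<lambda>s. \<Sum>k. f k s) sequentially"
  proof (rule Weierstrass_m_test)
    fix k s assume s: "s \<in> cball x d"
    have "norm s \<le> norm x + d"
      using s norm_triangle_ineq2[of s x] by (simp add: dist_norm norm_minus_commute)
    then have "C * exp (c * norm s) * q ^ k \<le> C * exp (c * (norm x + d)) * q ^ k"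
      using c q by (intro mult_right_mono mult_left_mono) (auto intro!: mult_left_mono)
    moreover have "s \<in> S" using s d by blast
    ultimately show "norm (f k s) \<le> C * exp (c * (norm x + d)) * q ^ k"
      using bound order_trans by blast
  next
    show "summable (\<lambda>k. C * exp (c * (norm x + d)) * q ^ k)"
      using q by (intro summable_mult summable_geometric) auto
  qed
  then show "\<exists>d>0. cball x d \<subseteq> S \<and> uniform_limit (cball x d) (\<lambda>n s. \<Sum>k<n. f k s) (\<lambda>s. \<Sum>k. f k s) sequentially"
    using d by blast
qed

definition zeta_diff_term :: "complex \<Rightarrow> nat \<Rightarrow> complex" where
  "zeta_diff_term s k = zeta_base s ^ (k + 1) * (transfer k (koenigs_power s) (3/4) - transfer k (koenigs_power s) (5/4))"

text \<open>One application of the operator minus its leading eigenvalue 2. Evaluated at 5/4 this is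
  a sum of two differences of values of the same function, to which \<open>koenigs_power_osc\<close>
  applies.\<close>

definition zeta_step_term :: "complex \<Rightarrow> nat \<Rightarrow> complex" where
  "zeta_step_term s k = zeta_base s ^ (k + 1) * (transfer (Suc k) (koenigs_power s) (5/4) - 2 * transfer k (koenigs_power s) (5/4))"

lemma norm_zeta_base_strip:
  assumes "- 1 < Re s" shows "norm (zeta_base s) \<le> sqrt 5"
proof -
  have "5 powr (- Re s / 2) \<le> 5 powr (1/2)" using assms by (intro powr_mono) auto
  then show ?thesis by (simp add: norm_zeta_base powr_half_sqrt)
qed

lemma zeta_power_bound:
  assumes "- 1 < Re s" "norm t \<le> C * exp (4 * norm s) * (2/5) ^ k" "0 \<le> C"
  shows "norm (zeta_base s ^ (k + 1) * t) \<le> (C * sqrt 5) * exp (4 * norm s) * (2/5 * sqrt 5) ^ k"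
proof -
  have "norm (zeta_base s ^ (k + 1) * t) = norm (zeta_base s) ^ (k + 1) * norm t" by (simp add: norm_mult norm_power)
  also have "\<dots> \<le> sqrt 5 ^ (k + 1) * (C * exp (4 * norm s) * (2/5) ^ k)"
    using assms norm_zeta_base_strip[OF assms(1)] by (intro mult_mono power_mono) auto
  also have "\<dots> = (C * sqrt 5) * exp (4 * norm s) * (2/5 * sqrt 5) ^ k"
    by (simp only: power_mult_distrib power_add power_one_right mult_ac)
  finally show ?thesis .
qed

lemma zeta_diff_bound:
  assumes "- 1 < Re s"
  shows "norm (zeta_diff_term s k) \<le> (73 * sqrt 5) * exp (4 * norm s) * (2/5 * sqrt 5) ^ k"
  unfolding zeta_diff_term_def by (rule zeta_power_bound[OF assms koenigs_power_osc]) auto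

lemma zeta_step_bound:
  assumes "- 1 < Re s"
  shows "norm (zeta_step_term s k) \<le> (146 * sqrt 5) * exp (4 * norm s) * (2/5 * sqrt 5) ^ k"
  unfolding zeta_step_term_def
proof (rule zeta_power_bound[OF assms])
  let ?T = "\<lambda>x. transfer k (koenigs_power s) x"
  have "transfer (Suc k) (koenigs_power s) (5/4) - 2 * ?T (5/4) =
     (?T (branch False (5/4)) - ?T (5/4)) + (?T (branch True (5/4)) - ?T (5/4))"
    by (simp add: transfer_Suc')
  also have "norm \<dots> \<le> 73 * exp (4 * norm s) * (2/5) ^ k + 73 * exp (4 * norm s) * (2/5) ^ k"
    by (intro norm_triangle_le add_mono koenigs_power_osc branch_range) auto
  finally show "norm (transfer (Suc k) (koenigs_power s) (5/4) - 2 * ?T (5/4)) \<le> 146 * exp (4 * norm s) * (2/5) ^ k"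
    by simp
qed auto

lemma continuation_ratio: "0 \<le> 2/5 * sqrt (5 :: real)" "2/5 * sqrt (5 :: real) < 1"
proof -
  have "sqrt 5 < (5/2 :: real)" by (rule real_less_lsqrt) (auto simp: power2_eq_square)
  then show "2/5 * sqrt (5 :: real) < 1" by simp
qed simp

lemma open_halfplane: "open {s. - 1 < Re s}"
  by (rule open_halfspace_Re_gt)

lemma zeta_base_holomorphic: "zeta_base holomorphic_on A"
  by (rule zeta_term_holomorphic) simp

lemma zeta_diff_holomorphic: "(\<lambda>s. \<Sum>k. zeta_diff_term s k) holomorphic_on {s. - 1 < Re s}"
proof (rule holomorphic_suminf[OF open_halfplane _ _ continuation_ratio])
  show "(\<lambda>s. zeta_diff_term s k) holomorphic_on {s. - 1 < Re s}" for k
    unfolding zeta_diff_term_def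
    by (intro holomorphic_intros zeta_base_holomorphic transfer_koenigs_holomorphic) auto
  show "norm (zeta_diff_term s k) \<le> (73 * sqrt 5) * exp (4 * norm s) * (2/5 * sqrt 5) ^ k"
    if "s \<in> {s. - 1 < Re s}" for k s using that zeta_diff_bound by simp
qed auto

lemma zeta_step_holomorphic: "(\<lambda>s. \<Sum>k. zeta_step_term s k) holomorphic_on {s. - 1 < Re s}"
proof (rule holomorphic_suminf[OF open_halfplane _ _ continuation_ratio])
  show "(\<lambda>s. zeta_step_term s k) holomorphic_on {s. - 1 < Re s}" for k
    unfolding zeta_step_term_def
    by (intro holomorphic_intros zeta_base_holomorphic transfer_koenigs_holomorphic) auto
  show "norm (zeta_step_term s k) \<le> (146 * sqrt 5) * exp (4 * norm s) * (2/5 * sqrt 5) ^ k"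
    if "s \<in> {s. - 1 < Re s}" for k s using that zeta_step_bound by simp
qed auto

definition zeta_diff :: "complex \<Rightarrow> complex" where
  "zeta_diff s = zeta_term (koenigs (3/4)) s - zeta_term (koenigs (5/4)) s + (\<Sum>k. zeta_diff_term s k)"

text \<open>The zeta function for \<open>5/4\<close> with its pole at \<open>1 = 2 * 5 powr (- s / 2)\<close> removed.\<close>

definition zeta_regular :: "complex \<Rightarrow> complex" where
  "zeta_regular s = (1 - 2 * zeta_base s) * zeta_term (koenigs (5/4)) s
     + zeta_base s * (koenigs_power s (5/4) + (\<Sum>k. zeta_step_term s k))"

lemma koenigs_pos: "0 < x \<Longrightarrow> x \<le> 5/4 \<Longrightarrow> 0 < koenigs x"
  using koenigs_bounds(1)[of x] by simp

lemma zeta_diff_regular_holomorphic: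
  "zeta_diff holomorphic_on {s. - 1 < Re s}" "zeta_regular holomorphic_on {s. - 1 < Re s}"
  unfolding zeta_diff_def zeta_regular_def koenigs_power_def
  by (intro holomorphic_intros zeta_diff_holomorphic zeta_step_holomorphic zeta_base_holomorphic koenigs_pos
      koenigs_branch_bounds; simp)+

lemma poly_zeta_diff:
  assumes s: "ln 4 / ln 5 < Re s"
  shows "poly_zeta gasket_poly (3/4) s = poly_zeta gasket_poly (5/4) s + zeta_diff s"
proof -
  have "summable (poly_zeta_series (3/4) s)" "summable (poly_zeta_series (5/4) s)"
    using poly_zeta_LIMSEQ(2)[OF _ _ s, of "3/4"] poly_zeta_LIMSEQ(2)[OF _ _ s, of "5/4"] summable_norm_cancel by auto
  then have "(\<Sum>k. poly_zeta_series (3/4) s k) - (\<Sum>k. poly_zeta_series (5/4) s k) = (\<Sum>k. zeta_diff_term s k)"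
    by (subst suminf_diff) (simp_all add: poly_zeta_series_def zeta_diff_term_def[abs_def] right_diff_distrib)
  then show ?thesis
    using poly_zeta_eq[OF _ _ s, of "3/4"] poly_zeta_eq[OF _ _ s, of "5/4"] by (simp add: zeta_diff_def algebra_simps)
qed

text \<open>An index shift: with \<open>t = zeta_base s\<close>, each term of the series is
  \<open>2 * t\<close> times its predecessor plus \<open>t\<close> times a step term. Solving for
  the sum produces the factor \<open>1 - 2 * t\<close>.\<close>

lemma poly_zeta_regular:
  assumes s: "ln 4 / ln 5 < Re s"
  shows "(1 - 2 * zeta_base s) * poly_zeta gasket_poly (5/4) s = zeta_regular s"
proof -
  let ?t = "zeta_base s" and ?T = "\<lambda>k. transfer k (koenigs_power s) (5/4)"
  have s1: "- 1 < Re s" using s by (smt (verit) ln_ge_zero divide_nonneg_nonneg)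
  have sm: "summable (poly_zeta_series (5/4) s)"
    using poly_zeta_LIMSEQ(2)[OF _ _ s, of "5/4"] summable_norm_cancel by auto
  let ?a = "poly_zeta_series (5/4) s"
  have sst: "summable (zeta_step_term s)"
  proof (rule summable_comparison_test')
    show "summable (\<lambda>k. (146 * sqrt 5) * exp (4 * norm s) * (2/5 * sqrt 5) ^ k)"
      using continuation_ratio by (intro summable_mult summable_geometric) auto
  qed (use zeta_step_bound[OF s1] in auto)
  have "(\<Sum>k. ?a k) = ?a 0 + (\<Sum>k. ?a (Suc k))" using suminf_split_head[OF sm] by simp
  moreover have "(\<Sum>k. ?a (Suc k)) = (\<Sum>k. 2 * ?t * ?a k + ?t * zeta_step_term s k)"
    by (simp add: poly_zeta_series_def zeta_step_term_def algebra_simps)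
  moreover have "\<dots> = 2 * ?t * (\<Sum>k. ?a k) + ?t * (\<Sum>k. zeta_step_term s k)"
    using sm sst by (simp add: suminf_add[symmetric] suminf_mult summable_mult)
  ultimately have "(1 - 2 * ?t) * (\<Sum>k. ?a k) = ?t * (koenigs_power s (5/4) + (\<Sum>k. zeta_step_term s k))"
    by (simp add: poly_zeta_series_def algebra_simps)
  then show ?thesis
    using poly_zeta_eq[OF _ _ s, of "5/4"] by (simp add: zeta_regular_def algebra_simps)
qed

section \<open>Eigenvalues and their multiplicities\<close>

text \<open>Words whose branch applied last is large. They represent branch words up to additional
  small steps at the end, which the scaled Koenigs value does not notice.\<close>

definition reduced :: "bool list set" where
  "reduced = {b. b = [] \<or> hd b}"

text \<open>The eigenvalue indexed by \<open>(z, i, b)\<close> is born on the level \<open>i + 1\<close> from the value \<open>z\<close> of the graph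
  Laplacian, and then continued along the branches in \<open>b\<close> (outermost first) and the small branch.\<close>

definition eigenvalue :: "real \<times> nat \<times> bool list \<Rightarrow> real" where
  "eigenvalue = (\<lambda>(z, i, b). 5 ^ (Suc i + length b) * koenigs (branches b z))"

definition born_mult :: "nat \<Rightarrow> real \<Rightarrow> nat" where
  "born_mult i z = (if z = 3/4 then (3 ^ i + 3) div 2 else (3 ^ i - 1) div 2)"

text \<open>For \<open>z = 5/4\<close> and \<open>i = 0\<close> the multiplicity is zero; such
  triples stay in the index set but contribute nothing.\<close>

definition spectrum_index :: "(real \<times> nat \<times> bool list) set" where
  "spectrum_index = {3/4, 5/4} \<times> UNIV \<times> reduced"

lemma pad_reduced: "\<exists>j b. w = replicate j False @ b \<and> b \<in> reduced"
proof (induction w)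
  case Nil
  show ?case by (intro exI[of _ 0] exI[of _ "[]"]) (simp add: reduced_def)
next
  case (Cons a w)
  then obtain j b where w: "w = replicate j False @ b" "b \<in> reduced" by blast
  show ?case
  proof (cases a)
    case True
    then show ?thesis by (intro exI[of _ 0] exI[of _ "a # w"]) (simp add: reduced_def)
  next
    case False
    then show ?thesis using w by (intro exI[of _ "Suc j"] exI[of _ b]) simp
  qed
qed

lemma pad_unique:
  assumes "replicate j False @ b = replicate j' False @ b'" "b \<in> reduced" "b' \<in> reduced"
  shows "b = b'"
proof -
  have "dropWhile Not (replicate j False @ b) = b" if "b \<in> reduced" for j b
    using that by (induction j) (cases b; auto simp: reduced_def)+
  then show ?thesis using assms by metis
qed

lemma seeds_range: "z \<in> {3/4, 5/4} \<Longrightarrow> 0 < z \<and> z \<le> (5/4 :: real)"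
  by auto

lemma seeds_decimation:
  assumes "z \<in> {3/4, 5/4}" "z' \<in> {3/4, 5/4}" shows "(decimation ^^ Suc k) z \<noteq> z'"
  using decimation_iterate_exceptional[of z k] assms by auto

lemma koenigs_pad:
  assumes "0 < z" "z \<le> 5/4"
  shows "5 ^ (j + length b) * koenigs (branches (replicate j False @ b) z) = 5 ^ length b * koenigs (branches b z)"
proof -
  have "0 \<le> branches b z" "branches b z \<le> 5/4" using branches_range[of z b] assms by auto
  from koenigs_small_iter[OF this, of j] show ?thesis
    by (simp add: branches_append small_iter_branches power_add mult_ac)
qed

lemma eigenvalue_pad:
  assumes "z \<in> {3/4, 5/4}" "Suc i + length b \<le> n"
  shows "5 ^ n * koenigs (branches (replicate (n - Suc i - length b) False @ b) z) = eigenvalue (z, i, b)"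
proof -
  define j where "j = n - Suc i - length b"
  have n: "n = Suc i + (j + length b)" using assms by (simp add: j_def)
  have "5 ^ n * koenigs (branches (replicate j False @ b) z) = 5 ^ Suc i * (5 ^ (j + length b) * koenigs (branches (replicate j False @ b) z))"
    unfolding n power_add by (simp only: mult.assoc)
  also have "\<dots> = 5 ^ Suc i * (5 ^ length b * koenigs (branches b z))"
    using seeds_range[OF assms(1)] by (subst koenigs_pad) auto
  finally show ?thesis by (simp add: eigenvalue_def power_add j_def)
qed

text \<open>Both eigenvalues are expressed on a common level \<open>n\<close> by padding the words
  with small branches. Injectivity of \<open>koenigs\<close> gives one graph eigenvalue; its forward
  orbit meets the set of 3/4 and 5/4 at most once, which fixes the level of birth, then the seed and
  the word.\<close>

lemma eigenvalue_inj: "inj_on eigenvalue spectrum_index"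
proof (rule inj_onI)
  fix p p' assume p: "p \<in> spectrum_index" "p' \<in> spectrum_index" and e: "eigenvalue p = eigenvalue p'"
  obtain z i b z' i' b' where pp: "p = (z, i, b)" "p' = (z', i', b')" by (metis prod_cases3)
  have z: "z \<in> {3/4, 5/4}" "z' \<in> {3/4, 5/4}" and b: "b \<in> reduced" "b' \<in> reduced"
    using p by (auto simp: pp spectrum_index_def)
  define n where "n = Suc i + length b + (Suc i' + length b')"
  define w where "w = replicate (n - Suc i - length b) False @ b"
  define w' where "w' = replicate (n - Suc i' - length b') False @ b'"
  have len: "length w = n - Suc i" "length w' = n - Suc i'" by (auto simp: w_def w'_def n_def)
  have "5 ^ n * koenigs (branches w z) = 5 ^ n * koenigs (branches w' z')"
    unfolding w_def w'_def using eigenvalue_pad[OF z(1), of i b n] eigenvalue_pad[OF z(2), of i' b' n] e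
    by (simp add: pp n_def)
  then have k: "koenigs (branches w z) = koenigs (branches w' z')" by simp
  have r: "0 < branches w z" "branches w z \<le> 5/4" "0 < branches w' z'" "branches w' z' \<le> 5/4"
    using seeds_range[OF z(1)] seeds_range[OF z(2)] branches_pos[of z w] branches_pos[of z' w']
      branches_range[of z w] branches_range[of z' w'] by simp_all
  have br: "branches w z = branches w' z'" by (rule koenigs_inj[OF r k])
  have d: "(decimation ^^ (n - Suc i)) (branches w z) = z" "(decimation ^^ (n - Suc i')) (branches w z) = z'"
    using decimation_branches[of z w] decimation_branches[of z' w'] seeds_range[OF z(1)] seeds_range[OF z(2)] len br
    by auto
  have aux: False if "k < l" "(decimation ^^ k) y = u" "(decimation ^^ l) y = u'" "u \<in> {3/4, 5/4}" "u' \<in> {3/4, 5/4}"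
    for k l y u u'
  proof -
    have "l = Suc (l - k - 1) + k" using that by simp
    then have "(decimation ^^ l) y = (decimation ^^ Suc (l - k - 1)) u" using that by (metis comp_apply funpow_add)
    then show False using seeds_decimation[OF that(4,5)] that(3) by metis
  qed
  have "n - Suc i = n - Suc i'"
    using aux[OF _ d z] aux[OF _ d(2) d(1) z(2,1)] by (meson linorder_neqE_nat)
  then have ii: "i = i'" by (simp add: n_def)
  then have zz: "z = z'" using d by simp
  have "w = w'" using branches_inj[of z w w'] seeds_range[OF z(1)] br zz len ii by simp
  then have "b = b'" unfolding w_def w'_def by (rule pad_unique[OF _ b])
  then show "p = p'" using pp ii zz by simp
qed

text \<open>This is where reducedness pays: an eigenvalue is at least a fixed multiple of 5 to the
  power of its level of birth plus the length of its word, which bounds the counting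
  function.\<close>

lemma koenigs_reduced_ge:
  assumes "z \<in> {3/4, 5/4}" "b \<in> reduced" shows "5/8 \<le> koenigs (branches b z)"
proof (cases b)
  case Nil
  then show ?thesis using koenigs_bounds(1)[of z] assms by auto
next
  case (Cons a u)
  then have "branches b z = branch True (branches u z)" using assms by (simp add: reduced_def)
  then show ?thesis
    using koenigs_branch_bounds(1) branches_range[of z u] seeds_range[OF assms(1)] by simp
qed

lemma eigenvalue_ge:
  assumes "p \<in> spectrum_index"
  shows "5/8 * 5 ^ (Suc (fst (snd p)) + length (snd (snd p))) \<le> eigenvalue p" "0 < eigenvalue p"
proof -
  obtain z i b where p: "p = (z, i, b)" by (metis prod_cases3)
  have "5/8 \<le> koenigs (branches b z)" using assms by (intro koenigs_reduced_ge) (auto simp: p spectrum_index_def)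
  then show ge: "5/8 * 5 ^ (Suc (fst (snd p)) + length (snd (snd p))) \<le> eigenvalue p"
    by (simp add: p eigenvalue_def)
  have "0 < 5/8 * (5 :: real) ^ (Suc (fst (snd p)) + length (snd (snd p)))" by simp
  then show "0 < eigenvalue p" using ge by linarith
qed

section \<open>Multiplicities of the eigenvalues on the gasket\<close>

context gasket_space
begin

lemma eigenspace_subspace: "fun_subspace (eigenspace v S \<mu> l)"
proof -
  have lf: "level_form n (\<lambda>x. f x + g x) h = level_form n f h + level_form n g h"
     "level_form n (\<lambda>x. c * f x) h = c * level_form n f h" for n f g h c
  proof -
    have "cell_form w (\<lambda>x. f x + g x) h = cell_form w f h + cell_form w g h"
      "cell_form w (\<lambda>x. c * f x) h = c * cell_form w f h" for w
      unfolding cell_form_def by (simp_all add: sum_3 algebra_simps)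
    then show "level_form n (\<lambda>x. f x + g x) h = level_form n f h + level_form n g h"
      "level_form n (\<lambda>x. c * f x) h = c * level_form n f h"
      by (simp_all add: level_form_def sum.distrib distrib_left sum_distrib_left[symmetric])
  qed
  have zero: "(\<lambda>_. 0) \<in> eigenspace v S \<mu> l"
  proof -
    have lev: "level_form n (\<lambda>_. 0) g = 0" for n g by (simp add: level_form_def cell_form_def)
    have dom: "(\<lambda>_. 0) \<in> energy_domain v S"
      by (auto simp: energy_domain_def energy_level_eq lev convergent_const)
    have "energy_form v (\<lambda>_. 0) g = 0" if "g \<in> energy_domain v S" for g
      using energy_form_LIMSEQ[OF dom that] by (simp add: lev LIMSEQ_const_iff)
    then show ?thesis unfolding eigenspace_iff using dom by simp
  qed
  have add: "(\<lambda>x. f x + g x) \<in> eigenspace v S \<mu> l" if f: "f \<in> eigenspace v S \<mu> l" and g: "g \<in> eigenspace v S \<mu> l" for f g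
  proof -
    have dom: "f \<in> energy_domain v S" "g \<in> energy_domain v S" using f g by (auto simp: eigenspace_iff)
    have s: "(\<lambda>x. f x + g x) \<in> energy_domain v S" by (rule energy_domain_add_diff(1)[OF dom])
    have "energy_form v (\<lambda>x. f x + g x) h = 6 * l * (LINT x|\<mu>. (f x + g x) * h x)" if h: "h \<in> energy_domain v S" for h
    proof -
      have c: "continuous_on S f" "continuous_on S g" "continuous_on S h" using dom h by (auto simp: energy_domain_def)
      have "(\<lambda>n. level_form n (\<lambda>x. f x + g x) h) \<longlonglongrightarrow> energy_form v f h + energy_form v g h"
        unfolding lf by (intro tendsto_add energy_form_LIMSEQ[OF dom(1) h] energy_form_LIMSEQ[OF dom(2) h])
      then have "energy_form v (\<lambda>x. f x + g x) h = energy_form v f h + energy_form v g h"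
        using energy_form_LIMSEQ[OF s h] LIMSEQ_unique by blast
      also have "\<dots> = 6 * l * (LINT x|\<mu>. f x * h x) + 6 * l * (LINT x|\<mu>. g x * h x)"
        using f g h by (simp add: eigenspace_iff)
      also have "\<dots> = 6 * l * (LINT x|\<mu>. f x * h x + g x * h x)"
        by (subst Bochner_Integration.integral_add)
          (auto intro!: continuous_integrable continuous_intros c simp: distrib_left)
      finally show ?thesis by (simp add: distrib_right)
    qed
    then show ?thesis using f g s by (simp add: eigenspace_iff)
  qed
  have scale: "(\<lambda>x. c * f x) \<in> eigenspace v S \<mu> l" if f: "f \<in> eigenspace v S \<mu> l" for f c
  proof -
    have dom: "f \<in> energy_domain v S" using f by (simp add: eigenspace_iff)
    have sym: "level_form n g h = level_form n h g" for n g h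
      by (simp add: level_form_def cell_form_def mult.commute)
    have "energy_level v n (\<lambda>x. c * f x) = c * (c * energy_level v n f)" for n
      unfolding energy_level_eq lf(2) sym[of n f "\<lambda>x. c * f x"] by simp
    moreover have "convergent (\<lambda>n. c * (c * energy_level v n f))"
      by (rule convergentI[of _ "c * (c * energy v f)"]) (intro tendsto_intros energy_LIMSEQ[OF dom])
    ultimately have s: "(\<lambda>x. c * f x) \<in> energy_domain v S"
      using dom by (auto simp: energy_domain_def intro!: continuous_intros)
    have "energy_form v (\<lambda>x. c * f x) h = 6 * l * (LINT x|\<mu>. (c * f x) * h x)" if h: "h \<in> energy_domain v S" for h
    proof -
      have "(\<lambda>n. level_form n (\<lambda>x. c * f x) h) \<longlonglongrightarrow> c * energy_form v f h"
        unfolding lf by (intro tendsto_mult_left energy_form_LIMSEQ[OF dom h])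
      then have "energy_form v (\<lambda>x. c * f x) h = c * energy_form v f h"
        using energy_form_LIMSEQ[OF s h] LIMSEQ_unique by blast
      then show ?thesis using f h by (simp add: eigenspace_iff mult.assoc)
    qed
    then show ?thesis using f s by (simp add: eigenspace_iff)
  qed
  show ?thesis unfolding fun_subspace_def using zero add scale by blast
qed

lemma eventually_small_scale:
  assumes "0 < l"
  shows "\<forall>\<^sub>F n in sequentially. l / 5 ^ n \<le> 1/8 \<and> 6 * l * (osc_const\<^sup>2 * (3/5) ^ n) < 1"
proof -
  have a: "(\<lambda>n. l * (1/5) ^ n) \<longlonglongrightarrow> 0" "(\<lambda>n. (6 * l * osc_const\<^sup>2) * (3/5) ^ n) \<longlonglongrightarrow> 0"
    by (intro tendsto_mult_right_zero LIMSEQ_power_zero; simp)+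
  have "\<forall>\<^sub>F n in sequentially. l * (1/5) ^ n < 1/8" by (rule order_tendstoD(2)[OF a(1)]) simp
  moreover have "\<forall>\<^sub>F n in sequentially. (6 * l * osc_const\<^sup>2) * (3/5) ^ n < 1"
    by (rule order_tendstoD(2)[OF a(2)]) simp
  ultimately show ?thesis by eventually_elim (simp add: power_divide mult_ac)
qed

text \<open>The small-branch orbit of \<open>x\<close>, started on level \<open>n\<close>, rescales
  to \<open>l\<close>, so the restriction theorem identifies the eigenspace with a graph eigenspace
  on a single level.\<close>

lemma eigen_mult_level:
  assumes l: "0 < l" and n: "6 * l * (osc_const\<^sup>2 * (3/5) ^ n) < 1"
    and x: "0 < x" "x \<le> 1/8" "koenigs x = l / 5 ^ n"
  shows "eigen_mult v S \<mu> l = fun_dim (graph_eigenspace n x)"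
proof -
  have "(\<lambda>m. 5 ^ m * small_iter (m - n) x) \<longlonglongrightarrow> l"
    using decimation_seq_limit[of x n] x by simp
  from eigenspace_restriction[OF decimation_seq_small_iter this _ n] x l
  have "bij_betw (restr n) (eigenspace v S \<mu> l) (graph_eigenspace n x)" by simp
  then show ?thesis
    unfolding eigen_mult_def using fun_dim_bij[OF restr_linear eigenspace_subspace] by blast
qed

lemma eigen_mult_eigenvalue:
  assumes "(z, i, b) \<in> spectrum_index"
  shows "eigen_mult v S \<mu> (eigenvalue (z, i, b)) = born_mult i z"
proof -
  let ?l = "eigenvalue (z, i, b)"
  have l: "0 < ?l" by (rule eigenvalue_ge(2)[OF assms])
  have z: "z \<in> {3/4, 5/4}" "0 < z" "z \<le> 5/4" using assms by (auto simp: spectrum_index_def)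
  have "\<forall>\<^sub>F n in sequentially. Suc i + length b \<le> n \<and> ?l / 5 ^ n \<le> 1/8 \<and> 6 * ?l * (osc_const\<^sup>2 * (3/5) ^ n) < 1"
    using eventually_small_scale[OF l] eventually_ge_at_top[of "Suc i + length b"] by eventually_elim simp
  then obtain n where n: "Suc i + length b \<le> n" "?l / 5 ^ n \<le> 1/8" "6 * ?l * (osc_const\<^sup>2 * (3/5) ^ n) < 1"
    by (auto simp: eventually_sequentially)
  obtain x where x: "0 < x" "x \<le> 1/8" "koenigs x = ?l / 5 ^ n"
    using koenigs_surj[of "?l / 5 ^ n"] l n by auto
  define w where "w = replicate (n - Suc i - length b) False @ b"
  have len: "length w = n - Suc i" using n by (simp add: w_def)
  have "koenigs (branches w z) = ?l / 5 ^ n"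
    using eigenvalue_pad[OF z(1) n(1)] by (simp add: w_def field_simps)
  then have xw: "x = branches w z"
    using koenigs_inj[of x "branches w z"] x branches_pos[OF z(2,3), of w] branches_range[of z w] z(2,3) by simp
  have "(decimation ^^ (n - Suc i)) x = z"
    using decimation_branches[of z w] z len xw by simp
  from dim_born[OF this z(1), of "Suc i"] n(1)
  have "fun_dim (graph_eigenspace n x) = fun_dim (graph_eigenspace (Suc i) z)" by simp
  also have "\<dots> = born_mult i z"
  proof -
    consider "z = 3/4" | "z = 5/4" using z(1) by blast
    then show ?thesis
    proof cases
      case 1
      show ?thesis unfolding 1 by (simp add: born_mult_def dim_three_fourths)
    next
      case 2
      show ?thesis unfolding 2 by (simp add: born_mult_def dim_five_fourths)
    qed
  qed
  finally show ?thesis using eigen_mult_level[OF l n(3) x] by simp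
qed

text \<open>If the forward orbit of the graph eigenvalue met 3/4 or 5/4 on a level from 1 to
  \<open>n\<close>, the inverse path, with its final small steps removed, would exhibit
  \<open>l\<close> as an indexed eigenvalue. Otherwise \<open>dim_unborn\<close> applies.\<close>

lemma eigen_mult_other:
  assumes "l \<noteq> 0" "l \<notin> eigenvalue ` spectrum_index"
  shows "eigen_mult v S \<mu> l = 0"
proof (cases "l < 0")
  case True
  show ?thesis unfolding eigen_mult_def eigenspace_negative[OF True] by (rule fun_dim_zero)
next
  case False
  then have l: "0 < l" using assms by simp
  then obtain n where n: "l / 5 ^ n \<le> 1/8" "6 * l * (osc_const\<^sup>2 * (3/5) ^ n) < 1"
    using eventually_small_scale[OF l] by (auto simp: eventually_sequentially)
  obtain x where x: "0 < x" "x \<le> 1/8" "koenigs x = l / 5 ^ n"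
    using koenigs_surj[of "l / 5 ^ n"] l n by auto
  have "fun_dim (graph_eigenspace n x) = 0"
  proof (rule dim_unborn)
    fix m assume m: "m \<in> {1..n}"
    show "(decimation ^^ (n - m)) x \<notin> {3/4, 5/4}"
    proof
      assume z: "(decimation ^^ (n - m)) x \<in> {3/4, 5/4}"
      define z where "z = (decimation ^^ (n - m)) x"
      obtain w where w: "length w = n - m" "x = branches w z" using decimation_preimage z_def by metis
      obtain j b where b: "w = replicate j False @ b" "b \<in> reduced" using pad_reduced by blast
      obtain i where i: "m = Suc i" using m by (cases m) auto
      have len: "Suc i + length b \<le> n" "j = n - Suc i - length b" using w b i m by auto
      have "l = 5 ^ n * koenigs (branches w z)" using x w by simp
      also have "\<dots> = eigenvalue (z, i, b)"
        using eigenvalue_pad[of z i b n] z len b by (simp add: z_def)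
      finally have "l \<in> eigenvalue ` spectrum_index"
        using z b by (auto simp: spectrum_index_def z_def)
      then show False using assms by simp
    qed
  qed (use x in auto)
  then show ?thesis using eigen_mult_level[OF l n(2) x] by simp
qed

lemma eigen_index_eq:
  "eigen_index v S \<mu> = (\<lambda>(p, k). (eigenvalue p, k)) ` (SIGMA p:spectrum_index. {..<born_mult (fst (snd p)) (fst p)})"
proof (intro equalityI subsetI)
  fix q assume "q \<in> eigen_index v S \<mu>"
  then obtain l k where q: "q = (l, k)" "l \<noteq> 0" "k < eigen_mult v S \<mu> l" by (auto simp: eigen_index_def)
  then have "l \<in> eigenvalue ` spectrum_index" using eigen_mult_other[of l] by fastforce
  then obtain p where p: "p \<in> spectrum_index" "l = eigenvalue p" by blast
  obtain z i b where zib: "p = (z, i, b)" by (metis prod_cases3)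
  have "k < born_mult i z" using q p zib eigen_mult_eigenvalue[of z i b] by simp
  then show "q \<in> (\<lambda>(p, k). (eigenvalue p, k)) ` (SIGMA p:spectrum_index. {..<born_mult (fst (snd p)) (fst p)})"
    using p q zib by force
next
  fix q assume "q \<in> (\<lambda>(p, k). (eigenvalue p, k)) ` (SIGMA p:spectrum_index. {..<born_mult (fst (snd p)) (fst p)})"
  then obtain z i b k where q: "(z, i, b) \<in> spectrum_index" "k < born_mult i z" "q = (eigenvalue (z, i, b), k)" by auto
  then show "q \<in> eigen_index v S \<mu>"
    using eigen_mult_eigenvalue[OF q(1)] eigenvalue_ge(2)[OF q(1)] by (simp add: eigen_index_def)
qed

lemma eigen_index_inj:
  "inj_on (\<lambda>(p, k). (eigenvalue p, k)) (SIGMA p:spectrum_index. {..<born_mult (fst (snd p)) (fst p)})"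
  using eigenvalue_inj by (auto intro!: inj_onI dest: inj_onD)

end

section \<open>Summation over the spectrum\<close>

text \<open>The sum of the norms is carried along, so that the result can serve as input for the
  next, outer summation.\<close>

lemma has_sum_Sigma_abs:
  fixes f :: "'a \<times> 'b \<Rightarrow> complex"
  assumes f: "\<And>x. x \<in> A \<Longrightarrow> ((\<lambda>y. f (x, y)) has_sum g x) (B x)"
    and n: "\<And>x. x \<in> A \<Longrightarrow> ((\<lambda>y. norm (f (x, y))) has_sum h x) (B x)"
    and g: "(g has_sum T) A" and h: "(h has_sum U) A"
  shows "(f has_sum T) (Sigma A B)" "((\<lambda>p. norm (f p)) has_sum U) (Sigma A B)"
proof -
  have "infsum (\<lambda>y. norm (f (x, y))) (B x) = h x" if "x \<in> A" for x using n[OF that] by (rule infsumI)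
  then have "(\<lambda>x. infsum (\<lambda>y. norm (f (x, y))) (B x)) summable_on A"
    using h by (subst summable_on_cong[of _ _ h]) (auto simp: summable_on_def)
  then have "(\<lambda>x. norm (infsum (\<lambda>y. norm (f (x, y))) (B x))) summable_on A"
    by (rule summable_on_cong[THEN iffD1, rotated]) (simp add: infsum_nonneg)
  moreover have "(\<lambda>y. norm (f (x, y))) summable_on B x" if "x \<in> A" for x
    using n[OF that] by (auto simp: summable_on_def)
  ultimately have abs: "(\<lambda>p. norm (f p)) summable_on Sigma A B"
    using Infinite_Sum.abs_summable_on_Sigma_iff[of f A B] by blast
  show "(f has_sum T) (Sigma A B)"
    by (rule has_sum_SigmaI[OF f g]) (use abs abs_summable_summable in auto)
  show "((\<lambda>p. norm (f p)) has_sum U) (Sigma A B)"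
    by (rule has_sum_SigmaI[OF n h]) (use abs in auto)
qed

lemma eigenvalue_zeta_term:
  assumes "z \<in> {3/4, 5/4}" "b \<in> reduced"
  shows "zeta_term (eigenvalue (z, i, b)) s = zeta_base s ^ Suc i * zeta_term (5 ^ length b * koenigs (branches b z)) s"
proof -
  have k: "0 < koenigs (branches b z)" using koenigs_reduced_ge[OF assms] by linarith
  have "eigenvalue (z, i, b) = 5 ^ Suc i * (5 ^ length b * koenigs (branches b z))"
    by (simp add: eigenvalue_def power_add)
  then show ?thesis
    using k by (simp only: zeta_term_mult zeta_term_power zero_less_power zero_less_numeral mult_pos_pos)
qed

definition reduced_of_length :: "nat \<Rightarrow> bool list set" where
  "reduced_of_length n = (case n of 0 \<Rightarrow> {[]} | Suc k \<Rightarrow> (#) True ` bwords k)"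

lemma reduced_of_length_simps [simp]:
  "reduced_of_length 0 = {[]}" "reduced_of_length (Suc k) = (#) True ` bwords k"
  by (simp_all add: reduced_of_length_def)

lemma reduced_of_length_eq: "reduced_of_length n = {b \<in> reduced. length b = n}"
  by (cases n) (auto simp: reduced_def bwords_def image_iff length_Suc_conv)

lemma reduced_eq: "reduced = snd ` (SIGMA n:UNIV. reduced_of_length n)"
  by (force simp: reduced_of_length_eq)

text \<open>Sorted by length, the reduced words reproduce term by term the series in
  \<open>poly_zeta_eq\<close>: the empty word gives the Koenigs term, length \<open>k + 1\<close>
  the \<open>k\<close>-th term of \<open>poly_zeta_series\<close>.\<close>

lemma reduced_zeta_sum:
  assumes z: "z \<in> {3/4, 5/4}" and s: "ln 4 / ln 5 < Re s"
  shows "((\<lambda>b. zeta_term (5 ^ length b * koenigs (branches b z)) s) has_sum poly_zeta gasket_poly z s) reduced"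
    "\<exists>U. ((\<lambda>b. norm (zeta_term (5 ^ length b * koenigs (branches b z)) s)) has_sum U) reduced"
proof -
  let ?f = "\<lambda>b. zeta_term (5 ^ length b * koenigs (branches b z)) s"
  have z': "0 < z" "z \<le> 5/4" using seeds_range[OF z] by auto
  have s0: "0 \<le> Re s" using s by (smt (verit) ln_ge_zero divide_nonneg_nonneg)
  define q where "q = 2 * norm (zeta_base s)"
  have q: "0 \<le> q" "q < 1" using norm_zeta_base_less[OF s] by (auto simp: q_def)
  have tm: "?f (True # w) = zeta_base s ^ Suc (length w) * koenigs_power s (branches w z)" for w
  proof -
    have "0 < koenigs (branch True (branches w z))"
      using branches_range[of z w] z' by (intro koenigs_branch_bounds(2)) auto
    then show ?thesis
      by (simp only: zeta_term_mult zeta_term_power zero_less_power zero_less_numeral koenigs_power_def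
          branches.simps list.size add_0_right add_0 Suc_eq_plus1)
  qed
  define g where "g n = (case n of 0 \<Rightarrow> zeta_term (koenigs z) s | Suc k \<Rightarrow> poly_zeta_series z s k)" for n
  define h where "h n = (\<Sum>b\<in>reduced_of_length n. norm (?f b))" for n
  have fin: "finite (reduced_of_length n)" for n by (cases n) auto
  have g: "(\<Sum>b\<in>reduced_of_length n. ?f b) = g n" for n
  proof (cases n)
    case (Suc k)
    have "(\<Sum>b\<in>(#) True ` bwords k. ?f b) = (\<Sum>w\<in>bwords k. ?f (True # w))"
      by (subst sum.reindex) auto
    also have "\<dots> = (\<Sum>w\<in>bwords k. zeta_base s ^ Suc k * koenigs_power s (branches w z))"
      unfolding tm by (intro sum.cong refl) (simp add: bwords_def)
    finally show ?thesis using Suc by (simp add: g_def poly_zeta_series_def transfer_def sum_distrib_left)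
  qed (simp add: g_def)
  have hb: "h (Suc k) \<le> (norm (zeta_base s) * (5/8) powr (- Re s / 2)) * q ^ k" for k
  proof -
    have "h (Suc k) = (\<Sum>w\<in>bwords k. norm (?f (True # w)))"
      unfolding h_def reduced_of_length_simps by (subst sum.reindex) auto
    also have "\<dots> \<le> (\<Sum>w\<in>bwords k. norm (zeta_base s) ^ Suc k * (5/8) powr (- Re s / 2))"
    proof (rule sum_mono)
      fix w assume w: "w \<in> bwords k"
      have "5/8 \<le> koenigs (branch True (branches w z))"
        using branches_range[of z w] z' by (intro koenigs_branch_bounds(1)) auto
      then have "norm (koenigs_power s (branches w z)) \<le> (5/8) powr (- Re s / 2)"
        unfolding koenigs_power_def by (rule zeta_term_norm_le[OF _ s0])
      then show "norm (?f (True # w)) \<le> norm (zeta_base s) ^ Suc k * (5/8) powr (- Re s / 2)"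
        unfolding tm using w by (simp add: norm_mult norm_power bwords_def mult_left_mono)
    qed
    also have "\<dots> = (norm (zeta_base s) * (5/8) powr (- Re s / 2)) * q ^ k"
      by (simp add: card_bwords q_def power_mult_distrib)
    finally show ?thesis .
  qed
  have h0: "0 \<le> h n" for n by (simp add: h_def sum_nonneg)
  have "summable (\<lambda>k. h (Suc k))"
  proof (rule summable_comparison_test')
    show "summable (\<lambda>k. (norm (zeta_base s) * (5/8) powr (- Re s / 2)) * q ^ k)"
      using q by (intro summable_mult summable_geometric) auto
  qed (use hb h0 in auto)
  then have hs: "summable h" by (simp add: summable_Suc_iff)
  then obtain U where U: "(h has_sum U) UNIV"
    using summable_on_UNIV_nonneg_real_iff[of h] h0 by (auto simp: summable_on_def)
  have gh: "norm (g n) \<le> h n" for n unfolding g[symmetric] h_def by (rule norm_sum)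
  have gs: "summable (\<lambda>n. norm (g n))"
    by (rule summable_comparison_test'[OF hs, of 0]) (simp add: gh)
  have "(\<lambda>k. g (Suc k)) sums (\<Sum>k. poly_zeta_series z s k)"
    using summable_norm_cancel[OF poly_zeta_LIMSEQ(2)[OF z' s]] by (simp add: g_def summable_sums)
  moreover have g0: "g 0 = zeta_term (koenigs z) s" by (simp add: g_def)
  ultimately have "g sums ((\<Sum>k. poly_zeta_series z s k) + zeta_term (koenigs z) s)"
    using sums_Suc[of g "\<Sum>k. poly_zeta_series z s k"] by (simp only:)
  then have "g sums poly_zeta gasket_poly z s"
    unfolding poly_zeta_eq[OF z' s] by (simp only: add.commute)
  then have G: "(g has_sum poly_zeta gasket_poly z s) UNIV" by (rule norm_summable_imp_has_sum[OF gs])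
  have inj: "inj_on snd (SIGMA n:UNIV. reduced_of_length n)" by (auto intro!: inj_onI simp: reduced_of_length_eq)
  have F: "((\<lambda>b. ?f (snd (n, b))) has_sum g n) (reduced_of_length n)" for n
    using has_sum_finite[OF fin, of ?f n] g by simp
  have H: "((\<lambda>b. norm (?f (snd (n, b)))) has_sum h n) (reduced_of_length n)" for n
    using has_sum_finite[OF fin, of "\<lambda>b. norm (?f b)" n] by (simp add: h_def)
  note sig = has_sum_Sigma_abs[where f = "\<lambda>p. ?f (snd p)" and A = UNIV and B = reduced_of_length, OF F H G U]
  show "(?f has_sum poly_zeta gasket_poly z s) reduced"
    unfolding reduced_eq has_sum_reindex[OF inj] o_def by (rule sig(1))
  have "((\<lambda>b. norm (?f b)) has_sum U) reduced"
    unfolding reduced_eq has_sum_reindex[OF inj] o_def by (rule sig(2))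
  then show "\<exists>U. ((\<lambda>b. norm (?f b)) has_sum U) reduced" by blast
qed

text \<open>The type is left open because the series are needed both for complex \<open>t\<close>
  and, for absolute convergence, for the real number \<open>norm t\<close>.\<close>

lemma born_mult_sums:
  fixes t :: "'a :: {real_normed_field, banach}"
  assumes "norm (3 * t) < 1"
  shows "(\<lambda>i. of_nat (born_mult i (3/4)) * t ^ Suc i) sums (t / 2 * (1 / (1 - 3 * t) + 3 / (1 - t)))"
    "(\<lambda>i. of_nat (born_mult i (5/4)) * t ^ Suc i) sums (t\<^sup>2 / 2 * (3 / (1 - 3 * t) - 1 / (1 - t)))"
proof -
  have t: "norm t < 1" using assms by (simp add: norm_mult)
  have "3 * t \<noteq> 1" "t \<noteq> 1" using assms t by (metis norm_one less_irrefl)+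
  then have nz: "1 - 3 * t \<noteq> 0" "1 - t \<noteq> 0" by simp_all
  have G: "(\<lambda>i. (3 * t) ^ i) sums (1 / (1 - 3 * t))" "(\<lambda>i. t ^ i) sums (1 / (1 - t))"
    by (rule geometric_sums[OF assms], rule geometric_sums[OF t])
  have m: "of_nat (born_mult i (3/4)) = (3 ^ i + 3 :: 'a) / 2" "of_nat (born_mult i (5/4)) = (3 ^ i - 1 :: 'a) / 2" for i
  proof -
    have "2 * born_mult i (3/4) = 3 ^ i + 3" by (simp add: born_mult_def)
    from arg_cong[OF this, of "of_nat :: nat \<Rightarrow> 'a"] show "of_nat (born_mult i (3/4)) = (3 ^ i + 3 :: 'a) / 2"
      by (simp add: field_simps)
    have "2 * born_mult i (5/4) + 1 = 3 ^ i" by (simp add: born_mult_def)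
    from arg_cong[OF this, of "of_nat :: nat \<Rightarrow> 'a"] show "of_nat (born_mult i (5/4)) = (3 ^ i - 1 :: 'a) / 2"
      by (simp add: field_simps)
  qed
  have s1: "(\<lambda>i. t / 2 * ((3 * t) ^ i + 3 * t ^ i)) sums (t / 2 * (1 / (1 - 3 * t) + 3 * (1 / (1 - t))))"
    by (intro sums_mult sums_add G)
  have e1: "t / 2 * ((3 * t) ^ i + 3 * t ^ i) = of_nat (born_mult i (3/4)) * t ^ Suc i" for i
    unfolding m by (simp add: power_mult_distrib field_simps)
  from s1[unfolded e1] show "(\<lambda>i. of_nat (born_mult i (3/4)) * t ^ Suc i) sums (t / 2 * (1 / (1 - 3 * t) + 3 / (1 - t)))" by simp
  have s2: "(\<lambda>i. t / 2 * ((3 * t) ^ i - t ^ i)) sums (t / 2 * (1 / (1 - 3 * t) - 1 / (1 - t)))"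
    by (intro sums_mult sums_diff G)
  have e2: "t / 2 * ((3 * t) ^ i - t ^ i) = of_nat (born_mult i (5/4)) * t ^ Suc i" for i
    unfolding m by (simp add: power_mult_distrib field_simps)
  \<comment> \<open>Both sides equal \<open>t\<^sup>2 / ((1 - 3 * t) * (1 - t))\<close>; the right
    one is the form required by the theorem.\<close>
  have e3: "t / 2 * (1 / (1 - 3 * t) - 1 / (1 - t)) = t\<^sup>2 / 2 * (3 / (1 - 3 * t) - 1 / (1 - t))"
    using nz by (simp add: field_simps power2_eq_square)
  from s2[unfolded e2 e3] show "(\<lambda>i. of_nat (born_mult i (5/4)) * t ^ Suc i) sums (t\<^sup>2 / 2 * (3 / (1 - 3 * t) - 1 / (1 - t)))" .
qed

lemma born_mult_has_sum:
  assumes "z \<in> {3/4, 5/4}" "norm (3 * t) < 1"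
  shows "((\<lambda>i. of_nat (born_mult i z) * t ^ Suc i :: complex) has_sum (\<Sum>i. of_nat (born_mult i z) * t ^ Suc i)) UNIV"
    "\<exists>U. ((\<lambda>i. real (born_mult i z) * norm t ^ Suc i) has_sum U) UNIV"
proof -
  have "norm (3 * norm t) < 1" using assms(2) by (simp add: norm_mult)
  then have s: "summable (\<lambda>i. real (born_mult i z) * norm t ^ Suc i)"
    using assms(1) sums_summable[OF born_mult_sums(1)[of "norm t"]] sums_summable[OF born_mult_sums(2)[of "norm t"]]
    by blast
  have n: "norm (of_nat (born_mult i z) * t ^ Suc i) = real (born_mult i z) * norm t ^ Suc i" for i
    by (simp add: norm_mult norm_power)
  then have s': "summable (\<lambda>i. norm (of_nat (born_mult i z) * t ^ Suc i))" using s by simp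
  show "((\<lambda>i. of_nat (born_mult i z) * t ^ Suc i :: complex) has_sum (\<Sum>i. of_nat (born_mult i z) * t ^ Suc i)) UNIV"
    by (rule norm_summable_imp_has_sum[OF s' summable_sums[OF summable_norm_cancel[OF s']]])
  show "\<exists>U. ((\<lambda>i. real (born_mult i z) * norm t ^ Suc i) has_sum U) UNIV"
    using s summable_on_UNIV_nonneg_real_iff[of "\<lambda>i. real (born_mult i z) * norm t ^ Suc i"]
    by (auto simp: summable_on_def)
qed

lemma norm_zeta_base_third:
  assumes "ln 9 / ln 5 < Re s" shows "norm (3 * zeta_base s) < 1"
proof -
  have "ln 9 < Re s * ln 5" using assms by (simp add: divide_less_eq)
  then have "ln 3 < Re s / 2 * ln 5" using ln_realpow[of 3 2] by simp
  then have "exp (- Re s / 2 * ln 5) < exp (- ln 3)" by (subst exp_less_cancel_iff) simp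
  then show ?thesis by (simp add: norm_mult norm_zeta_base powr_def exp_minus)
qed

lemma ln_4_9: "ln 4 / ln 5 < (1 :: real)" "1 < ln 9 / ln (5 :: real)" "ln 9 / ln (5 :: real) < 2" "0 < ln 4 / ln (5 :: real)"
proof -
  have "ln 9 < ln (5 ^ 2 :: real)" by simp
  then show "ln 9 / ln (5 :: real) < 2" unfolding ln_realpow by (simp add: divide_less_eq)
qed (simp_all add: divide_less_eq less_divide_eq)

text \<open>The weights of the two polynomial zeta functions are the generating functions of the
  multiplicities with which eigenvalues are born on the successive levels.\<close>

lemma spectrum_zeta_sum:
  assumes s: "ln 9 / ln 5 < Re s"
  defines "t \<equiv> zeta_base s"
  shows "((\<lambda>(p, k). zeta_term (eigenvalue p) s) has_sum
      poly_zeta gasket_poly (3/4) s * (t / 2 * (1 / (1 - 3 * t) + 3 / (1 - t))) +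
      poly_zeta gasket_poly (5/4) s * (t\<^sup>2 / 2 * (3 / (1 - 3 * t) - 1 / (1 - t))))
    (SIGMA p:spectrum_index. {..<born_mult (fst (snd p)) (fst p)})"
proof -
  have s4: "ln 4 / ln 5 < Re s" using s ln_4_9 by linarith
  have t3: "norm (3 * t) < 1" unfolding t_def by (rule norm_zeta_base_third[OF s])
  let ?r = "\<lambda>z b. zeta_term (5 ^ length b * koenigs (branches b z)) s"
  define M where "M z = (\<Sum>i. of_nat (born_mult i z) * t ^ Suc i)" for z
  define F where "F = (\<lambda>p. of_nat (born_mult (fst (snd p)) (fst p)) * zeta_term (eigenvalue p) s)"
  have tm: "zeta_term (eigenvalue (z, i, b)) s = t ^ Suc i * ?r z b" if "z \<in> {3/4, 5/4}" "b \<in> reduced" for z i b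
    unfolding t_def by (rule eigenvalue_zeta_term[OF that])
  have "(F has_sum (\<Sum>z\<in>{3/4, 5/4}. M z * poly_zeta gasket_poly z s)) spectrum_index \<and>
     (\<exists>U. ((\<lambda>p. norm (F p)) has_sum U) spectrum_index)"
  proof -
    have 1: "\<exists>U. ((\<lambda>q. F (z, q)) has_sum M z * poly_zeta gasket_poly z s) (UNIV \<times> reduced) \<and>
        ((\<lambda>q. norm (F (z, q))) has_sum U) (UNIV \<times> reduced)" if z: "z \<in> {3/4, 5/4}" for z
    proof -
      obtain U where U: "((\<lambda>b. norm (?r z b)) has_sum U) reduced" using reduced_zeta_sum(2)[OF z s4] by blast
      obtain V where V: "((\<lambda>i. real (born_mult i z) * norm t ^ Suc i) has_sum V) UNIV"
        using born_mult_has_sum(2)[OF z t3] by blast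
      have f: "((\<lambda>b. F (z, i, b)) has_sum (of_nat (born_mult i z) * t ^ Suc i) * poly_zeta gasket_poly z s) reduced" for i
      proof -
        have "((\<lambda>b. (of_nat (born_mult i z) * t ^ Suc i) * ?r z b) has_sum (of_nat (born_mult i z) * t ^ Suc i) * poly_zeta gasket_poly z s) reduced"
          by (intro has_sum_cmult_right reduced_zeta_sum(1)[OF z s4])
        then show ?thesis
          by (rule has_sum_cong[THEN iffD1, rotated]) (simp add: F_def tm[OF z] mult.assoc)
      qed
      have n: "((\<lambda>b. norm (F (z, i, b))) has_sum (real (born_mult i z) * norm t ^ Suc i) * U) reduced" for i
      proof -
        have "((\<lambda>b. (real (born_mult i z) * norm t ^ Suc i) * norm (?r z b)) has_sum (real (born_mult i z) * norm t ^ Suc i) * U) reduced"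
          by (intro has_sum_cmult_right U)
        then show ?thesis
          by (rule has_sum_cong[THEN iffD1, rotated]) (simp add: F_def tm[OF z] norm_mult norm_power mult.assoc)
      qed
      have g: "((\<lambda>i. (of_nat (born_mult i z) * t ^ Suc i) * poly_zeta gasket_poly z s) has_sum M z * poly_zeta gasket_poly z s) UNIV"
        unfolding M_def by (intro has_sum_cmult_left born_mult_has_sum(1)[OF z t3])
      have h: "((\<lambda>i. (real (born_mult i z) * norm t ^ Suc i) * U) has_sum V * U) UNIV"
        by (intro has_sum_cmult_left V)
      show ?thesis
        using has_sum_Sigma_abs[where f = "\<lambda>q. F (z, q)" and A = UNIV and B = "\<lambda>_. reduced", OF f n g h] by blast
    qed
    then obtain U where U: "\<And>z. z \<in> {3/4, 5/4} \<Longrightarrow> ((\<lambda>q. F (z, q)) has_sum M z * poly_zeta gasket_poly z s) (UNIV \<times> reduced)"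
      "\<And>z. z \<in> {3/4, 5/4} \<Longrightarrow> ((\<lambda>q. norm (F (z, q))) has_sum U z) (UNIV \<times> reduced)" by metis
    have fin: "((\<lambda>z. M z * poly_zeta gasket_poly z s) has_sum (\<Sum>z\<in>{3/4, 5/4}. M z * poly_zeta gasket_poly z s)) {3/4, 5/4}"
      "(U has_sum (\<Sum>z\<in>{3/4, 5/4}. U z)) {3/4, 5/4}" by (intro has_sum_finite; simp)+
    show ?thesis unfolding spectrum_index_def using has_sum_Sigma_abs[OF U fin] by blast
  qed
  then obtain U where F: "(F has_sum (\<Sum>z\<in>{3/4, 5/4}. M z * poly_zeta gasket_poly z s)) spectrum_index"
    "((\<lambda>p. norm (F p)) has_sum U) spectrum_index" by blast
  let ?f = "\<lambda>q :: (real \<times> nat \<times> bool list) \<times> nat. zeta_term (eigenvalue (fst q)) s"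
  have "((\<lambda>k. ?f (p, k)) has_sum F p) {..<born_mult (fst (snd p)) (fst p)}" for p
    using has_sum_finite[of "{..<born_mult (fst (snd p)) (fst p)}" "\<lambda>k. ?f (p, k)"] by (simp add: F_def)
  moreover have "((\<lambda>k. norm (?f (p, k))) has_sum norm (F p)) {..<born_mult (fst (snd p)) (fst p)}" for p
    using has_sum_finite[of "{..<born_mult (fst (snd p)) (fst p)}" "\<lambda>k. norm (?f (p, k))"] by (simp add: F_def norm_mult)
  ultimately have "(?f has_sum (\<Sum>z\<in>{3/4, 5/4}. M z * poly_zeta gasket_poly z s))
      (SIGMA p:spectrum_index. {..<born_mult (fst (snd p)) (fst p)})"
    by (intro has_sum_Sigma_abs(1)[OF _ _ F])
  moreover have "M (3/4) = t / 2 * (1 / (1 - 3 * t) + 3 / (1 - t))" "M (5/4) = t\<^sup>2 / 2 * (3 / (1 - 3 * t) - 1 / (1 - t))"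
    unfolding M_def using born_mult_sums[OF t3] by (auto simp: sums_iff)
  ultimately show ?thesis by (simp add: case_prod_unfold mult.commute)
qed

context gasket_space
begin

lemma spectral_zeta_eq:
  assumes s: "ln 9 / ln 5 < Re s"
  shows "eigen_term s summable_on eigen_index v S \<mu>"
    "spectral_zeta v S \<mu> s =
      poly_zeta gasket_poly (3/4) s * (zeta_base s / 2 * (1 / (1 - 3 * zeta_base s) + 3 / (1 - zeta_base s))) +
      poly_zeta gasket_poly (5/4) s * ((zeta_base s)\<^sup>2 / 2 * (3 / (1 - 3 * zeta_base s) - 1 / (1 - zeta_base s)))"
proof -
  have e: "eigen_term s \<circ> (\<lambda>(p, k). (eigenvalue p, k)) = (\<lambda>(p, k). zeta_term (eigenvalue p) s)"
    by (auto simp: eigen_term_def zeta_term_def)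
  have "(eigen_term s has_sum
      poly_zeta gasket_poly (3/4) s * (zeta_base s / 2 * (1 / (1 - 3 * zeta_base s) + 3 / (1 - zeta_base s))) +
      poly_zeta gasket_poly (5/4) s * ((zeta_base s)\<^sup>2 / 2 * (3 / (1 - 3 * zeta_base s) - 1 / (1 - zeta_base s))))
      (eigen_index v S \<mu>)"
    unfolding eigen_index_eq has_sum_reindex[OF eigen_index_inj] e by (rule spectrum_zeta_sum[OF s])
  then show "eigen_term s summable_on eigen_index v S \<mu>"
    "spectral_zeta v S \<mu> s =
      poly_zeta gasket_poly (3/4) s * (zeta_base s / 2 * (1 / (1 - 3 * zeta_base s) + 3 / (1 - zeta_base s))) +
      poly_zeta gasket_poly (5/4) s * ((zeta_base s)\<^sup>2 / 2 * (3 / (1 - 3 * zeta_base s) - 1 / (1 - zeta_base s)))"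
    by (auto simp: summable_on_def spectral_zeta_def infsumI)
qed

end

section \<open>Counting eigenvalues\<close>

text \<open>The exponent is half the spectral dimension: scaling eigenvalues by 5 multiplies the
  count by 3.\<close>

lemma power5_powr: "(5 ^ N) powr (ln 9 / ln 5 / 2) = (3 :: real) ^ N"
proof -
  have "ln 9 = 2 * ln (3 :: real)" using ln_realpow[of 3 2] by simp
  then have "(5 ^ N) powr (ln 9 / ln 5 / 2) = exp (real N * ln (3 :: real))"
    by (simp add: powr_def ln_realpow)
  also have "\<dots> = 3 ^ N" by (simp add: exp_of_nat_mult)
  finally show ?thesis .
qed

lemma power5_between:
  fixes y :: real
  assumes "1 < y" obtains N :: nat where "5 ^ N < y" "y \<le> 5 ^ Suc N"
proof -
  define n where "n = (LEAST n. y \<le> 5 ^ n)"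
  obtain m where "y < 5 ^ m" using real_arch_pow[of 5 y] by auto
  then have n: "y \<le> 5 ^ n" unfolding n_def using LeastI[of "\<lambda>n. y \<le> 5 ^ n" m] by simp
  have "n \<noteq> 0" using n assms by (cases n) auto
  then obtain N where N: "n = Suc N" by (cases n) auto
  have "\<not> y \<le> 5 ^ N" using not_less_Least[of N "\<lambda>n. y \<le> 5 ^ n"] N by (simp add: n_def[symmetric])
  then show thesis using n unfolding N by (intro that[of N]) simp_all
qed

definition short_reduced :: "nat \<Rightarrow> bool list set" where
  "short_reduced L = {b \<in> reduced. length b \<le> L}"

text \<open>Padding with small branches on the left maps these words injectively into all words of
  length \<open>L\<close>.\<close>

lemma short_reduced_card: "finite (short_reduced L)" "card (short_reduced L) \<le> 2 ^ L"
proof -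
  let ?pad = "\<lambda>b. replicate (L - length b) False @ b"
  have inj: "inj_on ?pad (short_reduced L)"
    by (rule inj_onI) (auto intro: pad_unique simp: short_reduced_def)
  have sub: "?pad ` short_reduced L \<subseteq> bwords L" by (auto simp: short_reduced_def bwords_def)
  show "finite (short_reduced L)" using inj_on_finite[OF inj sub] by simp
  show "card (short_reduced L) \<le> 2 ^ L" using card_inj_on_le[OF inj sub] by (simp add: card_bwords)
qed

definition low_index :: "nat \<Rightarrow> (real \<times> nat \<times> bool list) set" where
  "low_index N = {p \<in> spectrum_index. Suc (fst (snd p)) + length (snd (snd p)) \<le> N}"

lemma low_index_eq:
  "low_index N = (\<lambda>(i, z, b). (z, i, b)) ` (SIGMA i:{..<N}. {3/4, 5/4} \<times> short_reduced (N - Suc i))"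
  by (force simp: low_index_def spectrum_index_def short_reduced_def image_iff)

lemma finite_low_index: "finite (low_index N)"
  unfolding low_index_eq by (intro finite_imageI finite_SigmaI finite_cartesian_product short_reduced_card) auto

text \<open>On level \<open>i + 1\<close> the two seeds together have multiplicity at most
  \<open>3 ^ Suc i\<close>, each with at most \<open>2 ^ (N - Suc i)\<close> words; births dominate,
  so the sum is of the order of \<open>3 ^ N\<close>.\<close>

lemma sum_low_index: "(\<Sum>p\<in>low_index N. born_mult (fst (snd p)) (fst p)) \<le> 3 ^ Suc N"
proof -
  have inj: "inj_on (\<lambda>(i, z, b). (z, i, b)) (SIGMA i:{..<N}. {3/4, 5/4 :: real} \<times> short_reduced (N - Suc i))"
    by (auto intro!: inj_onI)
  have "(\<Sum>p\<in>low_index N. born_mult (fst (snd p)) (fst p)) =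
     (\<Sum>i<N. \<Sum>q\<in>{3/4, 5/4} \<times> short_reduced (N - Suc i). born_mult i (fst q))"
    unfolding low_index_eq sum.reindex[OF inj]
    by (subst sum.Sigma) (auto simp: short_reduced_card case_prod_unfold intro!: finite_cartesian_product)
  also have "\<dots> = (\<Sum>i<N. (\<Sum>z\<in>{3/4, 5/4}. born_mult i z) * card (short_reduced (N - Suc i)))"
  proof (intro sum.cong refl)
    fix i
    have "(\<Sum>q\<in>{3/4, 5/4 :: real} \<times> short_reduced (N - Suc i). born_mult i (fst q)) =
        (\<Sum>z\<in>{3/4, 5/4}. \<Sum>b\<in>short_reduced (N - Suc i). born_mult i z)"
      by (simp only: sum.cartesian_product case_prod_unfold)
    also have "\<dots> = (\<Sum>z\<in>{3/4, 5/4}. born_mult i z) * card (short_reduced (N - Suc i))"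
      unfolding sum_distrib_right sum_constant by (intro sum.cong refl) simp
    finally show "(\<Sum>q\<in>{3/4, 5/4 :: real} \<times> short_reduced (N - Suc i). born_mult i (fst q)) =
        (\<Sum>z\<in>{3/4, 5/4}. born_mult i z) * card (short_reduced (N - Suc i))" .
  qed
  also have "\<dots> \<le> (\<Sum>i<N. 3 ^ Suc i * 2 ^ (N - Suc i))"
  proof (intro sum_mono mult_mono short_reduced_card)
    fix i
    have "(\<Sum>z\<in>{3/4, 5/4 :: real}. born_mult i z) = (3 ^ i + 3) div 2 + (3 ^ i - 1) div 2" by (simp add: born_mult_def)
    also have "\<dots> \<le> 3 ^ Suc i"
    proof -
      have "(q + 3) div 2 + (q - 1) div 2 \<le> 3 * q" if "1 \<le> q" for q :: nat
        using that div_times_less_eq_dividend[of "q + 3" 2] div_times_less_eq_dividend[of "q - 1" 2] by linarith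
      from this[of "3 ^ i"] show ?thesis by (simp only: power_Suc one_le_power one_le_numeral)
    qed
    finally show "(\<Sum>z\<in>{3/4, 5/4 :: real}. born_mult i z) \<le> 3 ^ Suc i" .
  qed auto
  also have "\<dots> \<le> 3 ^ Suc N"
  proof (induction N)
    case (Suc N)
    have "(\<Sum>i<N. 3 ^ Suc i * 2 ^ (Suc N - Suc i)) = 2 * (\<Sum>i<N. 3 ^ Suc i * 2 ^ (N - Suc i) :: nat)"
      unfolding sum_distrib_left
    proof (intro sum.cong refl)
      fix i assume "i \<in> {..<N}"
      then have "Suc N - Suc i = Suc (N - Suc i)" by auto
      then show "(3 :: nat) ^ Suc i * 2 ^ (Suc N - Suc i) = 2 * (3 ^ Suc i * 2 ^ (N - Suc i))"
        by (simp only: power_Suc mult_ac)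
    qed
    then show ?case using Suc by simp
  qed simp
  finally show ?thesis .
qed

context gasket_space
begin

lemma eigen_count_upper:
  assumes "x \<le> 5/8 * 5 ^ Suc N"
  shows "finite {j \<in> eigen_index v S \<mu>. fst j < x}" "eigen_count v S \<mu> x \<le> 3 ^ Suc N"
proof -
  let ?h = "\<lambda>(p, k). (eigenvalue p, k)"
  let ?M = "SIGMA p:low_index N. {..<born_mult (fst (snd p)) (fst p)}"
  have sub: "{j \<in> eigen_index v S \<mu>. fst j < x} \<subseteq> ?h ` ?M"
  proof
    fix j assume "j \<in> {j \<in> eigen_index v S \<mu>. fst j < x}"
    then have j: "j \<in> eigen_index v S \<mu>" "fst j < x" by auto
    obtain p k where p: "p \<in> spectrum_index" "k < born_mult (fst (snd p)) (fst p)" "j = (eigenvalue p, k)"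
      using j(1) unfolding eigen_index_eq by auto
    have "5/8 * 5 ^ (Suc (fst (snd p)) + length (snd (snd p))) < (5/8 * 5 ^ Suc N :: real)"
      using eigenvalue_ge(1)[OF p(1)] j(2) assms unfolding p(3) fst_conv
      by (meson le_less_trans less_le_trans)
    then have "(5 :: real) ^ (Suc (fst (snd p)) + length (snd (snd p))) < 5 ^ Suc N"
      by (simp only: mult_less_cancel_left_pos zero_less_divide_iff zero_less_numeral simp_thms)
    then have "Suc (fst (snd p)) + length (snd (snd p)) < Suc N" by (rule power_less_imp_less_exp[rotated]) simp
    then have "p \<in> low_index N" using p(1) by (simp add: low_index_def)
    then show "j \<in> ?h ` ?M" using p by force
  qed
  have fin: "finite ?M" by (intro finite_SigmaI finite_low_index) auto
  show "finite {j \<in> eigen_index v S \<mu>. fst j < x}" using sub fin by (meson finite_imageI finite_subset)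
  have "eigen_count v S \<mu> x \<le> card ?M"
    unfolding eigen_count_def using sub fin by (meson card_image_le card_mono finite_imageI le_trans)
  also have "\<dots> = (\<Sum>p\<in>low_index N. born_mult (fst (snd p)) (fst p))"
    by (subst card_SigmaI) (auto simp: finite_low_index)
  also have "\<dots> \<le> 3 ^ Suc N" by (rule sum_low_index)
  finally show "eigen_count v S \<mu> x \<le> 3 ^ Suc N" .
qed

text \<open>A single eigenvalue suffices: the one born from 3/4 on level \<open>i + 1\<close> and
  continued by small branches only already has multiplicity \<open>(3 ^ i + 3) / 2\<close>.\<close>

lemma eigen_count_lower:
  assumes "5 ^ Suc i * koenigs (3/4) < x"
  shows "3 ^ i / 2 \<le> real (eigen_count v S \<mu> x)"
proof -
  have p: "(3/4, i, []) \<in> spectrum_index" by (simp add: spectrum_index_def reduced_def)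
  obtain N where "8/5 * x < 5 ^ N" using real_arch_pow[of 5 "8/5 * x"] by auto
  moreover have "(5 :: real) ^ N \<le> 5 ^ Suc N" by simp
  ultimately have "x \<le> 5/8 * 5 ^ Suc N" by linarith
  then have fin: "finite {j \<in> eigen_index v S \<mu>. fst j < x}" by (rule eigen_count_upper)
  have "(\<lambda>k. (eigenvalue (3/4, i, []), k)) ` {..<born_mult i (3/4)} \<subseteq> {j \<in> eigen_index v S \<mu>. fst j < x}"
    using assms eigen_mult_eigenvalue[OF p] eigenvalue_ge(2)[OF p]
    by (auto simp: eigen_index_def) (auto simp: eigenvalue_def)
  from card_mono[OF fin this] have "born_mult i (3/4) \<le> eigen_count v S \<mu> x"
    by (simp add: eigen_count_def card_image inj_on_def)
  moreover have "3 ^ i / 2 \<le> real (born_mult i (3/4))"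
  proof -
    have "2 * born_mult i (3/4) = 3 ^ i + 3" by (simp add: born_mult_def)
    then have "2 * real (born_mult i (3/4)) = 3 ^ i + 3" by (metis of_nat_add of_nat_mult of_nat_numeral of_nat_power)
    then show ?thesis by simp
  qed
  ultimately show ?thesis by (meson of_nat_le_iff order_trans)
qed

lemma eigen_count_asymptotics:
  obtains c C where "0 < c"
    "\<forall>\<^sub>F x in at_top. c \<le> real (eigen_count v S \<mu> x) * x powr (- (ln 9 / ln 5) / 2)"
    "\<forall>\<^sub>F x in at_top. real (eigen_count v S \<mu> x) * x powr (- (ln 9 / ln 5) / 2) \<le> C"
proof
  define a :: real where "a = ln 9 / ln 5 / 2"
  define K where "K = koenigs (3/4)"
  have K: "0 < K" unfolding K_def by (rule koenigs_pos) auto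
  have a0: "0 \<le> a" by (simp add: a_def)
  have exponent: "- (ln 9 / ln 5) / 2 = - a" by (simp add: a_def)
  show "0 < (25 * K) powr - a / 2" using K by simp
  show "\<forall>\<^sub>F x in at_top. (25 * K) powr - a / 2 \<le> real (eigen_count v S \<mu> x) * x powr (- (ln 9 / ln 5) / 2)"
    using eventually_gt_at_top[of "5 * K"]
  proof eventually_elim
    case (elim x)
    have "1 < x / (5 * K)" using elim K by simp
    then obtain i where i: "5 ^ i < x / (5 * K)" "x / (5 * K) \<le> 5 ^ Suc i" by (rule power5_between)
    \<comment> \<open>\<open>x\<close> lies between \<open>5 ^ (i + 1) * K\<close> and
      \<open>5 ^ (i + 2) * K\<close>; this is the origin of the 25.\<close>
    have "5 ^ Suc i * K < x" "x \<le> 25 * K * 5 ^ i" using i K by (simp_all add: field_simps)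
    have "(25 * K) powr - a * inverse (3 ^ i) = (25 * K * 5 ^ i) powr - a"
      using power5_powr[of i] K by (simp add: powr_mult powr_minus a_def)
    also have "\<dots> \<le> x powr - a" using \<open>x \<le> 25 * K * 5 ^ i\<close> elim K a0 by (intro powr_mono2') auto
    finally have "(3 ^ i / 2) * ((25 * K) powr - a * inverse (3 ^ i)) \<le> real (eigen_count v S \<mu> x) * x powr - a"
      using eigen_count_lower[of i x] \<open>5 ^ Suc i * K < x\<close> by (intro mult_mono) (auto simp: K_def)
    moreover have "(3 ^ i / 2) * (y * inverse (3 ^ i)) = y / 2" for y :: real by simp
    ultimately show ?case unfolding exponent by (simp only:)
  qed
  show "\<forall>\<^sub>F x in at_top. real (eigen_count v S \<mu> x) * x powr (- (ln 9 / ln 5) / 2) \<le> 3 * (5/8) powr - a"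
    using eventually_gt_at_top[of "5/8"]
  proof eventually_elim
    case (elim x)
    have "1 < 8/5 * x" using elim by simp
    then obtain N where N: "5 ^ N < 8/5 * x" "8/5 * x \<le> 5 ^ Suc N" by (rule power5_between)
    have "real (eigen_count v S \<mu> x) \<le> 3 ^ Suc N"
    proof -
      have "x \<le> 5/8 * 5 ^ Suc N" using N(2) by linarith
      from of_nat_mono[OF eigen_count_upper(2)[OF this]] show ?thesis
        by (simp only: of_nat_power of_nat_numeral)
    qed
    moreover have "x powr - a \<le> (5/8 * 5 ^ N) powr - a" using N(1) a0 by (intro powr_mono2') auto
    moreover have "(5/8 * 5 ^ N) powr - a = (5/8) powr - a * inverse (3 ^ N)"
    proof -
      have "(5 ^ N) powr - a = inverse (3 ^ N)" unfolding powr_minus a_def power5_powr ..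
      then show ?thesis unfolding powr_mult by (rule arg_cong)
    qed
    ultimately have "real (eigen_count v S \<mu> x) * x powr - a \<le> 3 ^ Suc N * ((5/8) powr - a * inverse (3 ^ N))"
      by (intro mult_mono) auto
    moreover have "3 ^ Suc N * (y * inverse (3 ^ N)) = 3 * y" for y :: real by simp
    ultimately show ?case unfolding exponent by (simp only:)
  qed
qed

lemma is_spectral_dim_ln: "is_spectral_dim v S \<mu> (ln 9 / ln 5)"
proof -
  obtain c C where c: "0 < c"
    "\<forall>\<^sub>F x in at_top. c \<le> real (eigen_count v S \<mu> x) * x powr (- (ln 9 / ln 5) / 2)"
    "\<forall>\<^sub>F x in at_top. real (eigen_count v S \<mu> x) * x powr (- (ln 9 / ln 5) / 2) \<le> C"
    using eigen_count_asymptotics by blast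
  have "ereal c \<le> Liminf at_top (\<lambda>x. ereal (real (eigen_count v S \<mu> x) * x powr (- (ln 9 / ln 5) / 2)))"
    by (rule Liminf_bounded) (use c(2) in \<open>simp del: minus_divide_left\<close>)
  moreover have "Limsup at_top (\<lambda>x. ereal (real (eigen_count v S \<mu> x) * x powr (- (ln 9 / ln 5) / 2))) \<le> ereal C"
    by (rule Limsup_bounded) (use c(3) in \<open>simp del: minus_divide_left\<close>)
  moreover have "0 < ereal c" "ereal C < \<infinity>" using c(1) by auto
  ultimately show ?thesis unfolding is_spectral_dim_def using less_le_trans le_less_trans by blast
qed

text \<open>\<open>spectral_dim\<close> is a definite description and thus depends on uniqueness.
  Another exponent inserts a factor \<open>x powr e\<close> with nonzero \<open>e\<close>, which
  sends the quotient to 0 or to infinity.\<close>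

lemma is_spectral_dim_unique:
  assumes "is_spectral_dim v S \<mu> d" shows "d = ln 9 / ln 5"
proof (rule ccontr)
  assume ne: "d \<noteq> ln 9 / ln 5"
  define e :: real where "e = (ln 9 / ln 5 - d) / 2"
  let ?f = "\<lambda>x. real (eigen_count v S \<mu> x) * x powr (- (ln 9 / ln 5) / 2)"
  let ?g = "\<lambda>x. real (eigen_count v S \<mu> x) * x powr (- d / 2)"
  obtain c C where c: "0 < c" "\<forall>\<^sub>F x in at_top. c \<le> ?f x" "\<forall>\<^sub>F x in at_top. ?f x \<le> C"
    using eigen_count_asymptotics by blast
  have gf: "?g x = ?f x * x powr e" if "0 < x" for x
  proof -
    have "- d / 2 = - (ln 9 / ln 5) / 2 + e" unfolding e_def by argo
    then show ?thesis by (simp only: powr_add mult.assoc)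
  qed
  have L: "0 < Liminf at_top (\<lambda>x. ereal (?g x))" "Limsup at_top (\<lambda>x. ereal (?g x)) < \<infinity>"
    using assms by (auto simp: is_spectral_dim_def)
  show False
  proof (cases "e < 0")
    case True
    have "(?g \<longlongrightarrow> 0) at_top"
    proof (rule tendsto_sandwich[of "\<lambda>_. 0" _ _ "\<lambda>x. C * x powr e"])
      show "\<forall>\<^sub>F x in at_top. ?g x \<le> C * x powr e"
        using c(3) eventually_gt_at_top[of 0]
      proof eventually_elim
        case (elim x)
        show ?case unfolding gf[OF elim(2)] by (rule mult_right_mono[OF elim(1)]) simp
      qed
      show "((\<lambda>x. C * x powr e) \<longlongrightarrow> 0) at_top"
        by (intro tendsto_mult_right_zero tendsto_neg_powr True filterlim_ident)
    qed auto
    then have "((\<lambda>x. ereal (?g x)) \<longlongrightarrow> ereal 0) at_top" by (rule tendsto_ereal)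
    then have "Liminf at_top (\<lambda>x. ereal (?g x)) = ereal 0" by (intro lim_imp_Liminf) auto
    then show False using L(1) by simp
  next
    case False
    then have e: "0 < e" using ne by (simp add: e_def)
    have "((\<lambda>x. inverse (x powr e)) \<longlongrightarrow> 0) at_top"
      using tendsto_neg_powr[of "- e" "\<lambda>x. x" at_top] e by (simp add: powr_minus filterlim_ident)
    moreover have "\<forall>\<^sub>F x in at_top. 0 < inverse (x powr e)"
      using eventually_gt_at_top[of 0] by eventually_elim simp
    ultimately have "filterlim (\<lambda>x. inverse (inverse (x powr e))) at_top at_top"
      by (rule filterlim_inverse_at_top)
    then have "filterlim (\<lambda>x. c * x powr e) at_top at_top"
      using c(1) by (intro filterlim_tendsto_pos_mult_at_top[OF tendsto_const]) auto
    moreover have "\<forall>\<^sub>F x in at_top. c * x powr e \<le> ?g x"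
      using c(2) eventually_gt_at_top[of 0]
    proof eventually_elim
      case (elim x)
      show ?case unfolding gf[OF elim(2)] by (rule mult_right_mono[OF elim(1)]) simp
    qed
    ultimately have "filterlim ?g at_top at_top" by (rule filterlim_at_top_mono)
    then have "((\<lambda>x. ereal (?g x)) \<longlongrightarrow> \<infinity>) at_top" by (subst tendsto_PInfty_eq_at_top)
    then have "Limsup at_top (\<lambda>x. ereal (?g x)) = \<infinity>" by (intro lim_imp_Limsup) auto
    then show False using L(2) by simp
  qed
qed

lemma spectral_dim_eq: "spectral_dim v S \<mu> = ln 9 / ln 5"
  unfolding spectral_dim_def using is_spectral_dim_ln is_spectral_dim_unique by (rule the_equality)

end

section \<open>The meromorphic continuation\<close>

text \<open>Write \<open>P\<close> for the zeta function of 5/4 and express that of 3/4 as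
  \<open>P + zeta_diff s\<close>. Over the common denominator \<open>P\<close> receives the
  coefficient \<open>t * (2 - 5 * t) + t\<^sup>2 = 2 * t * (1 - 2 * t)\<close>, and
  \<open>(1 - 2 * t) * P\<close> is \<open>zeta_regular\<close>.\<close>

definition zeta_numerator :: "complex \<Rightarrow> complex" where
  "zeta_numerator s = zeta_base s * (2 - 5 * zeta_base s) * zeta_diff s + 2 * zeta_base s * zeta_regular s"

definition zeta_denominator :: "complex \<Rightarrow> complex" where
  "zeta_denominator s = (1 - 3 * zeta_base s) * (1 - zeta_base s)"

lemma zeta_quotient:
  assumes s: "ln 9 / ln 5 < Re s"
  defines "t \<equiv> zeta_base s"
  shows "poly_zeta gasket_poly (3/4) s * (t / 2 * (1 / (1 - 3 * t) + 3 / (1 - t))) +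
      poly_zeta gasket_poly (5/4) s * (t\<^sup>2 / 2 * (3 / (1 - 3 * t) - 1 / (1 - t))) =
      zeta_numerator s / zeta_denominator s" "zeta_denominator s \<noteq> 0"
proof -
  have s4: "ln 4 / ln 5 < Re s" using s ln_4_9 by linarith
  have t3: "norm (3 * t) < 1" unfolding t_def by (rule norm_zeta_base_third[OF s])
  then have "norm t < 1" by (simp add: norm_mult)
  then have "3 * t \<noteq> 1" "t \<noteq> 1" using t3 by (metis norm_one less_irrefl)+
  then have nz: "1 - 3 * t \<noteq> 0" "1 - t \<noteq> 0" by simp_all
  then show "zeta_denominator s \<noteq> 0" by (simp add: zeta_denominator_def t_def)
  define D where "D = (1 - 3 * t) * (1 - t)"
  have A: "t / 2 * (1 / (1 - 3 * t) + 3 / (1 - t)) = t * (2 - 5 * t) / D"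
  proof -
    have "t / 2 * (1 * (1 - t) + 3 * (1 - 3 * t)) = t * (2 - 5 * t)" by (simp add: algebra_simps)
    then show ?thesis unfolding D_def add_frac_eq[OF nz] times_divide_eq_right by (rule arg_cong)
  qed
  have B: "t\<^sup>2 / 2 * (3 / (1 - 3 * t) - 1 / (1 - t)) = t\<^sup>2 / D"
  proof -
    have "t\<^sup>2 / 2 * (3 * (1 - t) - 1 * (1 - 3 * t)) = t\<^sup>2" by (simp add: algebra_simps)
    then show ?thesis unfolding D_def diff_frac_eq[OF nz] times_divide_eq_right by (rule arg_cong)
  qed
  let ?P = "poly_zeta gasket_poly (5/4) s"
  have "poly_zeta gasket_poly (3/4) s * (t * (2 - 5 * t) / D) + ?P * (t\<^sup>2 / D) =
     ((?P + zeta_diff s) * (t * (2 - 5 * t)) + ?P * t\<^sup>2) / D"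
    unfolding poly_zeta_diff[OF s4] by (simp add: add_divide_distrib)
  also have "(?P + zeta_diff s) * (t * (2 - 5 * t)) + ?P * t\<^sup>2 = t * (2 - 5 * t) * zeta_diff s + 2 * t * ((1 - 2 * t) * ?P)"
    by (simp add: algebra_simps power2_eq_square)
  also have "(1 - 2 * t) * ?P = zeta_regular s" unfolding t_def by (rule poly_zeta_regular[OF s4])
  finally show "poly_zeta gasket_poly (3/4) s * (t / 2 * (1 / (1 - 3 * t) + 3 / (1 - t))) +
      poly_zeta gasket_poly (5/4) s * (t\<^sup>2 / 2 * (3 / (1 - 3 * t) - 1 / (1 - t))) =
      zeta_numerator s / zeta_denominator s"
    unfolding A B by (simp add: zeta_numerator_def zeta_denominator_def t_def D_def)
qed

lemma zeta_base_eq_exp: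
  assumes "zeta_base s = exp (- of_real r)"
  shows "\<exists>n::int. s = (of_real (2 * r) + 2 * \<i> * of_int n * of_real pi) / of_real (ln 5)"
proof -
  have "exp (- s / 2 * of_real (ln 5)) = exp (- of_real r)" using assms by (simp add: zeta_term_exp)
  then obtain n :: int where "- s / 2 * of_real (ln 5) = - of_real r + (of_int (2 * n) * pi) * \<i>"
    unfolding exp_eq by blast
  then have "- 2 * (- s / 2 * of_real (ln 5)) = - 2 * (- of_real r + (of_int (2 * n) * pi) * \<i>)" by (rule arg_cong)
  moreover have "- 2 * (- s / 2 * of_real (ln 5)) = s * of_real (ln 5)" by simp
  moreover have "- 2 * (- of_real r + (of_int (2 * n) * pi) * \<i>) =
      of_real (2 * r) + 2 * \<i> * of_int (- 2 * n) * of_real pi"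
    by (simp add: algebra_simps)
  ultimately have "s * of_real (ln 5) = of_real (2 * r) + 2 * \<i> * of_int (- 2 * n) * of_real pi"
    by (simp only:)
  moreover have "complex_of_real (ln 5) \<noteq> 0" by simp
  ultimately show ?thesis by (intro exI[of _ "- 2 * n"]) (simp add: nonzero_eq_divide_eq)
qed

lemma zeta_denominator_zeros:
  assumes "zeta_denominator s = 0"
  shows "s \<in> {2 * \<i> * of_int n * of_real pi / of_real (ln 5) | n :: int. True} \<union>
    {(of_real (ln 9) + 2 * \<i> * of_int n * of_real pi) / of_real (ln 5) | n :: int. True}"
proof -
  have "1 - 3 * zeta_base s = 0 \<or> 1 - zeta_base s = 0" using assms unfolding zeta_denominator_def by (rule mult_eq_0_iff[THEN iffD1])
  then have "zeta_base s = 1 \<or> zeta_base s = 1/3" by (auto simp: field_simps)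
  then show ?thesis
  proof
    assume "zeta_base s = 1"
    then have "zeta_base s = exp (- of_real 0)" by simp
    from zeta_base_eq_exp[OF this] show ?thesis by auto
  next
    assume "zeta_base s = 1/3"
    moreover have "exp (complex_of_real (ln 3)) = 3" unfolding exp_of_real by simp
    then have "exp (- complex_of_real (ln 3)) = 1/3" by (simp add: exp_minus inverse_eq_divide)
    ultimately have "zeta_base s = exp (- of_real (ln 3))" by (simp only:)
    moreover have "2 * ln 3 = ln (9 :: real)" using ln_realpow[of 3 2] by simp
    ultimately show ?thesis using zeta_base_eq_exp[of s "ln 3"] by auto
  qed
qed

lemma zeta_parts_holomorphic:
  "zeta_numerator holomorphic_on {s. - 1 < Re s}" "zeta_denominator holomorphic_on {s. - 1 < Re s}"
  unfolding zeta_numerator_def zeta_denominator_def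
  by (intro holomorphic_intros zeta_base_holomorphic zeta_diff_regular_holomorphic)+

text \<open>With division by zero yielding 0, the plain quotient may have wrong values where
  numerator and denominator vanish together; \<open>remove_sings\<close> fills in the limits, as
  \<open>nicely_meromorphic_on\<close> demands.\<close>

definition zeta_continuation :: "complex \<Rightarrow> complex" where
  "zeta_continuation = remove_sings (\<lambda>s. zeta_numerator s / zeta_denominator s)"

lemma zeta_quotient_analytic:
  assumes "- 1 < Re s" "zeta_denominator s \<noteq> 0"
  shows "(\<lambda>s. zeta_numerator s / zeta_denominator s) analytic_on {s}"
proof -
  have "zeta_numerator analytic_on {s}" "zeta_denominator analytic_on {s}"
    using zeta_parts_holomorphic assms(1) open_halfplane
    by (auto simp: analytic_on_open[symmetric] intro: analytic_on_subset)
  then show ?thesis using assms(2) by (intro analytic_intros) auto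
qed

lemma zeta_continuation_meromorphic: "zeta_continuation nicely_meromorphic_on {s. - 1 < Re s}"
  unfolding zeta_continuation_def
  by (intro remove_sings_nicely_meromorphic meromorphic_on_divide analytic_on_imp_meromorphic_on)
    (simp_all add: analytic_on_open open_halfplane zeta_parts_holomorphic)

lemma zeta_continuation_poles:
  assumes "- 1 < Re s" "is_pole zeta_continuation s" shows "zeta_denominator s = 0"
proof (rule ccontr)
  assume "zeta_denominator s \<noteq> 0"
  then have a: "(\<lambda>s. zeta_numerator s / zeta_denominator s) analytic_on {s}"
    by (rule zeta_quotient_analytic[OF assms(1)])
  have "zeta_continuation analytic_on {s}"
    unfolding zeta_continuation_def
    using a analytic_at_cong[OF eventually_remove_sings_eq_nhds[OF a] refl] by simp
  then show False using assms(2) analytic_at_imp_no_pole by blast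
qed

theorem theorem6:
  fixes v :: "3 \<Rightarrow> real^2" and S :: "(real^2) set" and \<mu> :: "(real^2) measure"
  assumes triangle: "\<not> collinear (range v)"
    and gasket: "is_gasket v S"
    and meas: "is_gasket_measure v S \<mu>"
  defines "d\<^sub>s \<equiv> spectral_dim v S \<mu>"
    and "d\<^sub>R \<equiv> poly_zeta_dim gasket_poly"
  shows
    "(\<forall>s. Re s > d\<^sub>s \<longrightarrow>
        eigen_term s summable_on eigen_index v S \<mu> \<and>
        convergent (poly_zeta_approx gasket_poly (3/4) s) \<and>
        convergent (poly_zeta_approx gasket_poly (5/4) s) \<and>
        spectral_zeta v S \<mu> s =
          poly_zeta gasket_poly (3/4) s * (5 powr (- s / 2) / 2) *
            (1 / (1 - 3 * 5 powr (- s / 2)) + 3 / (1 - 5 powr (- s / 2))) +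
          poly_zeta gasket_poly (5/4) s * (5 powr (- s) / 2) *
            (3 / (1 - 3 * 5 powr (- s / 2)) - 1 / (1 - 5 powr (- s / 2))))
     \<and> (\<exists>\<epsilon>\<ge>1. \<exists>Z.
          Z nicely_meromorphic_on {s. Re s > - \<epsilon>} \<and>
          (\<forall>s. Re s > d\<^sub>s \<longrightarrow> Z s = spectral_zeta v S \<mu> s) \<and>
          {s. Re s > - \<epsilon> \<and> is_pole Z s} \<subseteq>
            {2 * \<i> * of_int n * of_real pi / of_real (ln 5) | n :: int. True} \<union>
            {(of_real (ln 9) + 2 * \<i> * of_int n * of_real pi) / of_real (ln 5) | n :: int. True})
     \<and> is_spectral_dim v S \<mu> d\<^sub>s
     \<and> 0 < ln 4 / ln (5::real) \<and> ln 4 / ln 5 = d\<^sub>R \<and> d\<^sub>R < 1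
     \<and> 1 < d\<^sub>s \<and> d\<^sub>s = ln 9 / ln 5 \<and> d\<^sub>s < 2"
proof -
  interpret gasket_space v S \<mu> by unfold_locales (fact triangle gasket meas)+
  have ds: "d\<^sub>s = ln 9 / ln 5" unfolding d\<^sub>s_def by (rule spectral_dim_eq)
  have dR: "d\<^sub>R = ln 4 / ln 5"
    using ln_realpow[of 2 2] by (simp add: d\<^sub>R_def poly_zeta_dim_def degree_gasket_poly pderiv_gasket_poly)
  have base: "zeta_base s = 5 powr (- s / 2)" for s by (simp add: zeta_term_def)
  have base2: "(5 powr (- s / 2) :: complex)\<^sup>2 = 5 powr (- s)" for s
    by (simp add: power2_eq_square powr_add[symmetric])
  have zeta: "eigen_term s summable_on eigen_index v S \<mu> \<and>
        convergent (poly_zeta_approx gasket_poly (3/4) s) \<and>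
        convergent (poly_zeta_approx gasket_poly (5/4) s) \<and>
        spectral_zeta v S \<mu> s =
          poly_zeta gasket_poly (3/4) s * (5 powr (- s / 2) / 2) *
            (1 / (1 - 3 * 5 powr (- s / 2)) + 3 / (1 - 5 powr (- s / 2))) +
          poly_zeta gasket_poly (5/4) s * (5 powr (- s) / 2) *
            (3 / (1 - 3 * 5 powr (- s / 2)) - 1 / (1 - 5 powr (- s / 2)))"
    if "Re s > d\<^sub>s" for s
  proof (intro conjI)
    have s: "ln 9 / ln 5 < Re s" using that ds by simp
    have s4: "ln 4 / ln 5 < Re s" using s ln_4_9 by linarith
    show "eigen_term s summable_on eigen_index v S \<mu>" by (rule spectral_zeta_eq(1)[OF s])
    show "convergent (poly_zeta_approx gasket_poly (3/4) s)" "convergent (poly_zeta_approx gasket_poly (5/4) s)"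
      by (rule convergentI, rule poly_zeta_LIMSEQ(1)[OF _ _ s4]; simp)+
    show "spectral_zeta v S \<mu> s =
          poly_zeta gasket_poly (3/4) s * (5 powr (- s / 2) / 2) *
            (1 / (1 - 3 * 5 powr (- s / 2)) + 3 / (1 - 5 powr (- s / 2))) +
          poly_zeta gasket_poly (5/4) s * (5 powr (- s) / 2) *
            (3 / (1 - 3 * 5 powr (- s / 2)) - 1 / (1 - 5 powr (- s / 2)))"
      using spectral_zeta_eq(2)[OF s] unfolding base base2 by (simp only: mult.assoc)
  qed
  have cont: "zeta_continuation s = spectral_zeta v S \<mu> s" if "Re s > d\<^sub>s" for s
  proof -
    have s: "ln 9 / ln 5 < Re s" using that ds by simp
    have "- 1 < Re s" using s ln_4_9 by linarith
    then have "zeta_continuation s = zeta_numerator s / zeta_denominator s"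
      unfolding zeta_continuation_def by (intro remove_sings_at_analytic zeta_quotient_analytic zeta_quotient(2)[OF s])
    then show ?thesis using zeta_quotient(1)[OF s] spectral_zeta_eq(2)[OF s] by simp
  qed
  have poles: "{s. Re s > - 1 \<and> is_pole zeta_continuation s} \<subseteq>
            {2 * \<i> * of_int n * of_real pi / of_real (ln 5) | n :: int. True} \<union>
            {(of_real (ln 9) + 2 * \<i> * of_int n * of_real pi) / of_real (ln 5) | n :: int. True}"
    using zeta_continuation_poles zeta_denominator_zeros by blast
  have "\<exists>\<epsilon>\<ge>1. \<exists>Z.
          Z nicely_meromorphic_on {s. Re s > - \<epsilon>} \<and>
          (\<forall>s. Re s > d\<^sub>s \<longrightarrow> Z s = spectral_zeta v S \<mu> s) \<and>
          {s. Re s > - \<epsilon> \<and> is_pole Z s} \<subseteq>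
            {2 * \<i> * of_int n * of_real pi / of_real (ln 5) | n :: int. True} \<union>
            {(of_real (ln 9) + 2 * \<i> * of_int n * of_real pi) / of_real (ln 5) | n :: int. True}"
    \<comment> \<open>The witness for \<open>\<epsilon>\<close> is 1, the half-plane in which
      \<open>2/5 * sqrt 5 < 1\<close> gives convergence of the remainder series.\<close>
    using zeta_continuation_meromorphic cont poles by (intro exI[of _ 1] exI[of _ zeta_continuation] conjI) auto
  then show ?thesis
    using zeta is_spectral_dim_ln ln_4_9 unfolding dR by (simp only: ds) blast
qed

end
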